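(* Assume $F_0$ is in the domain of attraction of the GEV law with extreme value index $\gamma_0>-1/2$ and that the second-order condition (a)-(b) stated in the context holds. There is $\varepsilon>0$ such that, for the local maximum likelihood estimator $$\widehat{\boldsymbol\theta}_n\in\mathop{\mathrm{argmax}}_{\boldsymbol\theta\in B(\boldsymbol\theta_0,\varepsilon)}L_n(\boldsymbol\theta),$$ the following holds. For any $R=R(n)\to\infty$ satisfying $R=o(\sqrt k)$ we have $\|\widehat{\boldsymbol\theta}_n-\boldsymbol\theta_0\|=O_{\mathbb P}(R/\sqrt k)$. Accordingly, the local maximum likelihood estimator $\widehat{\boldsymbol\vartheta}_n=(\widehat\gamma_n,\widehat\sigma_n)^\top=r^{-1}(\widehat{\boldsymbol\theta}_n)$ is, after normalisation, $\sqrt k$-consistent, i.e. $$\widehat\gamma_n=\gamma_0+O_{\mathbb P}(1/\sqrt k)\quad\text{and}\quad\widehat\sigma_n=a_0(n/k)\big(1+O_{\mathbb P}(1/\sqrt k)\big),$$ and it is unique with probability tending to one as $n\to\infty$.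
   Context: Expressions at $\gamma=0$ (or $\gamma_0=0$) are read as limits, e.g. $(y^{\gamma}-1)/\gamma=\log y$. $Y_1,\dots,Y_n$ are i.i.d. with distribution function $F_0$, order statistics $Y_{1,n}\le\dots\le Y_{n,n}$. Set $F^{\leftarrow}(u)=\inf\{x:F(x)\ge u\}$, $U_0(t)=F_0^{\leftarrow}(1-1/t)$. $F_0\in\mathcal D(G_{\gamma_0})$ means that there is a positive function $a_0$ with $\lim_{t\to\infty}\{U_0(ty)-U_0(t)\}/a_0(t)=(y^{\gamma_0}-1)/\gamma_0$ for all $y>0$. $k=k(n)$ is an intermediate sequence: $k\to\infty$, $k=o(n)$. Second-order condition: there is a positive or negative function $A$ with $A(t)\to0$ as $t\to\infty$ such that (a) $A$ is regularly varying with index $\rho\le0$ and, for all $x>0$, $$\lim_{t\to\infty}\frac{\frac{U_0(tx)-U_0(t)}{a_0(t)}-\frac{x^{\gamma_0}-1}{\gamma_0}}{A(t)}=\int_1^xv^{\gamma_0-1}\int_1^vu^{\rho-1}\,du\,dv;$$ (b) $\sqrt kA(n/k)\to\lambda\in\mathbb R$. Parameter space $\Theta=(-1/2,\infty)\times(0,\infty)$. For $\boldsymbol\theta=(\gamma,\sigma)^\top\in\Theta$ and $z\ge0$, the generalised Pareto log-likelihood is $\ell_{\boldsymbol\theta}(z)=-\log\sigma-(1+1/\gamma)\log(1+\gamma z/\sigma)$ if $1+\gamma z/\sigma>0$ and $-\infty$ otherwise. Let $Z_i=(Y_{n-i+1,n}-Y_{n-k,n})/a_0(n/k)$, $1\le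 i\le k$; $L_n(\boldsymbol\theta)=k^{-1}\sum_{i=1}^k\ell_{\boldsymbol\theta}(Z_i)$. The map $r:\Theta\to\Theta$ is $r(\gamma,\sigma)=(\gamma,\sigma/a_0(n/k))^\top$; $\boldsymbol\theta_0=(\gamma_0,1)^\top$. $B(\boldsymbol\theta_0,\varepsilon)=\{\boldsymbol\theta\in\Theta:\|\boldsymbol\theta-\boldsymbol\theta_0\|<\varepsilon\}$. *)

theory Defs
  imports "HOL-Probability.Probability" "HOL-Library.Landau_Symbols"
begin

text \<open>Tail quantile function \<open>U(t) = F\<^sup>\<leftarrow>(1 - 1/t)\<close>. All functions of \<open>t\<close> below matter
  only for \<open>t > 1\<close>, where \<open>1 - 1/t\<close> lies in \<open>(0,1)\<close>.\<close>

definition quantile :: "(real \<Rightarrow> real) \<Rightarrow> real \<Rightarrow> real" where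
  "quantile F u = Inf {x. F x \<ge> u}"

definition tail_quantile :: "(real \<Rightarrow> real) \<Rightarrow> real \<Rightarrow> real" where
  "tail_quantile F t = quantile F (1 - 1 / t)"

definition box_cox :: "real \<Rightarrow> real \<Rightarrow> real" where
  "box_cox \<gamma> y = (if \<gamma> = 0 then ln y else (y powr \<gamma> - 1) / \<gamma>)"

text \<open>\<open>F\<close> is in the domain of attraction of the GEV law with index \<open>\<gamma>\<close>, with the auxiliary
  function \<open>a\<close> made explicit because the later conditions refer to it.\<close>

definition gev_attraction :: "(real \<Rightarrow> real) \<Rightarrow> real \<Rightarrow> (real \<Rightarrow> real) \<Rightarrow> bool" where
  "gev_attraction F \<gamma> a \<longleftrightarrow>
     (\<forall>t>1. a t > 0) \<and>
     (\<forall>y>0. ((\<lambda>t. (tail_quantile F (t * y) - tail_quantile F t) / a t)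
              \<longlongrightarrow> box_cox \<gamma> y) at_top)"

definition regularly_varying :: "(real \<Rightarrow> real) \<Rightarrow> real \<Rightarrow> bool" where
  "regularly_varying A \<rho> \<longleftrightarrow>
     A \<in> borel_measurable (lebesgue_on {1<..}) \<and>
     (\<forall>x>0. ((\<lambda>t. A (t * x) / A t) \<longlongrightarrow> x powr \<rho>) at_top)"

text \<open>The interval integrals are oriented, so \<open>x < 1\<close> is covered.\<close>

definition second_order ::
  "(real \<Rightarrow> real) \<Rightarrow> real \<Rightarrow> (real \<Rightarrow> real) \<Rightarrow> (real \<Rightarrow> real) \<Rightarrow> real \<Rightarrow> bool" where
  "second_order F \<gamma> a A \<rho> \<longleftrightarrow>
     ((\<forall>t>1. A t > 0) \<or> (\<forall>t>1. A t < 0)) \<and>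
     (A \<longlongrightarrow> 0) at_top \<and>
     \<rho> \<le> 0 \<and> regularly_varying A \<rho> \<and>
     (\<forall>x>0. ((\<lambda>t. ((tail_quantile F (t * x) - tail_quantile F t) / a t - box_cox \<gamma> x) / A t)
        \<longlongrightarrow> (LBINT v=1..x. v powr (\<gamma> - 1) * (LBINT u=1..v. u powr (\<rho> - 1)))) at_top)"

definition Theta :: "(real \<times> real) set" where
  "Theta = {-1/2<..} \<times> {0<..}"

text \<open>Generalised Pareto log-likelihood; at \<open>\<gamma> = 0\<close> it is the limit for \<open>\<gamma> \<rightarrow> 0\<close>.\<close>

definition gpd_loglik :: "real \<times> real \<Rightarrow> real \<Rightarrow> ereal" where
  "gpd_loglik \<theta> z = (case \<theta> of (\<gamma>, \<sigma>) \<Rightarrow>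
     if 1 + \<gamma> * z / \<sigma> > 0
     then ereal (if \<gamma> = 0 then - ln \<sigma> - z / \<sigma>
                 else - ln \<sigma> - (1 + 1 / \<gamma>) * ln (1 + \<gamma> * z / \<sigma>))
     else - \<infinity>)"

text \<open>The \<open>j\<close>-th smallest of \<open>y 1, \<dots>, y n\<close>, for \<open>1 \<le> j \<le> n\<close>.\<close>

definition order_stat :: "(nat \<Rightarrow> real) \<Rightarrow> nat \<Rightarrow> nat \<Rightarrow> real" where
  "order_stat y j n = sort (map y [1..<Suc n]) ! (j - 1)"

text \<open>In the next three definitions \<open>y\<close> is the sample, \<open>n\<close> its size, \<open>k\<close> the number of
  exceedances, and \<open>s\<close> the scale, to be taken as \<open>a\<^sub>0(n/k)\<close>.\<close>

definition excess :: "(nat \<Rightarrow> real) \<Rightarrow> nat \<Rightarrow> nat \<Rightarrow> real \<Rightarrow> nat \<Rightarrow> real" where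
  "excess y n k s i = (order_stat y (n - i + 1) n - order_stat y (n - k) n) / s"

definition loglik :: "(nat \<Rightarrow> real) \<Rightarrow> nat \<Rightarrow> nat \<Rightarrow> real \<Rightarrow> real \<times> real \<Rightarrow> ereal" where
  "loglik y n k s \<theta> = ereal (1 / real k) * (\<Sum>i=1..k. gpd_loglik \<theta> (excess y n k s i))"

definition local_argmax ::
  "(nat \<Rightarrow> real) \<Rightarrow> nat \<Rightarrow> nat \<Rightarrow> real \<Rightarrow> real \<times> real \<Rightarrow> real \<Rightarrow> (real \<times> real) set" where
  "local_argmax y n k s \<theta>0 \<epsilon> =
     {\<theta>. is_arg_max (loglik y n k s) (\<lambda>\<theta>. \<theta> \<in> Theta \<and> norm (\<theta> - \<theta>0) < \<epsilon>) \<theta>}"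

definition rescale :: "real \<Rightarrow> real \<times> real \<Rightarrow> real \<times> real" where
  "rescale s \<theta> = (case \<theta> of (\<gamma>, \<sigma>) \<Rightarrow> (\<gamma>, \<sigma> / s))"

text \<open>\<open>X\<^sub>n = O\<^sub>P(r\<^sub>n)\<close>, and an event having probability tending to one. Outer (inner)
  probability is used so that no measurable choice of maximisers is needed: for measurable
  \<open>X\<^sub>n\<close> the first is \<open>P(\<bar>X\<^sub>n\<bar> > C r\<^sub>n) \<le> \<delta>\<close> for all large \<open>n\<close>, and for measurable events
  the second is convergence of their probabilities to one.\<close>

definition O_P :: "'a measure \<Rightarrow> (nat \<Rightarrow> 'a \<Rightarrow> real) \<Rightarrow> (nat \<Rightarrow> real) \<Rightarrow> bool" where
  "O_P M X r \<longleftrightarrow>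
     (\<forall>\<delta>>0. \<exists>C. \<forall>\<^sub>F n in sequentially. \<exists>E\<in>sets M.
        {\<omega> \<in> space M. \<bar>X n \<omega>\<bar> > C * r n} \<subseteq> E \<and> measure M E \<le> \<delta>)"

definition prob_tends_to_one :: "'a measure \<Rightarrow> (nat \<Rightarrow> 'a \<Rightarrow> bool) \<Rightarrow> bool" where
  "prob_tends_to_one M P \<longleftrightarrow>
     (\<exists>E. (\<forall>n. E n \<in> sets M \<and> E n \<subseteq> {\<omega> \<in> space M. P n \<omega>}) \<and>
          (\<lambda>n. measure M (E n)) \<longlonglongrightarrow> 1)"

end

theory Submission
  imports Defs "HOL-Real_Asymp.Real_Asymp"
begin

text \<open>
  The proof is an M-estimation argument: with probability close to one the sample satisfies
  finitely many deterministic inequalities, and these inequalities force the likelihood to have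
  exactly one maximiser near the true parameter, at distance \<open>O(1/\<surd>k)\<close>.

  Deterministic part. Put \<open>s = 1/\<sigma>\<close> and \<open>\<tau> = \<gamma>/\<sigma>\<close>. The mean log-likelihood of the
  excesses is then \<open>ln s - (s + \<tau>) h(\<tau>)\<close>, where \<open>h(\<tau>)\<close> averages \<open>\<integral>\<^sub>0\<^sup>z dv/(1 + \<tau>v)\<close>. This
  integral equals \<open>ln(1 + \<tau>z)/\<tau>\<close> and is smooth through \<open>\<tau> = 0\<close>, so no case split on the shape is
  needed. For fixed \<open>\<tau>\<close> the optimal \<open>s\<close> is \<open>1/h(\<tau>)\<close>, which leaves the scalar function
  \<open>f(\<tau>) = ln h(\<tau>) + \<tau> h(\<tau>)\<close> to be minimised. If \<open>f\<close> is strongly convex near \<open>\<gamma>\<^sub>0\<close> and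
  \<open>f'(\<gamma>\<^sub>0) = O(1/\<surd>k)\<close>, the rate and uniqueness follow (\<open>strongly_convex_minimum\<close>). The second
  derivative of \<open>f\<close> is a combination of averages of integrals with kernels \<open>v\<^sup>a/(1 + \<tau>v)\<^sup>r\<close>. For
  negative \<open>\<gamma>\<^sub>0\<close> these averages need not stay bounded at \<open>\<tau>\<close> near \<open>\<gamma>\<^sub>0\<close>: the largest excesses may
  approach or pass the endpoint \<open>-1/\<tau>\<close>. The lower bound on \<open>f''\<close> is therefore obtained from the
  excesses truncated at a level \<open>K\<close>: by a Cauchy--Schwarz inequality the truncation can only
  decrease \<open>f''\<close>, up to a small factor, as long as \<open>h(\<tau>)\<close> is close to one
  (\<open>truncated_curvature_le\<close>). Where \<open>h(\<tau>)\<close> is larger, the likelihood is smaller for that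
  reason alone (\<open>gpd_unique_local_argmax\<close>).

  Analytic part. The second-order condition is a pointwise limit. A measure-theoretic argument in
  the spirit of Steinhaus, applied to a cocycle identity, makes it locally uniform
  (\<open>local_uniform_bound\<close>), and iterating over powers of two gives the bound
  \<open>\<bar>(U(tx) - U(t))/a(t) - (x\<^sup>\<gamma> - 1)/\<gamma>\<bar> \<le> C \<bar>A(t)\<bar> x\<^bsup>max \<gamma> 0 + \<epsilon>\<^esup>\<close> (\<open>uniform_bound\<close>).

  Probabilistic part. The sample has the law of \<open>U(exp E\<^sub>i)\<close> with independent standard
  exponential \<open>E\<^sub>i\<close> (\<open>sample_law_transfer\<close>). Shifted by \<open>ln(n/k)\<close>, the top \<open>k\<close> of the \<open>E\<^sub>i\<close>
  are essentially those that exceed zero, and by lack of memory each of these is again standard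
  exponential. On the scale \<open>ln(1 + \<gamma>\<^sub>0z)/\<gamma>\<^sub>0\<close> an excess agrees with the corresponding shifted
  exponential up to \<open>O(1/\<surd>k)\<close> times \<open>exp(b p)\<close> with \<open>b < 1/2\<close>; this is one place
  where \<open>\<gamma>\<^sub>0 > -1/2\<close> enters, since \<open>b\<close> has to exceed \<open>-\<gamma>\<^sub>0\<close>. The averages of the statistics are thus
  \<open>O(1/\<surd>k)\<close>-close to sums over the whole exponential sample, to which the inequalities of
  Chebyshev and Markov apply (\<open>tail_statistics\<close>).
\<close>

section \<open>Kernel integrals of the generalised Pareto score\<close>

text \<open>For the four pairs \<open>(a, r) = (0,1), (1,2), (1,3), (2,3)\<close> the averages of these integrals give the
  profile likelihood and the terms of its second derivative; differentiation in \<open>\<tau>\<close> maps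
  \<open>(a, r)\<close> to \<open>(a + 1, r + 1)\<close>.\<close>

definition gint :: "nat \<Rightarrow> nat \<Rightarrow> real \<Rightarrow> real \<Rightarrow> real" where
  "gint a r \<tau> z = integral {0..z} (\<lambda>v. v ^ a / (1 + \<tau> * v) ^ r)"

lemma affine_pos_between:
  fixes \<tau> z v :: real
  assumes "1 + \<tau> * z > 0" "0 \<le> v" "v \<le> z"
  shows "1 + \<tau> * v > 0"
proof (cases "\<tau> \<ge> 0")
  case True
  then show ?thesis using assms by (smt (verit) mult_nonneg_nonneg)
next
  case False
  then have "\<tau> * z \<le> \<tau> * v" using assms by (simp add: mult_left_mono_neg)
  then show ?thesis using assms by linarith
qed

lemma gint_kernel_continuous:
  fixes \<tau> z u :: real
  assumes "1 + \<tau> * z > 0" "0 \<le> u"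
  shows "continuous_on {u..z} (\<lambda>v. v ^ a / (1 + \<tau> * v) ^ r)"
proof -
  have "1 + \<tau> * v \<noteq> 0" if "v \<in> {u..z}" for v
    using affine_pos_between[of \<tau> z v] assms that by force
  then show ?thesis by (intro continuous_intros) auto
qed

lemma gint_kernel_integrable:
  fixes \<tau> z u :: real
  assumes "1 + \<tau> * z > 0" "0 \<le> u"
  shows "(\<lambda>v. v ^ a / (1 + \<tau> * v) ^ r) integrable_on {u..z}"
  using gint_kernel_continuous[OF assms] by (rule integrable_continuous_real)

lemma gint_0 [simp]: "gint a r \<tau> 0 = 0"
  by (simp add: gint_def)

lemma gint_diff:
  assumes "1 + \<tau> * z > 0" "0 \<le> u" "u \<le> z"
  shows "gint a r \<tau> z - gint a r \<tau> u = integral {u..z} (\<lambda>v. v ^ a / (1 + \<tau> * v) ^ r)"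
  using Henstock_Kurzweil_Integration.integral_combine[OF assms(2,3)
      gint_kernel_integrable[OF assms(1), of 0 a r]]
  by (simp add: gint_def)

lemma gint_kernel_nonneg:
  fixes \<tau> z v :: real
  assumes "1 + \<tau> * z > 0" "0 \<le> v" "v \<le> z"
  shows "0 \<le> v ^ a / (1 + \<tau> * v) ^ r"
  using affine_pos_between[OF assms] assms by simp

lemma gint_mono:
  assumes "1 + \<tau> * z > 0" "0 \<le> u" "u \<le> z"
  shows "gint a r \<tau> u \<le> gint a r \<tau> z"
proof -
  have "0 \<le> integral {u..z} (\<lambda>v. v ^ a / (1 + \<tau> * v) ^ r)"
    by (intro integral_nonneg gint_kernel_integrable assms)
       (use assms gint_kernel_nonneg[OF assms(1)] in auto)
  then show ?thesis using gint_diff[OF assms, of a r] by linarith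
qed

lemma gint_nonneg:
  assumes "1 + \<tau> * z > 0" "0 \<le> z"
  shows "0 \<le> gint a r \<tau> z"
  using gint_mono[OF assms(1), of 0 a r] assms by simp

text \<open>Differentiation under the integral sign; the kernel is smooth in \<open>\<tau>\<close> because \<open>1 +
  \<tau>v\<close> stays positive on the whole interval once it is positive at \<open>z\<close>.\<close>

lemma gint_has_derivative_param:
  assumes "1 + \<tau> * z > 0" "0 \<le> z"
  shows "((\<lambda>\<tau>. gint a r \<tau> z) has_real_derivative - (r * gint (Suc a) (Suc r) \<tau> z)) (at \<tau>)"
proof -
  let ?U = "{\<tau>. 1 + \<tau> * z > 0}"
  have pos: "1 + x * t > 0" if "x \<in> ?U" "t \<in> cbox 0 z" for x t
    using affine_pos_between[of x z t] that by auto
  have "?U = {x. inner z x > - 1}" by (auto simp: algebra_simps)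
  then have U: "convex ?U" "open ?U"
    using convex_halfspace_gt[of "-1" z] open_halfspace_gt[of "-1" z] by auto
  have "((\<lambda>x. integral (cbox 0 z) (\<lambda>v. v ^ a / (1 + x * v) ^ r)) has_field_derivative
      integral (cbox 0 z) (\<lambda>v. - (real r * (v ^ Suc a / (1 + \<tau> * v) ^ Suc r)))) (at \<tau> within ?U)"
  proof (rule leibniz_rule_field_derivative)
    fix x t assume "x \<in> ?U" "t \<in> cbox 0 z"
    then have p: "1 + x * t > 0" by (rule pos)
    show "((\<lambda>x. t ^ a / (1 + x * t) ^ r) has_real_derivative
        - (real r * (t ^ Suc a / (1 + x * t) ^ Suc r))) (at x within ?U)"
    proof (cases r)
      case 0 then show ?thesis by simp
    next
      case (Suc m)
      have "((\<lambda>x. inverse (1 + x * t)) has_real_derivative - (t * inverse (1 + x * t) ^ 2)) (at x within ?U)"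
        using p by (auto intro!: derivative_eq_intros simp: power2_eq_square)
      from DERIV_cmult[OF DERIV_power_Suc[OF this, of m], of "t ^ a"] show ?thesis
        unfolding Suc by (simp add: field_simps power2_eq_square)
    qed
  next
    fix x assume "x \<in> ?U"
    then show "(\<lambda>v. v ^ a / (1 + x * v) ^ r) integrable_on cbox 0 z"
      using gint_kernel_integrable[of x z 0 a r] by simp
  next
    have "1 + fst x * snd x \<noteq> 0" if "x \<in> ?U \<times> cbox 0 z" for x
      using pos[of "fst x" "snd x"] that by force
    then show "continuous_on (?U \<times> cbox 0 z)
        (\<lambda>(x, t). - (real r * (t ^ Suc a / (1 + x * t) ^ Suc r)))"
      unfolding case_prod_beta by (intro continuous_intros) auto
  qed (use U assms in auto)
  moreover have "integral (cbox 0 z) (\<lambda>v. - (real r * (v ^ Suc a / (1 + \<tau> * v) ^ Suc r)))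
      = - (real r * gint (Suc a) (Suc r) \<tau> z)"
    by (simp only: gint_def Henstock_Kurzweil_Integration.integral_neg integral_mult_right cbox_interval)
  ultimately show ?thesis using U assms
    by (simp add: gint_def at_within_open[of _ ?U] del: power_Suc)
qed

lemma gint_has_derivative_upper:
  assumes "1 + \<tau> * z > 0" "0 \<le> u" "u \<le> z"
  shows "((\<lambda>x. gint a r \<tau> x) has_real_derivative u ^ a / (1 + \<tau> * u) ^ r) (at u within {0..z})"
  unfolding gint_def
  by (rule integral_has_real_derivative[OF gint_kernel_continuous[OF assms(1)]]) (use assms in auto)

lemma gint_eqI:
  assumes "1 + \<tau> * z > 0" "0 \<le> z" "F 0 = 0"
    and "\<And>v. 0 \<le> v \<Longrightarrow> v \<le> z \<Longrightarrow> 1 + \<tau> * v > 0 \<Longrightarrow>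
           (F has_real_derivative v ^ a / (1 + \<tau> * v) ^ r) (at v)"
  shows "gint a r \<tau> z = F z"
proof -
  have "((\<lambda>v. v ^ a / (1 + \<tau> * v) ^ r) has_integral F z - F 0) {0..z}"
  proof (rule fundamental_theorem_of_calculus[OF assms(2)])
    fix v assume "v \<in> {0..z}"
    then show "(F has_vector_derivative v ^ a / (1 + \<tau> * v) ^ r) (at v within {0..z})"
      using assms(4)[of v] affine_pos_between[OF assms(1), of v]
      by (auto simp flip: has_real_derivative_iff_has_vector_derivative
          intro: has_field_derivative_at_within)
  qed
  then show ?thesis using assms by (simp add: gint_def integral_unique)
qed

text \<open>The integral \<open>gint 0 1 \<tau> z\<close> in closed form. It is inverse to \<open>zeta\<close>, so it maps
  a generalised Pareto variable with shape \<open>\<tau>\<close> and unit scale to a standard exponential one.\<close>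

definition gq :: "real \<Rightarrow> real \<Rightarrow> real" where
  "gq \<tau> z = (if \<tau> = 0 then z else ln (1 + \<tau> * z) / \<tau>)"

lemma gint_0_1:
  assumes "1 + \<tau> * z > 0" "0 \<le> z"
  shows "gint 0 1 \<tau> z = gq \<tau> z"
proof (rule gint_eqI[OF assms])
  show "gq \<tau> 0 = 0" by (simp add: gq_def)
  fix v assume "1 + \<tau> * v > 0"
  then show "(gq \<tau> has_real_derivative v ^ 0 / (1 + \<tau> * v) ^ 1) (at v)"
    by (cases "\<tau> = 0") (auto simp: gq_def[abs_def] intro!: derivative_eq_intros)
qed

text \<open>The Box--Cox transform on the log scale, which maps a standard exponential variable to a generalised Pareto
  one.\<close>

definition zeta :: "real \<Rightarrow> real \<Rightarrow> real" where
  "zeta \<gamma> p = box_cox \<gamma> (exp p)"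

lemma zeta_eq: "zeta \<gamma> p = (if \<gamma> = 0 then p else (exp (\<gamma> * p) - 1) / \<gamma>)"
  by (simp add: zeta_def box_cox_def powr_def)

lemma zeta_0 [simp]: "zeta \<gamma> 0 = 0" by (simp add: zeta_eq)

lemma one_plus_zeta: "1 + \<gamma> * zeta \<gamma> p = exp (\<gamma> * p)"
  by (simp add: zeta_eq)

lemma zeta_has_derivative: "(zeta \<gamma> has_real_derivative exp (\<gamma> * p)) (at p)"
  unfolding zeta_eq[abs_def] by (cases "\<gamma> = 0") (auto intro!: derivative_eq_intros)

lemma zeta_strict_mono: "strict_mono (zeta \<gamma>)"
proof (rule strict_monoI)
  fix x y :: real assume "x < y"
  then show "zeta \<gamma> x < zeta \<gamma> y"
    by (rule DERIV_pos_imp_increasing) (meson exp_gt_zero zeta_has_derivative)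
qed

lemma zeta_nonneg: "0 \<le> p \<Longrightarrow> 0 \<le> zeta \<gamma> p"
  using strict_mono_less_eq[OF zeta_strict_mono, of \<gamma> 0 p] by simp

lemma gq_zeta [simp]: "gq \<gamma> (zeta \<gamma> p) = p"
  by (simp add: gq_def one_plus_zeta) (simp add: zeta_eq)

lemma zeta_gq: "1 + \<gamma> * z > 0 \<Longrightarrow> zeta \<gamma> (gq \<gamma> z) = z"
  by (simp add: gq_def zeta_eq)

lemma gq_nonneg:
  assumes "1 + \<gamma> * z > 0" "0 \<le> z"
  shows "0 \<le> gq \<gamma> z"
  using gint_nonneg[OF assms, of 0 1] by (simp only: gint_0_1[OF assms])

section \<open>Curvature bounds by truncation\<close>

lemma gint_diff_has_integral:
  fixes \<tau> z u :: real
  assumes "1 + \<tau> * z > 0" "0 \<le> u" "u \<le> z"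
  shows "((\<lambda>v. v ^ a / (1 + \<tau> * v) ^ r) has_integral gint a r \<tau> z - gint a r \<tau> u) {u..z}"
  unfolding gint_diff[OF assms] by (rule integrable_integral[OF gint_kernel_integrable[OF assms(1,2)]])

text \<open>Beyond \<open>K \<ge> 2\<close> one has \<open>v \<le> v\<^sup>2/2\<close>, so the part of the negative term
  of the curvature that comes from the tail is dominated by half of the positive one.\<close>

lemma gint_tail_half:
  fixes \<tau> z K :: real
  assumes "1 + \<tau> * z > 0" "0 \<le> z" "2 \<le> K"
  shows "gint 1 3 \<tau> z - gint 1 3 \<tau> (min z K) \<le> (gint 2 3 \<tau> z - gint 2 3 \<tau> (min z K)) / 2"
proof (cases "z \<le> K")
  case False
  then have K: "min z K = K" "0 \<le> K" "K \<le> z" using assms by auto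
  have "v ^ 1 / (1 + \<tau> * v) ^ 3 \<le> v ^ 2 / (1 + \<tau> * v) ^ 3 / 2" if "v \<in> {K..z}" for v
  proof -
    have "2 * v \<le> v\<^sup>2" using that assms by (simp add: power2_eq_square mult_right_mono)
    then show ?thesis using affine_pos_between[OF assms(1), of v] that assms
      by (simp add: divide_simps)
  qed
  then show ?thesis
    unfolding K(1)
    using has_integral_le[OF gint_diff_has_integral[OF assms(1) K(2,3), of 1 3]
        has_integral_divide[OF gint_diff_has_integral[OF assms(1) K(2,3), of 2 3], of 2]] by auto
qed auto

text \<open>The kernel \<open>v/(1 + \<tau>v)\<^sup>2\<close> is the geometric mean of \<open>v\<^sup>2/(1 +
  \<tau>v)\<^sup>3\<close> and \<open>1/(1 + \<tau>v)\<close>. Young's inequality with a free parameter is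
  linear in the integrals and hence survives averaging; optimising the parameter afterwards yields
  Cauchy--Schwarz for the averages (\<open>square_le_of_young\<close>).\<close>

lemma gint_tail_young:
  fixes \<tau> z K lam :: real
  assumes "1 + \<tau> * z > 0" "0 \<le> z" "0 \<le> K" "0 < lam"
  shows "gint 1 2 \<tau> z - gint 1 2 \<tau> (min z K)
    \<le> (lam * (gint 2 3 \<tau> z - gint 2 3 \<tau> (min z K)) + (gint 0 1 \<tau> z - gint 0 1 \<tau> (min z K)) / lam) / 2"
proof (cases "z \<le> K")
  case False
  then have K: "min z K = K" "0 \<le> K" "K \<le> z" using assms by auto
  have "v ^ 1 / (1 + \<tau> * v) ^ 2 \<le> (lam * (v ^ 2 / (1 + \<tau> * v) ^ 3) + v ^ 0 / (1 + \<tau> * v) ^ 1 / lam) / 2"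
    if "v \<in> {K..z}" for v
  proof -
    define x where "x = 1 + \<tau> * v"
    have x: "x > 0" unfolding x_def using affine_pos_between[OF assms(1), of v] that assms by simp
    have "0 \<le> (lam * v / x - 1)\<^sup>2 / (x * lam)" using x assms by simp
    also have "\<dots> = lam * (v ^ 2 / x ^ 3) + 1 / x / lam - 2 * (v / x ^ 2)"
      using x assms by (simp add: field_simps power2_eq_square power3_eq_cube)
    finally show ?thesis unfolding x_def by simp argo
  qed
  then show ?thesis
    unfolding K(1)
    using has_integral_le[OF gint_diff_has_integral[OF assms(1) K(2,3), of 1 2]
        has_integral_divide[OF has_integral_add[OF
          has_integral_mult_right[OF gint_diff_has_integral[OF assms(1) K(2,3), of 2 3], of lam]
          has_integral_divide[OF gint_diff_has_integral[OF assms(1) K(2,3), of 0 1], of lam]], of 2]]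
    by auto
qed auto

definition avg :: "nat \<Rightarrow> (nat \<Rightarrow> real) \<Rightarrow> real" where
  "avg k x = (\<Sum>i=1..k. x i) / real k"

lemma avg_mono: "(\<And>i. i \<in> {1..k} \<Longrightarrow> x i \<le> y i) \<Longrightarrow> avg k x \<le> avg k y"
  unfolding avg_def by (intro divide_right_mono sum_mono) auto

lemma avg_add: "avg k (\<lambda>i. x i + y i) = avg k x + avg k y"
  by (simp add: avg_def sum.distrib add_divide_distrib)

lemma avg_diff: "avg k (\<lambda>i. x i - y i) = avg k x - avg k y"
  by (simp add: avg_def sum_subtractf diff_divide_distrib)

lemma avg_cmult: "avg k (\<lambda>i. c * x i) = c * avg k x"
  by (simp add: avg_def sum_distrib_left)

lemma avg_const: "k > 0 \<Longrightarrow> avg k (\<lambda>_. c) = c"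
  by (simp add: avg_def)

lemma avg_nonneg: "(\<And>i. i \<in> {1..k} \<Longrightarrow> 0 \<le> x i) \<Longrightarrow> 0 \<le> avg k x"
  unfolding avg_def by (intro divide_nonneg_nonneg sum_nonneg) auto

lemma avg_abs_le: "\<bar>avg k x\<bar> \<le> avg k (\<lambda>i. \<bar>x i\<bar>)"
  unfolding avg_def by (simp add: divide_right_mono)

lemma square_le_of_young:
  fixes R G Q :: real
  assumes "0 \<le> R" "0 \<le> G" and y: "\<And>lam. 0 < lam \<Longrightarrow> R \<le> (lam * G + Q / lam) / 2"
  shows "R\<^sup>2 \<le> G * Q"
proof (cases "R = 0")
  case True
  have "0 \<le> Q" if "G > 0"
  proof (rule ccontr)
    assume "\<not> 0 \<le> Q"
    then have Q: "Q < 0" by simp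
    have "0 < sqrt (- Q / (2 * G))" using Q that by (simp add: divide_neg_pos)
    from y[OF this] have "0 \<le> (- Q / (2 * G)) * G + Q"
      using Q that True by (simp add: field_simps real_sqrt_divide)
    then show False using that Q by simp
  qed
  then show ?thesis using True assms by (cases "G = 0") auto
next
  case False
  then have R: "R > 0" using assms by simp
  show ?thesis
  proof (cases "G = 0")
    case True
    define L where "L = \<bar>Q\<bar> / R + 1"
    have L: "L > 0" using R unfolding L_def by (smt (verit) divide_nonneg_pos)
    have "R * L \<le> Q / 2" using y[OF L] True L by (simp add: field_simps)
    moreover have "R * L = \<bar>Q\<bar> + R" using R by (simp add: L_def field_simps)
    ultimately have False using R by linarith
    then show ?thesis ..
  next
    case False
    then have G: "G > 0" using assms by simp
    from y[of "R / G"] R G show ?thesis by (simp add: field_simps power2_eq_square)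
  qed
qed

lemma square_add_le:
  fixes W R \<zeta> :: real
  assumes "\<zeta> > 0"
  shows "(W + R)\<^sup>2 \<le> (1 + \<zeta>) * W\<^sup>2 + (1 + 1 / \<zeta>) * R\<^sup>2"
proof -
  have "0 \<le> (\<zeta> * W - R)\<^sup>2 / \<zeta>" using assms by simp
  also have "\<dots> = (1 + \<zeta>) * W\<^sup>2 + (1 + 1 / \<zeta>) * R\<^sup>2 - (W + R)\<^sup>2"
    using assms by (simp add: field_simps power2_eq_square)
  finally show ?thesis by simp
qed

text \<open>With \<open>s = 1/h\<close> the right-hand side is the second derivative of the profile function. The excesses
  beyond \<open>K\<close> add \<open>2sG\<close> to its positive term and change the square by a remainder
  \<open>R\<close> with \<open>R\<^sup>2 \<le> GQ\<close>; since \<open>Q \<le> 2\<eta>\<close> is small,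
  \<open>2sG\<close> absorbs what they subtract. The bound is uniform in \<open>G\<close>, so it covers excesses
  close to the endpoint, where \<open>G\<close> may be large.\<close>

lemma truncated_curvature_le:
  fixes z :: "nat \<Rightarrow> real"
  assumes z: "\<And>i. i \<in> {1..k} \<Longrightarrow> 0 \<le> z i" "\<And>i. i \<in> {1..k} \<Longrightarrow> 1 + \<tau> * z i > 0"
    and K: "2 \<le> K" and s: "9/10 \<le> s" and \<zeta>: "0 < \<zeta>"
    and Q: "avg k (\<lambda>i. gint 0 1 \<tau> (z i)) - avg k (\<lambda>i. gint 0 1 \<tau> (min (z i) K)) \<le> 2 * \<eta>"
    and \<eta>: "s\<^sup>2 * (1 + 1 / \<zeta>) * (2 * \<eta>) \<le> 4/5"
  shows "2 * s * avg k (\<lambda>i. gint 2 3 \<tau> (min (z i) K)) - 2 * avg k (\<lambda>i. gint 1 3 \<tau> (min (z i) K))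
      - s\<^sup>2 * (1 + \<zeta>) * (avg k (\<lambda>i. gint 1 2 \<tau> (min (z i) K)))\<^sup>2
    \<le> 2 * s * avg k (\<lambda>i. gint 2 3 \<tau> (z i)) - 2 * avg k (\<lambda>i. gint 1 3 \<tau> (z i))
      - s\<^sup>2 * (avg k (\<lambda>i. gint 1 2 \<tau> (z i)))\<^sup>2"
proof -
  let ?D = "\<lambda>a r i. gint a r \<tau> (z i) - gint a r \<tau> (min (z i) K)"
  let ?W = "avg k (\<lambda>i. gint 1 2 \<tau> (min (z i) K))"
  define G where "G = avg k (?D 2 3)"
  define R where "R = avg k (?D 1 2)"
  define B where "B = avg k (?D 1 3)"
  define Q' where "Q' = avg k (?D 0 1)"
  have D0: "0 \<le> ?D a r i" if "i \<in> {1..k}" for a r i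
    using gint_mono[OF z(2)[OF that], of "min (z i) K" a r] z(1)[OF that] K by simp
  have G0: "0 \<le> G" unfolding G_def by (rule avg_nonneg) (rule D0)
  have R0: "0 \<le> R" unfolding R_def by (rule avg_nonneg) (rule D0)
  have "B \<le> avg k (\<lambda>i. (1/2) * ?D 2 3 i)"
    unfolding B_def using gint_tail_half[OF z(2) z(1) K] by (intro avg_mono) auto
  then have B: "B \<le> G / 2" unfolding avg_cmult G_def by simp
  have "R\<^sup>2 \<le> G * Q'"
  proof (rule square_le_of_young[OF R0 G0])
    fix lam :: real assume l: "0 < lam"
    have "R \<le> avg k (\<lambda>i. lam / 2 * ?D 2 3 i + 1 / (2 * lam) * ?D 0 1 i)"
      unfolding R_def using gint_tail_young[OF z(2) z(1) _ l, of _ K] K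
      by (intro avg_mono) (force simp: add_divide_distrib)
    also have "\<dots> = lam / 2 * G + 1 / (2 * lam) * Q'"
      unfolding avg_add avg_cmult G_def Q'_def ..
    finally show "R \<le> (lam * G + Q' / lam) / 2" using l by (simp add: field_simps)
  qed
  also have "\<dots> \<le> G * (2 * \<eta>)"
    using Q G0 unfolding Q'_def avg_diff by (intro mult_left_mono)
  finally have R2: "R\<^sup>2 \<le> G * (2 * \<eta>)" .
  have "s\<^sup>2 * (?W + R)\<^sup>2 \<le> s\<^sup>2 * ((1 + \<zeta>) * ?W\<^sup>2 + (1 + 1 / \<zeta>) * R\<^sup>2)"
    by (intro mult_left_mono square_add_le \<zeta>) auto
  also have "s\<^sup>2 * ((1 + \<zeta>) * ?W\<^sup>2 + (1 + 1 / \<zeta>) * R\<^sup>2) =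
      s\<^sup>2 * (1 + \<zeta>) * ?W\<^sup>2 + s\<^sup>2 * (1 + 1 / \<zeta>) * R\<^sup>2" by (simp add: algebra_simps)
  also have "s\<^sup>2 * (1 + 1 / \<zeta>) * R\<^sup>2 \<le> s\<^sup>2 * (1 + 1 / \<zeta>) * (G * (2 * \<eta>))"
    using \<zeta> by (intro mult_left_mono R2) auto
  also have "\<dots> = G * (s\<^sup>2 * (1 + 1 / \<zeta>) * (2 * \<eta>))" by simp
  also have "\<dots> \<le> G * (4/5)" by (intro mult_left_mono \<eta> G0)
  finally have 1: "s\<^sup>2 * (?W + R)\<^sup>2 \<le> s\<^sup>2 * (1 + \<zeta>) * ?W\<^sup>2 + G * (4/5)" by simp
  have 2: "G * (4/5) \<le> 2 * s * G - 2 * B"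
    using mult_right_mono[OF s G0] B by simp
  have e: "?W + R = avg k (\<lambda>i. gint 1 2 \<tau> (z i))" by (simp add: R_def avg_diff)
  have "2 * s * avg k (\<lambda>i. gint 2 3 \<tau> (z i)) = 2 * s * avg k (\<lambda>i. gint 2 3 \<tau> (min (z i) K)) + 2 * s * G"
    by (simp add: G_def avg_diff algebra_simps)
  then show ?thesis using 1 2 unfolding e B_def avg_diff by simp
qed

text \<open>At \<open>s = 1\<close> and the limiting means the expression equals \<open>1/((1 + 2\<gamma>)(1 +
  \<gamma>)\<^sup>2)\<close>, up to the term with \<open>\<zeta>\<close>. This is positive exactly in the regime
  \<open>\<gamma> > -1/2\<close> (given \<open>\<gamma> > -1\<close>), and continuity gives a neighbourhood.\<close>

lemma curvature_constants:
  fixes \<gamma> :: real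
  assumes "\<gamma> > -1/2"
  shows "\<exists>\<zeta>>0. \<exists>c>0. \<zeta> \<le> 1/20 \<and> (\<forall>s W B C. \<bar>s - 1\<bar> \<le> \<zeta> \<longrightarrow> \<bar>W - 1 / (1 + \<gamma>)\<bar> \<le> \<zeta> \<longrightarrow>
     \<bar>B - 1 / ((1 + \<gamma>) * (1 + 2 * \<gamma>))\<bar> \<le> \<zeta> \<longrightarrow> \<bar>C - 2 / ((1 + \<gamma>) * (1 + 2 * \<gamma>))\<bar> \<le> \<zeta> \<longrightarrow>
     c \<le> 2 * s * C - 2 * B - s\<^sup>2 * (1 + \<zeta>) * W\<^sup>2)"
proof -
  define W0 where "W0 = 1 / (1 + \<gamma>)"
  define B0 where "B0 = 1 / ((1 + \<gamma>) * (1 + 2 * \<gamma>))"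
  define C0 where "C0 = 2 / ((1 + \<gamma>) * (1 + 2 * \<gamma>))"
  define \<phi> where "\<phi> = (\<lambda>\<zeta>. 2 * (1 - \<zeta>) * (C0 - \<zeta>) - 2 * (B0 + \<zeta>) - (1 + \<zeta>)\<^sup>2 * (1 + \<zeta>) * (W0 + \<zeta>)\<^sup>2)"
  have pos: "1 + \<gamma> > 0" "1 + 2 * \<gamma> > 0" using assms by auto
  have "\<phi> 0 = 2 * C0 - 2 * B0 - W0\<^sup>2" by (simp add: \<phi>_def)
  also have "\<dots> = 1 / ((1 + 2 * \<gamma>) * (1 + \<gamma>)\<^sup>2)"
    using pos unfolding W0_def B0_def C0_def
    by (simp add: divide_simps power2_eq_square) (simp add: algebra_simps)?
  finally have p0: "\<phi> 0 > 0" using pos by simp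
  have "isCont \<phi> 0" unfolding \<phi>_def by (intro continuous_intros)
  then have "(\<phi> \<longlongrightarrow> \<phi> 0) (at_right 0)" by (simp add: isCont_def filterlim_at_split)
  then have "\<forall>\<^sub>F x in at_right 0. \<phi> x > \<phi> 0 / 2" using p0 by (intro order_tendstoD) auto
  moreover have "\<forall>\<^sub>F x::real in at_right 0. x \<in> {0<..<min (1/20) C0}"
    using pos by (intro eventually_at_rightI[of 0 "min (1/20) C0"]) (auto simp: C0_def)
  ultimately have "\<forall>\<^sub>F x in at_right 0. \<phi> x > \<phi> 0 / 2 \<and> x \<in> {0<..<min (1/20) C0}"
    by (rule eventually_conj)
  then obtain \<zeta> where z: "\<phi> \<zeta> > \<phi> 0 / 2" "0 < \<zeta>" "\<zeta> < 1/20" "\<zeta> < C0"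
    using eventually_happens'[of "at_right (0::real)"] by auto
  show ?thesis
  proof (rule exI[of _ \<zeta>], rule conjI[OF z(2)], rule exI[of _ "\<phi> 0 / 2"], intro conjI allI impI)
    fix s W B C assume h: "\<bar>s - 1\<bar> \<le> \<zeta>" "\<bar>W - 1 / (1 + \<gamma>)\<bar> \<le> \<zeta>"
     "\<bar>B - 1 / ((1 + \<gamma>) * (1 + 2 * \<gamma>))\<bar> \<le> \<zeta>" "\<bar>C - 2 / ((1 + \<gamma>) * (1 + 2 * \<gamma>))\<bar> \<le> \<zeta>"
    have a: "(1 - \<zeta>) * (C0 - \<zeta>) \<le> s * C"
      using h z by (intro mult_mono) (auto simp: C0_def)
    have W0: "W0 > 0" using pos by (simp add: W0_def)
    have "\<bar>W\<bar> \<le> W0 + \<zeta>" using h(2) W0 unfolding W0_def[symmetric] by linarith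
    then have "W\<^sup>2 \<le> (W0 + \<zeta>)\<^sup>2" using abs_le_square_iff[of W "W0 + \<zeta>"] by simp
    moreover have "s\<^sup>2 \<le> (1 + \<zeta>)\<^sup>2" using h(1) z by (intro power_mono) auto
    ultimately have b: "s\<^sup>2 * (1 + \<zeta>) * W\<^sup>2 \<le> (1 + \<zeta>)\<^sup>2 * (1 + \<zeta>) * (W0 + \<zeta>)\<^sup>2"
      using z by (intro mult_mono) auto
    have c: "B \<le> B0 + \<zeta>" using h(3) unfolding B0_def[symmetric] by linarith
    have "\<phi> \<zeta> = 2 * ((1 - \<zeta>) * (C0 - \<zeta>)) - 2 * (B0 + \<zeta>) - (1 + \<zeta>)\<^sup>2 * (1 + \<zeta>) * (W0 + \<zeta>)\<^sup>2"
        by (simp add: \<phi>_def)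
    moreover have "p / 2 \<le> 2 * s * C - 2 * B - w"
        if "p / 2 < f" "f = 2 * x - 2 * y - v" "x \<le> s * C" "w \<le> v" "B \<le> y" for p f x y v w :: real
        using that by linarith
    ultimately show "\<phi> 0 / 2 \<le> 2 * s * C - 2 * B - s\<^sup>2 * (1 + \<zeta>) * W\<^sup>2"
      using z(1) a b c by blast
  qed (use z p0 in auto)
qed

text \<open>On \<open>[0, K]\<close> the factor \<open>1 + \<tau>v\<close> is bounded below uniformly in
  \<open>\<tau>\<close> near \<open>\<gamma>\<close>, so truncated integrals are Lipschitz in the parameter.\<close>

lemma gint_param_uniform:
  fixes \<gamma> K :: real
  assumes "1 + \<gamma> * K > 0" "0 < K" "0 < \<omega>"
  shows "\<exists>\<delta>>0. \<forall>\<tau> u. \<bar>\<tau> - \<gamma>\<bar> \<le> \<delta> \<longrightarrow> 0 \<le> u \<longrightarrow> u \<le> K \<longrightarrow>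
      1 + \<tau> * K > 0 \<and> \<bar>gint a r \<tau> u - gint a r \<gamma> u\<bar> \<le> \<omega>"
proof -
  define m where "m = min 1 ((1 + \<gamma> * K) / 2)"
  have m: "0 < m" using assms by (simp add: m_def)
  define L where "L = real r * (K * (K ^ Suc a / m ^ Suc r)) + 1"
  have L: "L > 0" using m assms by (auto simp: L_def intro!: add_nonneg_pos)
  define \<delta> where "\<delta> = min ((1 + \<gamma> * K) / (2 * K)) (\<omega> / L)"
  have pos: "1 + \<tau> * v \<ge> m" if "\<bar>\<tau> - \<gamma>\<bar> \<le> \<delta>" "0 \<le> v" "v \<le> K" for \<tau> v
  proof -
    have "\<gamma> - \<tau> \<le> (1 + \<gamma> * K) / (2 * K)" using that by (auto simp: \<delta>_def)
    then have "(\<gamma> - \<tau>) * K \<le> (1 + \<gamma> * K) / 2" using assms by (simp add: field_simps)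
    then have *: "1 + \<tau> * K \<ge> m" unfolding m_def by (simp add: algebra_simps min_def)
    show ?thesis
    proof (cases "\<tau> \<ge> 0")
      case True then show ?thesis using that by (simp add: m_def min_le_iff_disj)
    next
      case False then have "\<tau> * K \<le> \<tau> * v" using that by (simp add: mult_left_mono_neg)
      then show ?thesis using * by linarith
    qed
  qed
  show ?thesis
  proof (intro exI[of _ \<delta>] conjI allI impI)
    show "\<delta> > 0" using assms L by (auto simp: \<delta>_def)
    fix \<tau> u assume t: "\<bar>\<tau> - \<gamma>\<bar> \<le> \<delta>" and u: "0 \<le> u" "u \<le> K"
    show "1 + \<tau> * K > 0" using pos[OF t, of K] m assms by auto
    have "norm (gint a r \<tau> u - gint a r \<gamma> u) \<le> L * norm (\<tau> - \<gamma>)"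
    proof (rule field_differentiable_bound[of "closed_segment \<gamma> \<tau>"])
      fix x assume x: "x \<in> closed_segment \<gamma> \<tau>"
      then have x': "\<bar>x - \<gamma>\<bar> \<le> \<delta>" using t by (auto simp: closed_segment_eq_real_ivl split: if_splits)
      have p: "1 + x * u > 0" using pos[OF x' u] m by simp
      show "((\<lambda>\<tau>. gint a r \<tau> u) has_field_derivative - (r * gint (Suc a) (Suc r) x u))
          (at x within closed_segment \<gamma> \<tau>)"
        by (rule has_field_derivative_at_within[OF gint_has_derivative_param[OF p u(1)]])
      have "gint (Suc a) (Suc r) x u \<le> integral {0..u} (\<lambda>_. K ^ Suc a / m ^ Suc r)"
        unfolding gint_def
      proof (rule integral_le)
        fix v assume v: "v \<in> {0..u}"
        then show "v ^ Suc a / (1 + x * v) ^ Suc r \<le> K ^ Suc a / m ^ Suc r"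
          using u m pos[OF x', of v] by (intro frac_le power_mono) auto
      qed (use gint_kernel_integrable[OF p] in \<open>auto simp del: power_Suc\<close>)
      also have "\<dots> \<le> K * (K ^ Suc a / m ^ Suc r)"
        using u m assms by (simp del: power_Suc add: mult_right_mono divide_right_mono)
      finally have "gint (Suc a) (Suc r) x u \<le> K * (K ^ Suc a / m ^ Suc r)" .
      then have "r * gint (Suc a) (Suc r) x u \<le> r * (K * (K ^ Suc a / m ^ Suc r))"
        by (rule mult_left_mono) simp
      then show "norm (- (r * gint (Suc a) (Suc r) x u)) \<le> L"
        using gint_nonneg[OF p u(1), of "Suc a" "Suc r"] unfolding L_def by simp
    qed (auto)
    also have "\<dots> \<le> L * (\<omega> / L)"
      using t L by (intro mult_left_mono) (auto simp: \<delta>_def)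
    finally show "\<bar>gint a r \<tau> u - gint a r \<gamma> u\<bar> \<le> \<omega>" using L by simp
  qed
qed

section \<open>Profile likelihood\<close>

text \<open>The derivative grows at rate at least \<open>c\<close>, so it changes sign within distance \<open>r\<close> of
  \<open>x0\<close>. The zero is the global minimiser on the interval because \<open>f'\<close> is strictly
  increasing.\<close>

lemma strongly_convex_minimum:
  fixes f f' f'' :: "real \<Rightarrow> real"
  assumes I: "is_interval I" and c: "c > 0" and r: "r > 0" and sub: "{x0 - r..x0 + r} \<subseteq> I"
    and f: "\<And>x. x \<in> I \<Longrightarrow> (f has_real_derivative f' x) (at x)"
    and f': "\<And>x. x \<in> I \<Longrightarrow> (f' has_real_derivative f'' x) (at x)"
    and f'': "\<And>x. x \<in> I \<Longrightarrow> c \<le> f'' x"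
    and x0: "\<bar>f' x0\<bar> \<le> c * r"
  shows "\<exists>x\<in>{x0 - r..x0 + r}. \<forall>y\<in>I. y \<noteq> x \<longrightarrow> f x < f y"
proof -
  have inc: "c * (y - x) \<le> f' y - f' x" if xy: "x \<in> I" "y \<in> I" "x < y" for x y
  proof -
    have mem: "u \<in> I" if "x \<le> u" "u \<le> y" for u
      using mem_is_interval_1_I[OF I \<open>x \<in> I\<close> \<open>y \<in> I\<close>] that by blast
    obtain \<xi> where "\<xi> > x" "\<xi> < y" "f' y - f' x = (y - x) * f'' \<xi>"
      using MVT2[of x y f' f''] f' mem xy by auto
    then show ?thesis using f''[of \<xi>] mem[of \<xi>] xy by (simp add: mult.commute mult_left_mono)
  qed
  have mem: "x0 - r \<in> I" "x0 \<in> I" "x0 + r \<in> I" using sub r by auto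
  have "f' (x0 - r) \<le> 0" using inc[OF mem(1,2)] x0 r by simp
  moreover have "0 \<le> f' (x0 + r)" using inc[OF mem(2,3)] x0 r by simp
  moreover have "continuous_on {x0 - r..x0 + r} f'"
    using f' sub by (intro continuous_at_imp_continuous_on ballI DERIV_isCont) blast
  ultimately obtain x where x: "x0 - r \<le> x" "x \<le> x0 + r" "f' x = 0"
    using IVT'[of f' "x0 - r" 0 "x0 + r"] r by auto
  have xI: "x \<in> I" using x sub by auto
  have "f x < f y" if y: "y \<in> I" "y \<noteq> x" for y
  proof (cases "x < y")
    case True
    have m: "u \<in> I" if "x \<le> u" "u \<le> y" for u
      using mem_is_interval_1_I[OF I xI y(1)] that by blast
    obtain \<xi> where \<xi>: "\<xi> > x" "\<xi> < y" "f y - f x = (y - x) * f' \<xi>"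
      using MVT2[of x y f f'] f m True by auto
    have "0 < c * (\<xi> - x)" using c \<xi> by simp
    also have "\<dots> \<le> f' \<xi>" using inc[of x \<xi>] xI m[of \<xi>] \<xi> x by simp
    finally show ?thesis using \<xi> True by (smt (verit) mult_pos_pos)
  next
    case False
    then have lt: "y < x" using y by simp
    have m: "u \<in> I" if "y \<le> u" "u \<le> x" for u
      using mem_is_interval_1_I[OF I y(1) xI] that by blast
    obtain \<xi> where \<xi>: "\<xi> > y" "\<xi> < x" "f x - f y = (x - y) * f' \<xi>"
      using MVT2[of y x f f'] f m lt by auto
    have "0 < c * (x - \<xi>)" using c \<xi> by simp
    also have "\<dots> \<le> - f' \<xi>" using inc[of \<xi> x] xI m[of \<xi>] \<xi> x by simp
    finally have "f' \<xi> < 0" by simp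
    then show ?thesis using \<xi> lt by (smt (verit) mult_pos_neg)
  qed
  then show ?thesis using x by (intro bexI[of _ x]) auto
qed

text \<open>The kernels satisfy \<open>1/(1 + \<tau>v) - \<tau>v/(1 + \<tau>v)\<^sup>2 = 1/(1 + \<tau>v)\<^sup>2\<close>;
  this puts the profile score into the form \<open>h\<^sub>0\<^sub>2 - h\<^sub>1\<^sub>2/h\<close>, which
  vanishes in the mean at the true shape.\<close>

lemma gint_split:
  assumes "1 + \<tau> * z > 0" "0 \<le> z"
  shows "gint 0 1 \<tau> z - \<tau> * gint 1 2 \<tau> z = gint 0 2 \<tau> z"
proof -
  have "((\<lambda>v. v ^ 0 / (1 + \<tau> * v) ^ 1 - \<tau> * (v ^ 1 / (1 + \<tau> * v) ^ 2)) has_integral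
      gint 0 1 \<tau> z - \<tau> * gint 1 2 \<tau> z) {0..z}"
    using gint_diff_has_integral[OF assms(1) order_refl assms(2)]
    by (intro has_integral_diff has_integral_mult_right) (metis diff_zero gint_0)+
  moreover have "v ^ 0 / (1 + \<tau> * v) ^ 1 - \<tau> * (v ^ 1 / (1 + \<tau> * v) ^ 2) = v ^ 0 / (1 + \<tau> * v) ^ 2"
    if "v \<in> {0..z}" for v
  proof -
    have "1 + \<tau> * v > 0" using affine_pos_between[OF assms(1), of v] that by auto
    then show ?thesis by (simp add: divide_simps power2_eq_square)
  qed
  ultimately have "((\<lambda>v. v ^ 0 / (1 + \<tau> * v) ^ 2) has_integral
      gint 0 1 \<tau> z - \<tau> * gint 1 2 \<tau> z) {0..z}"
    by (rule has_integral_eq[rotated])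
  then show ?thesis unfolding gint_def by (simp only: integral_unique)
qed

text \<open>The condition says that \<open>1 + \<tau>v\<close> is at least half of \<open>1 + \<gamma>v\<close> on
  \<open>[0, z]\<close>. It controls all excesses, the largest included, for \<open>\<tau>\<close> within
  \<open>O(1/\<surd>k)\<close> of \<open>\<gamma>\<close>.\<close>

lemma gint_param_lipschitz:
  fixes \<gamma> \<tau> z :: real
  assumes "1 + \<gamma> * z > 0" "0 \<le> z" "\<bar>\<tau> - \<gamma>\<bar> * z \<le> (1 + \<gamma> * z) / 2"
  shows "1 + \<tau> * z > 0" "\<bar>gint 0 1 \<tau> z - gint 0 1 \<gamma> z\<bar> \<le> 2 * \<bar>\<tau> - \<gamma>\<bar> * gint 1 2 \<gamma> z"
proof -
  have half: "1 + \<tau> * v \<ge> (1 + \<gamma> * v) / 2" if v: "0 \<le> v" "v \<le> z" for v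
  proof (cases "v = 0")
    case False
    then have z: "0 < z" using v by simp
    have "\<bar>\<tau> - \<gamma>\<bar> * v = \<bar>\<tau> - \<gamma>\<bar> * z * (v / z)" using z by simp
    also have "\<dots> \<le> (1 + \<gamma> * z) / 2 * (v / z)" using assms v by (intro mult_right_mono) auto
    also have "\<dots> = (v / z + \<gamma> * v) / 2" using z by (simp add: field_simps)
    also have "\<dots> \<le> (1 + \<gamma> * v) / 2" using v z by (simp add: field_simps)
    finally have "\<bar>\<tau> - \<gamma>\<bar> * v \<le> (1 + \<gamma> * v) / 2" .
    moreover have "(\<gamma> - \<tau>) * v \<le> \<bar>\<tau> - \<gamma>\<bar> * v" using v by (intro mult_right_mono) auto
    ultimately have "(\<gamma> - \<tau>) * v \<le> (1 + \<gamma> * v) / 2" by linarith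
    then show ?thesis by (simp add: algebra_simps)
  qed auto
  show p: "1 + \<tau> * z > 0" using half[of z] assms by simp
  have "\<bar>gint 0 1 \<tau> z - gint 0 1 \<gamma> z\<bar> = norm (integral {0..z} (\<lambda>v. v ^ 0 / (1 + \<tau> * v) ^ 1 - v ^ 0 / (1 + \<gamma> * v) ^ 1))"
    unfolding gint_def
    by (subst Henstock_Kurzweil_Integration.integral_diff)
       (auto simp only: real_norm_def intro!: gint_kernel_integrable p assms(1))
  also have "\<dots> \<le> integral {0..z} (\<lambda>v. 2 * \<bar>\<tau> - \<gamma>\<bar> * (v ^ 1 / (1 + \<gamma> * v) ^ 2))"
  proof (rule integral_norm_bound_integral)
    fix v assume v: "v \<in> {0..z}"
    then have a: "1 + \<gamma> * v > 0" "1 + \<tau> * v > 0"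
      using affine_pos_between[OF assms(1), of v] affine_pos_between[OF p, of v] by auto
    have "1 / (1 + \<tau> * v) - 1 / (1 + \<gamma> * v) = (\<gamma> - \<tau>) * v / ((1 + \<tau> * v) * (1 + \<gamma> * v))"
      using a by (simp add: divide_simps) (simp add: algebra_simps)
    then have "\<bar>1 / (1 + \<tau> * v) - 1 / (1 + \<gamma> * v)\<bar> = \<bar>\<tau> - \<gamma>\<bar> * v / ((1 + \<tau> * v) * (1 + \<gamma> * v))"
      using a v by (simp add: abs_mult abs_minus_commute)
    also have "\<dots> \<le> \<bar>\<tau> - \<gamma>\<bar> * v / ((1 + \<gamma> * v) / 2 * (1 + \<gamma> * v))"
      using half[of v] v a by (intro divide_left_mono mult_right_mono) auto
    also have "\<dots> = 2 * \<bar>\<tau> - \<gamma>\<bar> * (v ^ 1 / (1 + \<gamma> * v) ^ 2)"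
      using a by (simp add: field_simps power2_eq_square)
    finally show "norm (v ^ 0 / (1 + \<tau> * v) ^ 1 - v ^ 0 / (1 + \<gamma> * v) ^ 1)
        \<le> 2 * \<bar>\<tau> - \<gamma>\<bar> * (v ^ 1 / (1 + \<gamma> * v) ^ 2)" by simp
  next
    show "(\<lambda>v. v ^ 0 / (1 + \<tau> * v) ^ 1 - v ^ 0 / (1 + \<gamma> * v) ^ 1) integrable_on {0..z}"
      by (intro integrable_diff gint_kernel_integrable p assms(1)) auto
    show "(\<lambda>v. 2 * \<bar>\<tau> - \<gamma>\<bar> * (v ^ 1 / (1 + \<gamma> * v) ^ 2)) integrable_on {0..z}"
      by (intro integrable_on_mult_right gint_kernel_integrable assms(1)) auto
  qed
  also have "\<dots> = 2 * \<bar>\<tau> - \<gamma>\<bar> * gint 1 2 \<gamma> z"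
    by (simp only: gint_def integral_mult_right)
  finally show "\<bar>gint 0 1 \<tau> z - gint 0 1 \<gamma> z\<bar> \<le> 2 * \<bar>\<tau> - \<gamma>\<bar> * gint 1 2 \<gamma> z" .
qed

lemma avg_has_derivative:
  assumes "\<And>i. i \<in> {1..k} \<Longrightarrow> (g i has_real_derivative d i) (at x)"
  shows "((\<lambda>x. avg k (\<lambda>i. g i x)) has_real_derivative avg k d) (at x)"
  unfolding avg_def by (intro DERIV_cdivide DERIV_sum assms)

text \<open>The coordinates \<open>1/\<sigma>\<close> and \<open>g/\<sigma>\<close> remove the singularity of the formula
  at shape zero.\<close>

lemma gpd_loglik_eq:
  assumes "\<sigma> > 0" "0 \<le> z" "1 + g / \<sigma> * z > 0"
  shows "gpd_loglik (g, \<sigma>) z = ereal (ln (1 / \<sigma>) - (1 / \<sigma> + g / \<sigma>) * gint 0 1 (g / \<sigma>) z)"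
proof (cases "g = 0")
  case True
  then have "gint 0 1 (g / \<sigma>) z = z" using gint_0_1[OF assms(3,2)] by (simp add: gq_def)
  then show ?thesis using assms True by (simp add: gpd_loglik_def ln_div)
next
  case False
  define L where "L = ln (1 + g / \<sigma> * z)"
  have "(1 / \<sigma> + g / \<sigma>) * (L / (g / \<sigma>)) = (1 + 1 / g) * L"
    using False assms(1) by (simp add: field_simps)
  then show ?thesis using assms False
    by (simp only: gint_0_1[OF assms(3,2)]) (simp add: gpd_loglik_def gq_def ln_div L_def)
qed

lemma gpd_loglik_MInf:
  assumes "\<not> 1 + g / \<sigma> * z > 0"
  shows "gpd_loglik (g, \<sigma>) z = -\<infinity>"
  using assms by (simp add: gpd_loglik_def)

lemma gpd_loglik_neq_PInf: "gpd_loglik \<theta> z \<noteq> \<infinity>"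
  by (auto simp: gpd_loglik_def split: prod.splits)

lemma mean_loglik_eq:
  assumes "\<sigma> > 0" "k > 0" and z: "\<And>i. i \<in> {1..k} \<Longrightarrow> 0 \<le> z i" "\<And>i. i \<in> {1..k} \<Longrightarrow> 1 + g / \<sigma> * z i > 0"
  shows "ereal (1 / real k) * (\<Sum>i=1..k. gpd_loglik (g, \<sigma>) (z i))
    = ereal (- (- ln (1 / \<sigma>) + (1 / \<sigma> + g / \<sigma>) * avg k (\<lambda>i. gint 0 1 (g / \<sigma>) (z i))))"
proof -
  have "(\<Sum>i=1..k. gpd_loglik (g, \<sigma>) (z i)) =
      ereal (\<Sum>i=1..k. ln (1 / \<sigma>) - (1 / \<sigma> + g / \<sigma>) * gint 0 1 (g / \<sigma>) (z i))"
    unfolding sum_ereal[symmetric] by (intro sum.cong gpd_loglik_eq assms refl)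
  moreover have "avg k (\<lambda>i. ln (1 / \<sigma>) - (1 / \<sigma> + g / \<sigma>) * gint 0 1 (g / \<sigma>) (z i))
      = ln (1 / \<sigma>) - (1 / \<sigma> + g / \<sigma>) * avg k (\<lambda>i. gint 0 1 (g / \<sigma>) (z i))"
    unfolding avg_diff avg_cmult using assms by (simp add: avg_const)
  ultimately show ?thesis by (simp add: avg_def)
qed

lemma mean_loglik_MInf:
  assumes "k > 0" "i \<in> {1..k}" "\<not> 1 + g / \<sigma> * z i > 0"
  shows "ereal (1 / real k) * (\<Sum>i=1..k. gpd_loglik (g, \<sigma>) (z i)) = -\<infinity>"
proof -
  have "(\<Sum>i=1..k. gpd_loglik (g, \<sigma>) (z i)) = -\<infinity>"
  proof -
    have "(\<Sum>i\<in>{1..k} - {i}. gpd_loglik (g, \<sigma>) (z i)) \<noteq> \<infinity>"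
      by (simp add: sum_Pinfty gpd_loglik_neq_PInf)
    then show ?thesis
      using sum.remove[OF _ assms(2), of "\<lambda>i. gpd_loglik (g, \<sigma>) (z i)"] gpd_loglik_MInf[OF assms(3)]
      by simp
  qed
  then show ?thesis using assms by simp
qed

text \<open>The function \<open>s \<mapsto> - ln s + s h\<close> has its strict minimum at \<open>s = 1/h\<close>.\<close>

lemma profile_bound:
  fixes s h :: real
  assumes "s > 0" "h > 0"
  shows "1 + ln h \<le> - ln s + s * h" "s * h \<noteq> 1 \<Longrightarrow> 1 + ln h < - ln s + s * h"
proof -
  have p: "s * h > 0" using assms by simp
  have e: "ln (s * h) = ln s + ln h" using assms by (simp add: ln_mult)
  show "1 + ln h \<le> - ln s + s * h" using ln_le_minus_one[OF p] e by simp
  assume "s * h \<noteq> 1"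
  then have "ln (s * h) < s * h - 1"
    using ln_eq_minus_one[OF p] ln_le_minus_one[OF p] by force
  then show "1 + ln h < - ln s + s * h" using e by simp
qed

text \<open>The limits of the averages at the true shape: the means of \<open>gint a r \<gamma>\<close> under the
  generalised Pareto law with shape \<open>\<gamma>\<close> and unit scale. The last case stands for the pair
  \<open>(2, 3)\<close>.\<close>

definition gmean :: "real \<Rightarrow> nat \<Rightarrow> nat \<Rightarrow> real" where
  "gmean \<gamma> a r = (if (a, r) = (0, 1) then 1 else if (a, r) = (1, 2) then 1 / (1 + \<gamma>)
     else if (a, r) = (1, 3) then 1 / ((1 + \<gamma>) * (1 + 2 * \<gamma>)) else 2 / ((1 + \<gamma>) * (1 + 2 * \<gamma>)))"

text \<open>On the set \<open>I\<close>, where \<open>h \<le> 1 + \<eta>\<close>, truncation bounds the curvature of the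
  profile function from below. The set is an interval because each \<open>gint 0 1 \<tau> z\<close> decreases in
  \<open>\<tau>\<close>, so that lowering \<open>\<tau>\<close> is the only way to leave it before the bound
  \<open>\<delta>\<close> is met. The score bound then places the minimiser within \<open>r\<close> of
  \<open>\<gamma>\<close>.\<close>

lemma profile_minimum:
  fixes z :: "nat \<Rightarrow> real" and \<gamma> \<delta> \<eta> :: real and k :: nat
  defines "H \<equiv> (\<lambda>\<tau>. avg k (\<lambda>i. gint 0 1 \<tau> (z i)))"
  defines "I \<equiv> {\<tau>. \<bar>\<tau> - \<gamma>\<bar> \<le> \<delta> \<and> (\<forall>i\<in>{1..k}. 1 + \<tau> * z i > 0) \<and> H \<tau> \<le> 1 + \<eta>}"
  assumes k: "k > 0" and z: "\<And>i. i \<in> {1..k} \<Longrightarrow> 0 \<le> z i" and z\<gamma>: "\<And>i. i \<in> {1..k} \<Longrightarrow> 1 + \<gamma> * z i > 0"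
    and \<zeta>: "0 < \<zeta>" "\<zeta> \<le> 1/20"
    and c0: "0 < c0" and curv: "\<And>s W B C. \<bar>s - 1\<bar> \<le> \<zeta> \<Longrightarrow> \<bar>W - gmean \<gamma> 1 2\<bar> \<le> \<zeta> \<Longrightarrow>
     \<bar>B - gmean \<gamma> 1 3\<bar> \<le> \<zeta> \<Longrightarrow> \<bar>C - gmean \<gamma> 2 3\<bar> \<le> \<zeta> \<Longrightarrow>
     c0 \<le> 2 * s * C - 2 * B - s\<^sup>2 * (1 + \<zeta>) * W\<^sup>2"
    and \<eta>: "0 < \<eta>" "\<eta> \<le> \<zeta> / 4" "\<eta> * (3 * (1 + 1 / \<zeta>)) \<le> 1"
    and \<eta>': "\<eta>' \<le> \<eta> / 2"
    and K: "2 \<le> K" "1 + \<gamma> * K > 0"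
    and \<delta>: "\<And>a r \<tau> u. (a, r) \<in> {(0, 1), (1, 2), (1, 3), (2, 3)} \<Longrightarrow> \<bar>\<tau> - \<gamma>\<bar> \<le> \<delta> \<Longrightarrow> 0 \<le> u \<Longrightarrow> u \<le> K \<Longrightarrow>
        \<bar>gint a r \<tau> u - gint a r \<gamma> u\<bar> \<le> \<eta>'"
    and trunc: "\<And>a r. (a, r) \<in> {(0, 1), (1, 2), (1, 3), (2, 3)} \<Longrightarrow>
        \<bar>avg k (\<lambda>i. gint a r \<gamma> (min (z i) K)) - gmean \<gamma> a r\<bar> \<le> \<eta>'"
    and r: "0 < r" "{\<gamma> - r..\<gamma> + r} \<subseteq> I"
    and score: "\<bar>avg k (\<lambda>i. gint 0 2 \<gamma> (z i)) - avg k (\<lambda>i. gint 1 2 \<gamma> (z i)) / H \<gamma>\<bar> \<le> c0 * r"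
  shows "\<exists>t\<in>{\<gamma> - r..\<gamma> + r}. \<forall>\<tau>\<in>I. \<tau> \<noteq> t \<longrightarrow> ln (H t) + t * H t < ln (H \<tau>) + \<tau> * H \<tau>"
proof -
  let ?A = "\<lambda>a r \<tau>. avg k (\<lambda>i. gint a r \<tau> (z i))"
  let ?T = "\<lambda>a r \<tau>. avg k (\<lambda>i. gint a r \<tau> (min (z i) K))"
  have pos: "1 + \<tau> * z i > 0" if "\<tau> \<in> I" "i \<in> {1..k}" for \<tau> i using that by (auto simp: I_def)
  have T: "\<bar>?T a r \<tau> - gmean \<gamma> a r\<bar> \<le> 2 * \<eta>'"
    if "\<tau> \<in> I" "(a, r) \<in> {(0, 1), (1, 2), (1, 3), (2, 3)}" for \<tau> a r
  proof -
    have "\<bar>?T a r \<tau> - ?T a r \<gamma>\<bar> \<le> avg k (\<lambda>i. \<bar>gint a r \<tau> (min (z i) K) - gint a r \<gamma> (min (z i) K)\<bar>)"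
      unfolding avg_diff[symmetric] by (rule avg_abs_le)
    also have "\<dots> \<le> avg k (\<lambda>_. \<eta>')"
    proof (rule avg_mono)
      fix i assume "i \<in> {1..k}"
      then show "\<bar>gint a r \<tau> (min (z i) K) - gint a r \<gamma> (min (z i) K)\<bar> \<le> \<eta>'"
        using that z[of i] K by (intro \<delta>) (auto simp: I_def)
    qed
    finally show ?thesis using trunc[OF that(2)] k by (simp add: avg_const)
  qed
  have H_ge: "1 - \<eta> \<le> ?T 0 1 \<tau>" "?T 0 1 \<tau> \<le> H \<tau>" if "\<tau> \<in> I" for \<tau>
  proof -
    have "\<bar>?T 0 1 \<tau> - 1\<bar> \<le> 2 * \<eta>'" using T[OF that, of 0 1] by (simp add: gmean_def)
    then show "1 - \<eta> \<le> ?T 0 1 \<tau>" using \<eta>' by linarith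
    show "?T 0 1 \<tau> \<le> H \<tau>"
      unfolding H_def using pos[OF that] z K by (intro avg_mono gint_mono) auto
  qed
  have H_pos: "H \<tau> > 0" if "\<tau> \<in> I" for \<tau> using H_ge[OF that] \<eta> \<zeta> by linarith
  define f where "f = (\<lambda>\<tau>. ln (H \<tau>) + \<tau> * H \<tau>)"
  define f' where "f' = (\<lambda>\<tau>. ?A 0 2 \<tau> - ?A 1 2 \<tau> / H \<tau>)"
  define f'' where "f'' = (\<lambda>\<tau>. 2 * (1 / H \<tau>) * ?A 2 3 \<tau> - 2 * ?A 1 3 \<tau> - (1 / H \<tau>)\<^sup>2 * (?A 1 2 \<tau>)\<^sup>2)"
  have D: "(?A a r has_real_derivative avg k (\<lambda>i. - (r * gint (Suc a) (Suc r) \<tau> (z i)))) (at \<tau>)"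
    if "\<tau> \<in> I" for a r \<tau>
    using gint_has_derivative_param[OF pos[OF that] z] by (intro avg_has_derivative) auto
  have DH: "(H has_real_derivative - ?A 1 2 \<tau>) (at \<tau>)" if "\<tau> \<in> I" for \<tau>
    using D[OF that, of 0 1] unfolding H_def avg_def by (simp add: sum_negf numeral_2_eq_2)
  have D12: "(?A 1 2 has_real_derivative - (2 * ?A 2 3 \<tau>)) (at \<tau>)" if "\<tau> \<in> I" for \<tau>
    using D[OF that, of 1 2] unfolding avg_def
    by (simp add: sum_negf numeral_2_eq_2 numeral_3_eq_3 sum_distrib_left)
  have D02: "(?A 0 2 has_real_derivative - (2 * ?A 1 3 \<tau>)) (at \<tau>)" if "\<tau> \<in> I" for \<tau>
    using D[OF that, of 0 2] unfolding avg_def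
    by (simp add: sum_negf numeral_2_eq_2 numeral_3_eq_3 sum_distrib_left)
  have split: "H \<tau> - \<tau> * ?A 1 2 \<tau> = ?A 0 2 \<tau>" if "\<tau> \<in> I" for \<tau>
    unfolding H_def avg_cmult[symmetric] avg_diff[symmetric]
    unfolding avg_def using gint_split[OF pos[OF that] z] by (intro arg_cong2[of _ _ _ _ "(/)"] sum.cong) auto
  have "\<exists>t\<in>{\<gamma> - r..\<gamma> + r}. \<forall>\<tau>\<in>I. \<tau> \<noteq> t \<longrightarrow> f t < f \<tau>"
  proof (rule strongly_convex_minimum[where f' = f' and f'' = f''])
    show "is_interval I"
      unfolding is_interval_1
    proof (intro ballI allI impI)
      fix a b x assume ab: "a \<in> I" "b \<in> I" and x: "a \<le> x \<and> x \<le> b"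
      have p: "1 + y * z i > 0" if "i \<in> {1..k}" "a \<le> y" for y i
      proof -
        have "a * z i \<le> y * z i" using that z by (intro mult_right_mono) auto
        then show ?thesis using pos[OF ab(1) that(1)] by linarith
      qed
      have "H x \<le> H a"
      proof (rule DERIV_nonpos_imp_nonincreasing[where f = H and a = a and b = x])
        show "a \<le> x" using x by simp
        fix y assume y: "a \<le> y" "y \<le> x"
        have "(H has_real_derivative avg k (\<lambda>i. - (1 * gint (Suc 0) (Suc 1) y (z i)))) (at y)"
          unfolding H_def using gint_has_derivative_param[OF p[OF _ y(1)] z, where a = 0 and r = 1]
          by (intro avg_has_derivative) auto
        moreover have "avg k (\<lambda>i. - (1 * gint (Suc 0) (Suc 1) y (z i))) \<le> avg k (\<lambda>_. 0)"
          using gint_nonneg[OF p[OF _ y(1)] z] by (intro avg_mono) auto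
        ultimately show "\<exists>d. (H has_real_derivative d) (at y) \<and> d \<le> 0"
          using k by (auto simp: avg_const)
      qed
      then show "x \<in> I" using ab x p unfolding I_def by auto
    qed
    fix \<tau> assume \<tau>: "\<tau> \<in> I"
    show "(f has_real_derivative f' \<tau>) (at \<tau>)"
      unfolding f_def f'_def
      by (rule derivative_eq_intros DH[OF \<tau>] H_pos[OF \<tau>] refl)+
         (use split[OF \<tau>] H_pos[OF \<tau>] in \<open>simp add: field_simps\<close>)
    show "(f' has_real_derivative f'' \<tau>) (at \<tau>)"
      unfolding f'_def f''_def
      by (rule DERIV_cong[OF DERIV_diff[OF D02[OF \<tau>] DERIV_divide[OF D12[OF \<tau>] DH[OF \<tau>]]]])
         (use H_pos[OF \<tau>] in \<open>simp_all add: field_simps power2_eq_square\<close>)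
    define s where "s = 1 / H \<tau>"
    have H2: "1 - \<eta> \<le> H \<tau>" "H \<tau> \<le> 1 + \<eta>" using H_ge[OF \<tau>] \<tau> by (auto simp: I_def)
    have "\<bar>s - 1\<bar> = \<bar>1 - H \<tau>\<bar> / H \<tau>" using H_pos[OF \<tau>] by (simp add: s_def field_simps)
    also have "\<dots> \<le> \<eta> / (1/2)" using H2 \<eta> \<zeta> by (intro frac_le) auto
    finally have s: "\<bar>s - 1\<bar> \<le> \<zeta>" using \<eta> \<zeta> by simp
    have "s\<^sup>2 \<le> (21/20)\<^sup>2" using s \<zeta> by (intro power_mono) auto
    then have s2: "s\<^sup>2 \<le> 6/5" by (simp add: power2_eq_square)
    have "s\<^sup>2 * (1 + 1 / \<zeta>) * (2 * \<eta>) \<le> 6/5 * (1 + 1 / \<zeta>) * (2 * \<eta>)"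
      using s2 \<eta> \<zeta> by (intro mult_right_mono) auto
    also have "\<dots> = 4/5 * (\<eta> * (3 * (1 + 1 / \<zeta>)))" by simp
    also have "\<dots> \<le> 4/5" using \<eta>(3) by linarith
    finally have eta: "s\<^sup>2 * (1 + 1 / \<zeta>) * (2 * \<eta>) \<le> 4/5" .
    have "c0 \<le> 2 * s * ?T 2 3 \<tau> - 2 * ?T 1 3 \<tau> - s\<^sup>2 * (1 + \<zeta>) * (?T 1 2 \<tau>)\<^sup>2"
      using T[OF \<tau>, of 1 2] T[OF \<tau>, of 1 3] T[OF \<tau>, of 2 3] \<eta> \<eta>' \<zeta> by (intro curv s) auto
    also have "\<dots> \<le> 2 * s * ?A 2 3 \<tau> - 2 * ?A 1 3 \<tau> - s\<^sup>2 * (?A 1 2 \<tau>)\<^sup>2"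
    proof (rule truncated_curvature_le[OF z pos[OF \<tau>] K(1) _ \<zeta>(1) _ eta])
      show "9/10 \<le> s" using s \<zeta> by linarith
      show "?A 0 1 \<tau> - ?T 0 1 \<tau> \<le> 2 * \<eta>" using H2 H_ge[OF \<tau>] by (simp add: H_def)
    qed auto
    finally show "c0 \<le> f'' \<tau>" by (simp add: f''_def s_def)
  qed (use c0 r score in \<open>auto simp: f'_def\<close>)
  then show ?thesis by (simp add: f_def)
qed

section \<open>The local maximiser for well-behaved data\<close>

lemma abs_divide_sqrt_small:
  assumes "0 < (e::real)"
  shows "\<exists>k0::nat. \<forall>k\<ge>k0. k > 0 \<and> D / sqrt (real k) \<le> e"
proof -
  have "((\<lambda>k. D / sqrt (real k)) \<longlongrightarrow> 0) sequentially" by real_asymp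
  then have "\<forall>\<^sub>F k in sequentially. D / sqrt (real k) < e" using assms by (intro order_tendstoD) auto
  then have "\<forall>\<^sub>F k in sequentially. k > 0 \<and> D / sqrt (real k) \<le> e"
    using eventually_gt_at_top[of 0] by eventually_elim auto
  then show ?thesis by (simp add: eventually_sequentially)
qed

text \<open>The order of the quantifiers reflects how the constants depend on each other. The tolerance
  \<open>\<eta>1\<close> for the truncated averages depends on \<open>\<gamma>\<close> only; the truncation
  level \<open>K\<close> may be chosen afterwards so that the truncated means are within this tolerance of the
  limits. The radius \<open>\<epsilon>\<close> depends on both, but not on the bound \<open>C\<close> for the
  fluctuations. The last constant \<open>c\<close> makes \<open>z\<^sub>i/(1 + \<gamma>z\<^sub>i)\<close> so
  small against \<open>\<surd>k\<close> that all shapes within \<open>O(1/\<surd>k)\<close> of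
  \<open>\<gamma>\<close> are admissible. Parameters with \<open>h(\<tau>) > 1 + \<eta>\<close> lose against the
  minimiser directly, because \<open>s + \<tau>\<close> is positive and bounded away from zero near \<open>1 +
  \<gamma>\<close>.\<close>

theorem gpd_unique_local_argmax:
  fixes \<gamma> :: real
  assumes \<gamma>: "\<gamma> > -1/2"
  shows "\<exists>\<eta>1>0. \<forall>K\<ge>2. 1 + \<gamma> * K > 0 \<longrightarrow> (\<exists>\<epsilon>>0. \<forall>C>0. \<exists>c>0. \<exists>k0 C'. \<forall>k\<ge>k0. \<forall>z :: nat \<Rightarrow> real.
     (\<forall>i\<in>{1..k}. 0 \<le> z i \<and> 1 + \<gamma> * z i > 0 \<and> z i \<le> c * sqrt k * (1 + \<gamma> * z i)) \<longrightarrow>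
     \<bar>avg k (\<lambda>i. gint 0 1 \<gamma> (z i)) - 1\<bar> \<le> C / sqrt k \<longrightarrow>
     \<bar>avg k (\<lambda>i. gint 0 2 \<gamma> (z i) - gint 1 2 \<gamma> (z i))\<bar> \<le> C / sqrt k \<longrightarrow>
     avg k (\<lambda>i. gint 1 2 \<gamma> (z i)) \<le> C \<longrightarrow>
     (\<forall>(a, r)\<in>{(0, 1), (1, 2), (1, 3), (2, 3)}.
        \<bar>avg k (\<lambda>i. gint a r \<gamma> (min (z i) K)) - gmean \<gamma> a r\<bar> \<le> \<eta>1) \<longrightarrow>
     (\<exists>\<theta>. {\<theta>. is_arg_max (\<lambda>\<theta>. ereal (1 / real k) * (\<Sum>i=1..k. gpd_loglik \<theta> (z i)))
              (\<lambda>\<theta>. \<theta> \<in> Theta \<and> norm (\<theta> - (\<gamma>, 1)) < \<epsilon>) \<theta>} = {\<theta>}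
         \<and> norm (\<theta> - (\<gamma>, 1)) \<le> C' / sqrt k))"
proof -
  obtain \<zeta> c0 where \<zeta>: "0 < \<zeta>" "\<zeta> \<le> 1/20" and c0: "0 < c0" and curv: "\<And>s W B C. \<bar>s - 1\<bar> \<le> \<zeta> \<Longrightarrow> \<bar>W - gmean \<gamma> 1 2\<bar> \<le> \<zeta> \<Longrightarrow>
     \<bar>B - gmean \<gamma> 1 3\<bar> \<le> \<zeta> \<Longrightarrow> \<bar>C - gmean \<gamma> 2 3\<bar> \<le> \<zeta> \<Longrightarrow>
     c0 \<le> 2 * s * C - 2 * B - s\<^sup>2 * (1 + \<zeta>) * W\<^sup>2"
    using curvature_constants[OF \<gamma>] by (auto simp: gmean_def)
  define \<eta> where "\<eta> = min (\<zeta> / 4) (1 / (3 * (1 + 1 / \<zeta>)))"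
  have p3: "3 * (1 + 1 / \<zeta>) > 0" using \<zeta> by (simp add: add_pos_pos)
  have \<eta>: "0 < \<eta>" "\<eta> \<le> \<zeta> / 4" "\<eta> * (3 * (1 + 1 / \<zeta>)) \<le> 1"
  proof -
    show "0 < \<eta>" using \<zeta> p3 by (simp add: \<eta>_def)
    show "\<eta> \<le> \<zeta> / 4" by (simp add: \<eta>_def)
    have "\<eta> \<le> 1 / (3 * (1 + 1 / \<zeta>))" by (simp add: \<eta>_def)
    then show "\<eta> * (3 * (1 + 1 / \<zeta>)) \<le> 1" using p3 by (simp only: pos_le_divide_eq)
  qed
  show ?thesis
  proof (rule exI[of _ "\<eta> / 2"], intro conjI allI impI)
    show "0 < \<eta> / 2" using \<eta> by simp
    fix K :: real assume K: "2 \<le> K" "0 < 1 + \<gamma> * K"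
    have "\<forall>a r. \<exists>\<delta>>0. \<forall>\<tau> u. \<bar>\<tau> - \<gamma>\<bar> \<le> \<delta> \<longrightarrow> 0 \<le> u \<longrightarrow> u \<le> K \<longrightarrow>
      1 + \<tau> * K > 0 \<and> \<bar>gint a r \<tau> u - gint a r \<gamma> u\<bar> \<le> \<eta> / 2"
      using gint_param_uniform[of \<gamma> K "\<eta> / 2"] K \<eta> by auto
    then obtain D where D: "\<And>a r. D a r > 0" "\<And>a r \<tau> u. \<bar>\<tau> - \<gamma>\<bar> \<le> D a r \<Longrightarrow> 0 \<le> u \<Longrightarrow> u \<le> K \<Longrightarrow>
      \<bar>gint a r \<tau> u - gint a r \<gamma> u\<bar> \<le> \<eta> / 2" by metis
    define \<delta> where "\<delta> = Min {D 0 1, D 1 2, D 1 3, D 2 3}"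
    have \<delta>0: "\<delta> > 0" using D(1) by (simp add: \<delta>_def)
    have \<delta>: "\<bar>gint a r \<tau> u - gint a r \<gamma> u\<bar> \<le> \<eta> / 2"
      if "(a, r) \<in> {(0, 1), (1, 2), (1, 3), (2, 3)}" "\<bar>\<tau> - \<gamma>\<bar> \<le> \<delta>" "0 \<le> u" "u \<le> K" for a r \<tau> u
      using that D(2)[of \<tau> a r u] by (auto simp: \<delta>_def)
    \<comment> \<open>The last entry keeps \<open>(s + \<tau>)(1 + \<eta>)\<close> above \<open>1 + \<gamma>\<close> by a margin.\<close>
    define \<epsilon> where "\<epsilon> = Min {1/4, (\<gamma> + 1/2) / 2, \<delta> / (2 + 2 * \<bar>\<gamma>\<bar>), \<eta> * (1 + \<gamma>) / 2 / (4 + 4 * (1 + \<gamma>))}"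
    have g1: "1 + \<gamma> > 0" using \<gamma> by simp
    have \<epsilon>0: "\<epsilon> > 0" using \<gamma> \<delta>0 \<eta> g1 by (auto simp: \<epsilon>_def intro!: divide_pos_pos mult_pos_pos add_pos_pos)
    have \<epsilon>1: "\<epsilon> \<le> 1/4" "\<epsilon> \<le> (\<gamma> + 1/2) / 2" unfolding \<epsilon>_def by (intro Min_le; simp)+
    have \<epsilon>2: "\<epsilon> * (2 + 2 * \<bar>\<gamma>\<bar>) \<le> \<delta>"
    proof -
      have "\<epsilon> \<le> \<delta> / (2 + 2 * \<bar>\<gamma>\<bar>)" unfolding \<epsilon>_def by (intro Min_le; simp)
      then show ?thesis by (subst (asm) pos_le_divide_eq) auto
    qed
    have \<epsilon>3: "\<epsilon> * (4 + 4 * (1 + \<gamma>)) \<le> \<eta> * (1 + \<gamma>) / 2"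
    proof -
      have "\<epsilon> \<le> \<eta> * (1 + \<gamma>) / 2 / (4 + 4 * (1 + \<gamma>))" unfolding \<epsilon>_def by (intro Min_le; simp)
      then show ?thesis using g1 by (subst (asm) pos_le_divide_eq) auto
    qed
    have coords: "\<sigma> > 0" "g > -1/2" "\<bar>1 / \<sigma> - 1\<bar> \<le> 2 * \<epsilon>" "\<bar>g / \<sigma> - \<gamma>\<bar> \<le> \<delta>" "\<bar>g - \<gamma>\<bar> < \<epsilon>"
      if "norm ((g, \<sigma>) - (\<gamma>, 1)) < \<epsilon>" for g \<sigma>
    proof -
      have a: "\<bar>g - \<gamma>\<bar> < \<epsilon>" "\<bar>\<sigma> - 1\<bar> < \<epsilon>"
        using that norm_fst_le[of "g - \<gamma>" "\<sigma> - 1"] norm_snd_le[of "\<sigma> - 1" "g - \<gamma>"] by auto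
      have s: "\<sigma> \<ge> 3/4" using a \<epsilon>1 by auto
      show "\<sigma> > 0" "\<bar>g - \<gamma>\<bar> < \<epsilon>" using a s by auto
      show "g > -1/2" using a \<epsilon>1 \<gamma> by auto
      have "\<bar>1 / \<sigma> - 1\<bar> = \<bar>\<sigma> - 1\<bar> / \<sigma>" using s by (simp add: field_simps)
      also have "\<dots> \<le> \<epsilon> / (1/2)" using a s by (intro frac_le) auto
      finally show b: "\<bar>1 / \<sigma> - 1\<bar> \<le> 2 * \<epsilon>" by simp
      have "g / \<sigma> - \<gamma> = (g - \<gamma>) / \<sigma> + \<gamma> * (1 / \<sigma> - 1)" using s by (simp add: field_simps)
      also have "\<bar>\<dots>\<bar> \<le> \<bar>g - \<gamma>\<bar> / \<sigma> + \<bar>\<gamma>\<bar> * \<bar>1 / \<sigma> - 1\<bar>"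
        using s abs_triangle_ineq[of "(g - \<gamma>) / \<sigma>" "\<gamma> * (1 / \<sigma> - 1)"] by (simp add: abs_mult)
      also have "\<dots> \<le> \<epsilon> / (1/2) + \<bar>\<gamma>\<bar> * (2 * \<epsilon>)"
        using a s b by (intro add_mono frac_le mult_left_mono) auto
      also have "\<dots> = \<epsilon> * (2 + 2 * \<bar>\<gamma>\<bar>)" by (simp add: algebra_simps)
      finally show "\<bar>g / \<sigma> - \<gamma>\<bar> \<le> \<delta>" using \<epsilon>2 by linarith
    qed
    show "\<exists>\<epsilon>>0. \<forall>C>0. \<exists>c>0. \<exists>k0 C'. \<forall>k\<ge>k0. \<forall>z :: nat \<Rightarrow> real.
     (\<forall>i\<in>{1..k}. 0 \<le> z i \<and> 1 + \<gamma> * z i > 0 \<and> z i \<le> c * sqrt k * (1 + \<gamma> * z i)) \<longrightarrow>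
     \<bar>avg k (\<lambda>i. gint 0 1 \<gamma> (z i)) - 1\<bar> \<le> C / sqrt k \<longrightarrow>
     \<bar>avg k (\<lambda>i. gint 0 2 \<gamma> (z i) - gint 1 2 \<gamma> (z i))\<bar> \<le> C / sqrt k \<longrightarrow>
     avg k (\<lambda>i. gint 1 2 \<gamma> (z i)) \<le> C \<longrightarrow>
     (\<forall>(a, r)\<in>{(0, 1), (1, 2), (1, 3), (2, 3)}.
        \<bar>avg k (\<lambda>i. gint a r \<gamma> (min (z i) K)) - gmean \<gamma> a r\<bar> \<le> \<eta> / 2) \<longrightarrow>
     (\<exists>\<theta>. {\<theta>. is_arg_max (\<lambda>\<theta>. ereal (1 / real k) * (\<Sum>i=1..k. gpd_loglik \<theta> (z i)))
              (\<lambda>\<theta>. \<theta> \<in> Theta \<and> norm (\<theta> - (\<gamma>, 1)) < \<epsilon>) \<theta>} = {\<theta>}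
         \<and> norm (\<theta> - (\<gamma>, 1)) \<le> C' / sqrt k)"
    proof (rule exI[of _ \<epsilon>], rule conjI[OF \<epsilon>0], intro allI impI)
      fix C :: real assume C: "0 < C"
      \<comment> \<open>\<open>Cr/\<surd>k\<close> bounds the distance of the profile minimiser from \<open>\<gamma>\<close>, and \<open>Ch/\<surd>k\<close> that of \<open>h\<close> from one there.\<close>
      define Cr where "Cr = (C + 2 * C\<^sup>2) / c0"
      have Cr: "Cr > 0" using C c0 by (auto simp: Cr_def intro!: divide_pos_pos add_pos_pos)
      define Ch where "Ch = C + 2 * Cr * C"
      have Ch: "Ch > 0" using C Cr by (auto simp: Ch_def intro!: add_pos_pos)
      define C' where "C' = 2 * Cr + (1 + \<bar>\<gamma>\<bar>) * Ch"
      have C': "C' > 0" using Ch Cr by (auto simp: C'_def intro!: add_pos_nonneg mult_nonneg_nonneg)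
      define E where "E = C + Cr + Ch + (1 + \<bar>\<gamma>\<bar>) * C + C'"
      define e where "e = Min {\<eta>, \<delta>, \<epsilon> / 2, \<eta> * (1 + \<gamma>) / 4}"
      have e: "e > 0" using \<eta> \<delta>0 \<epsilon>0 g1 by (simp add: e_def)
      obtain k0 :: nat where k0: "\<And>k. k \<ge> k0 \<Longrightarrow> k > 0 \<and> E / sqrt (real k) \<le> e"
        using abs_divide_sqrt_small[OF e, of E] by blast
      show "\<exists>c>0. \<exists>k0 C'. \<forall>k\<ge>k0. \<forall>z :: nat \<Rightarrow> real.
     (\<forall>i\<in>{1..k}. 0 \<le> z i \<and> 1 + \<gamma> * z i > 0 \<and> z i \<le> c * sqrt k * (1 + \<gamma> * z i)) \<longrightarrow>
     \<bar>avg k (\<lambda>i. gint 0 1 \<gamma> (z i)) - 1\<bar> \<le> C / sqrt k \<longrightarrow>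
     \<bar>avg k (\<lambda>i. gint 0 2 \<gamma> (z i) - gint 1 2 \<gamma> (z i))\<bar> \<le> C / sqrt k \<longrightarrow>
     avg k (\<lambda>i. gint 1 2 \<gamma> (z i)) \<le> C \<longrightarrow>
     (\<forall>(a, r)\<in>{(0, 1), (1, 2), (1, 3), (2, 3)}.
        \<bar>avg k (\<lambda>i. gint a r \<gamma> (min (z i) K)) - gmean \<gamma> a r\<bar> \<le> \<eta> / 2) \<longrightarrow>
     (\<exists>\<theta>. {\<theta>. is_arg_max (\<lambda>\<theta>. ereal (1 / real k) * (\<Sum>i=1..k. gpd_loglik \<theta> (z i)))
              (\<lambda>\<theta>. \<theta> \<in> Theta \<and> norm (\<theta> - (\<gamma>, 1)) < \<epsilon>) \<theta>} = {\<theta>}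
         \<and> norm (\<theta> - (\<gamma>, 1)) \<le> C' / sqrt k)"
      proof (rule exI[of _ "1 / (2 * Cr)"], rule conjI, use Cr in simp,
          rule exI[of _ k0], rule exI[of _ C'], intro allI impI)
        fix k :: nat and z :: "nat \<Rightarrow> real"
        assume "k0 \<le> k"
          and zz: "\<forall>i\<in>{1..k}. 0 \<le> z i \<and> 0 < 1 + \<gamma> * z i \<and> z i \<le> 1 / (2 * Cr) * sqrt k * (1 + \<gamma> * z i)"
          and h1: "\<bar>avg k (\<lambda>i. gint 0 1 \<gamma> (z i)) - 1\<bar> \<le> C / sqrt k"
          and h2: "\<bar>avg k (\<lambda>i. gint 0 2 \<gamma> (z i) - gint 1 2 \<gamma> (z i))\<bar> \<le> C / sqrt k"
          and h3: "avg k (\<lambda>i. gint 1 2 \<gamma> (z i)) \<le> C"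
          and h4: "\<forall>(a, r)\<in>{(0, 1), (1, 2), (1, 3), (2, 3)}.
            \<bar>avg k (\<lambda>i. gint a r \<gamma> (min (z i) K)) - gmean \<gamma> a r\<bar> \<le> \<eta> / 2"
        have k: "k > 0" and Ek: "E / sqrt k \<le> e" using k0[OF \<open>k0 \<le> k\<close>] by auto
        have sk: "sqrt k > 0" using k by simp
        have small: "X / sqrt k \<le> e" if "X \<le> E" for X
          using Ek divide_right_mono[OF that, of "sqrt k"] sk by linarith
        have sm: "C / sqrt k \<le> e" "Cr / sqrt k \<le> e" "Ch / sqrt k \<le> e"
          "(1 + \<bar>\<gamma>\<bar>) * C / sqrt k \<le> e" "C' / sqrt k \<le> e"
          using C Cr Ch C' by (auto intro!: small simp: E_def)
        have ee: "e \<le> \<eta>" "e \<le> \<delta>" "e \<le> \<epsilon> / 2" "e \<le> \<eta> * (1 + \<gamma>) / 4" unfolding e_def by (intro Min_le; simp)+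
        have \<eta>80: "\<eta> \<le> 1/80" using \<eta> \<zeta> by linarith
        define r where "r = Cr / sqrt k"
        have r: "r > 0" using Cr sk by (simp add: r_def)
        have z0: "\<And>i. i \<in> {1..k} \<Longrightarrow> 0 \<le> z i" and zp: "\<And>i. i \<in> {1..k} \<Longrightarrow> 0 < 1 + \<gamma> * z i"
          using zz by auto
        define H where "H = (\<lambda>\<tau>. avg k (\<lambda>i. gint 0 1 \<tau> (z i)))"
        define W where "W = avg k (\<lambda>i. gint 1 2 \<gamma> (z i))"
        have W0: "0 \<le> W" unfolding W_def using gint_nonneg zp z0 by (intro avg_nonneg) auto
        have near: "1 + \<tau> * z i > 0"
          "\<bar>gint 0 1 \<tau> (z i) - gint 0 1 \<gamma> (z i)\<bar> \<le> 2 * r * gint 1 2 \<gamma> (z i)"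
          if "\<bar>\<tau> - \<gamma>\<bar> \<le> r" "i \<in> {1..k}" for \<tau> i
        proof -
          have "\<bar>\<tau> - \<gamma>\<bar> * z i \<le> r * (1 / (2 * Cr) * sqrt k * (1 + \<gamma> * z i))"
            using that zz r by (intro mult_mono) auto
          also have "\<dots> = (1 + \<gamma> * z i) / 2" using Cr sk by (simp add: r_def)
          finally have *: "\<bar>\<tau> - \<gamma>\<bar> * z i \<le> (1 + \<gamma> * z i) / 2" .
          note L = gint_param_lipschitz[OF zp[OF that(2)] z0[OF that(2)] *]
          show "1 + \<tau> * z i > 0" by (rule L)
          have "2 * \<bar>\<tau> - \<gamma>\<bar> * gint 1 2 \<gamma> (z i) \<le> 2 * r * gint 1 2 \<gamma> (z i)"
            using that gint_nonneg[OF zp z0] by (intro mult_right_mono) auto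
          with L(2) show "\<bar>gint 0 1 \<tau> (z i) - gint 0 1 \<gamma> (z i)\<bar> \<le> 2 * r * gint 1 2 \<gamma> (z i)" by linarith
        qed
        have Hnear: "\<bar>H \<tau> - 1\<bar> \<le> Ch / sqrt k" if "\<bar>\<tau> - \<gamma>\<bar> \<le> r" for \<tau>
        proof -
          have "\<bar>H \<tau> - H \<gamma>\<bar> \<le> avg k (\<lambda>i. \<bar>gint 0 1 \<tau> (z i) - gint 0 1 \<gamma> (z i)\<bar>)"
            unfolding H_def avg_diff[symmetric] by (rule avg_abs_le)
          also have "\<dots> \<le> avg k (\<lambda>i. 2 * r * gint 1 2 \<gamma> (z i))" by (intro avg_mono near that)
          also have "\<dots> = 2 * r * W" unfolding avg_cmult W_def ..
          also have "\<dots> \<le> 2 * r * C" using r h3 by (intro mult_left_mono) (auto simp: W_def)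
          finally have "\<bar>H \<tau> - 1\<bar> \<le> 2 * r * C + C / sqrt k" using h1 unfolding H_def by linarith
          also have "\<dots> = Ch / sqrt k" by (simp add: Ch_def r_def add_divide_distrib)
          finally show ?thesis .
        qed
        define I where "I = {\<tau>. \<bar>\<tau> - \<gamma>\<bar> \<le> \<delta> \<and> (\<forall>i\<in>{1..k}. 1 + \<tau> * z i > 0) \<and> H \<tau> \<le> 1 + \<eta>}"
        have rI: "{\<gamma> - r..\<gamma> + r} \<subseteq> I"
        proof
          fix \<tau> assume "\<tau> \<in> {\<gamma> - r..\<gamma> + r}"
          then have t: "\<bar>\<tau> - \<gamma>\<bar> \<le> r" by (auto simp: abs_le_iff)
          have "r \<le> \<delta>" using sm(2) ee(2) by (simp add: r_def)
          moreover have "H \<tau> \<le> 1 + \<eta>" using Hnear[OF t] sm(3) ee(1) by linarith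
          ultimately show "\<tau> \<in> I" using t near(1)[OF t] by (auto simp: I_def)
        qed
        have H\<gamma>: "\<bar>H \<gamma> - 1\<bar> \<le> C / sqrt k" "H \<gamma> \<ge> 1/2" using h1 sm(1) ee(1) \<eta>80 by (auto simp: H_def)
        have score: "\<bar>avg k (\<lambda>i. gint 0 2 \<gamma> (z i)) - W / H \<gamma>\<bar> \<le> c0 * r"
        proof -
          have "avg k (\<lambda>i. gint 0 2 \<gamma> (z i)) - W / H \<gamma> =
              avg k (\<lambda>i. gint 0 2 \<gamma> (z i) - gint 1 2 \<gamma> (z i)) + W * (H \<gamma> - 1) / H \<gamma>"
            using H\<gamma> unfolding avg_diff W_def[symmetric] by (simp add: field_simps)
          also have "\<bar>\<dots>\<bar> \<le> C / sqrt k + W * \<bar>H \<gamma> - 1\<bar> / H \<gamma>"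
            using h2 abs_triangle_ineq[of "avg k (\<lambda>i. gint 0 2 \<gamma> (z i) - gint 1 2 \<gamma> (z i))" "W * (H \<gamma> - 1) / H \<gamma>"]
              W0 H\<gamma> by (auto simp: abs_mult)
          also have "\<dots> \<le> C / sqrt k + C * (C / sqrt k) / (1/2)"
            using H\<gamma> W0 h3 C sk by (intro add_mono frac_le mult_mono) (auto simp: W_def)
          also have "\<dots> = (C + 2 * C\<^sup>2) / sqrt k" by (simp add: add_divide_distrib power2_eq_square)
          also have "\<dots> = c0 * r" using c0 by (simp add: r_def Cr_def)
          finally show ?thesis .
        qed
        have "\<exists>t\<in>{\<gamma> - r..\<gamma> + r}. \<forall>\<tau>\<in>I. \<tau> \<noteq> t \<longrightarrow> ln (H t) + t * H t < ln (H \<tau>) + \<tau> * H \<tau>"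
          unfolding H_def I_def
        proof (rule profile_minimum[where K = K and \<eta>' = "\<eta> / 2"])
          show "\<bar>avg k (\<lambda>i. gint 0 2 \<gamma> (z i)) - avg k (\<lambda>i. gint 1 2 \<gamma> (z i)) / avg k (\<lambda>i. gint 0 1 \<gamma> (z i))\<bar> \<le> c0 * r"
            using score by (simp add: W_def H_def)
          show "{\<gamma> - r..\<gamma> + r} \<subseteq> {\<tau>. \<bar>\<tau> - \<gamma>\<bar> \<le> \<delta> \<and> (\<forall>i\<in>{1..k}. 1 + \<tau> * z i > 0) \<and> avg k (\<lambda>i. gint 0 1 \<tau> (z i)) \<le> 1 + \<eta>}"
            using rI by (simp add: I_def H_def)
          show "\<bar>avg k (\<lambda>i. gint a r \<gamma> (min (z i) K)) - gmean \<gamma> a r\<bar> \<le> \<eta> / 2"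
            if "(a, r) \<in> {(0, 1), (1, 2), (1, 3), (2, 3)}" for a r using h4 that by blast
        qed (fact k z0 zp \<zeta> c0 curv \<eta> K \<delta> r order_refl)+
        then obtain t where t: "\<bar>t - \<gamma>\<bar> \<le> r" "t \<in> I"
          and tmin: "\<And>\<tau>. \<tau> \<in> I \<Longrightarrow> \<tau> \<noteq> t \<Longrightarrow> ln (H t) + t * H t < ln (H \<tau>) + \<tau> * H \<tau>"
          using rI by (force simp: abs_le_iff)
        define L where "L = (\<lambda>\<theta>. ereal (1 / real k) * (\<Sum>i=1..k. gpd_loglik \<theta> (z i)))"
        define \<theta> where "\<theta> = (t * H t, H t)"
        have Ht: "\<bar>H t - 1\<bar> \<le> Ch / sqrt k" by (rule Hnear[OF t(1)])
        have Ht2: "H t \<ge> 1/2" "H t \<le> 2" using Ht sm(3) ee(1) \<eta>80 by linarith+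
        have "norm (\<theta> - (\<gamma>, 1)) \<le> \<bar>t * H t - \<gamma>\<bar> + \<bar>H t - 1\<bar>"
          using norm_Pair_le[of "t * H t - \<gamma>" "H t - 1"] by (simp add: \<theta>_def)
        also have "t * H t - \<gamma> = (t - \<gamma>) * H t + \<gamma> * (H t - 1)" by (simp add: algebra_simps)
        also have "\<bar>\<dots>\<bar> \<le> \<bar>t - \<gamma>\<bar> * H t + \<bar>\<gamma>\<bar> * \<bar>H t - 1\<bar>"
          using abs_triangle_ineq[of "(t - \<gamma>) * H t" "\<gamma> * (H t - 1)"] Ht2 by (simp add: abs_mult)
        also have "\<dots> \<le> r * 2 + \<bar>\<gamma>\<bar> * (Ch / sqrt k)"
          using t(1) Ht2 Ht by (intro add_mono mult_mono) auto
        finally have n: "norm (\<theta> - (\<gamma>, 1)) \<le> C' / sqrt k"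
          using Ht by (simp add: C'_def r_def add_divide_distrib algebra_simps)
        have n\<epsilon>: "norm (\<theta> - (\<gamma>, 1)) < \<epsilon>" using n sm(5) ee(3) \<epsilon>0 by linarith
        have \<theta>T: "\<theta> \<in> Theta"
          using coords(1,2)[of "t * H t" "H t"] n\<epsilon> by (simp add: \<theta>_def Theta_def)
        have tz: "1 + t * z i > 0" if "i \<in> {1..k}" for i using t(2) that by (auto simp: I_def)
        have L\<theta>: "L \<theta> = ereal (- (1 + (ln (H t) + t * H t)))"
        proof -
          have "L \<theta> = ereal (- (- ln (1 / H t) + (1 / H t + t * H t / H t) * avg k (\<lambda>i. gint 0 1 (t * H t / H t) (z i))))"
            unfolding L_def \<theta>_def using tz z0 k Ht2 by (intro mean_loglik_eq) auto
          moreover have "t * H t / H t = t" using Ht2 by simp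
          ultimately have "L \<theta> = ereal (- (- ln (1 / H t) + (1 / H t + t) * H t))"
            by (simp only: H_def)
          moreover have "- ln (1 / H t) + (1 / H t + t) * H t = 1 + (ln (H t) + t * H t)"
            using Ht2 by (simp add: ln_div field_simps)
          ultimately show ?thesis by simp
        qed
        have better: "L \<theta>' < L \<theta>" if "norm (\<theta>' - (\<gamma>, 1)) < \<epsilon>" "\<theta>' \<noteq> \<theta>" for \<theta>'
        proof -
          obtain g \<sigma> where gs: "\<theta>' = (g, \<sigma>)" by (cases \<theta>')
          define s where "s = 1 / \<sigma>"
          define \<tau> where "\<tau> = g / \<sigma>"
          have c: "\<sigma> > 0" "g > -1/2" "\<bar>s - 1\<bar> \<le> 2 * \<epsilon>" "\<bar>\<tau> - \<gamma>\<bar> \<le> \<delta>" "\<bar>g - \<gamma>\<bar> < \<epsilon>"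
            using coords[of g \<sigma>] that unfolding gs s_def \<tau>_def by auto
          have s: "s > 0" using c by (simp add: s_def)
          show ?thesis
          proof (cases "\<forall>i\<in>{1..k}. 1 + \<tau> * z i > 0")
            case False
            then obtain i where "i \<in> {1..k}" "\<not> 1 + \<tau> * z i > 0" by auto
            then have "L \<theta>' = -\<infinity>"
              unfolding L_def gs using k by (intro mean_loglik_MInf) (auto simp: \<tau>_def)
            then show ?thesis by (simp add: L\<theta>)
          next
            case True
            then have L': "L \<theta>' = ereal (- (- ln s + (s + \<tau>) * H \<tau>))"
              unfolding L_def gs s_def \<tau>_def H_def using z0 k c by (intro mean_loglik_eq) auto
            have "1 + (ln (H t) + t * H t) < - ln s + (s + \<tau>) * H \<tau>"
            proof (cases "H \<tau> \<le> 1 + \<eta>")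
              case H\<tau>: True
              then have \<tau>I: "\<tau> \<in> I" using True c by (simp add: I_def)
              have Hpos: "H \<tau> > 0"
              proof -
                have "0 \<le> H \<tau>" unfolding H_def using True z0 by (intro avg_nonneg gint_nonneg) auto
                moreover have "H \<tau> \<noteq> 0"
                proof
                  assume "H \<tau> = 0"
                  then have all0: "gint 0 1 \<tau> (z i) = 0" if "i \<in> {1..k}" for i
                    using k that True z0 gint_nonneg[of \<tau> "z i" 0 1 for i] unfolding H_def avg_def
                    by (subst (asm) divide_eq_0_iff, subst (asm) sum_nonneg_eq_0_iff) auto
                  have "z i = 0" if i: "i \<in> {1..k}" for i
                  proof -
                    have "gq \<tau> (z i) = 0" using all0[OF i] gint_0_1[of \<tau> "z i"] True z0 i by simp
                    then show ?thesis using zeta_gq[of \<tau> "z i"] True i by simp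
                  qed
                  then have "H \<gamma> = 0" by (simp add: H_def avg_def)
                  then show False using H\<gamma> by simp
                qed
                ultimately show ?thesis by simp
              qed
              have e1: "1 + (ln (H \<tau>) + \<tau> * H \<tau>) \<le> - ln s + (s + \<tau>) * H \<tau>"
                using profile_bound(1)[OF s Hpos] by (simp add: algebra_simps)
              show ?thesis
              proof (cases "\<tau> = t")
                case False
                then show ?thesis using tmin[OF \<tau>I] e1 by simp
              next
                case \<tau>t: True
                have "s * H \<tau> \<noteq> 1"
                proof
                  assume "s * H \<tau> = 1"
                  then have "\<sigma> = H t" using c(1) by (simp add: s_def \<tau>t field_simps)
                  moreover have "g = t * \<sigma>" using c(1) \<tau>t by (auto simp: \<tau>_def field_simps)
                  ultimately show False using that(2) by (simp add: gs \<theta>_def)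
                qed
                then show ?thesis
                  using profile_bound(2)[OF s Hpos] \<tau>t by (simp add: algebra_simps)
              qed
            next
              case H\<tau>: False
              have "\<gamma> \<in> I" using rI r by auto
              then have "ln (H t) + t * H t \<le> ln (H \<gamma>) + \<gamma> * H \<gamma>"
                using tmin[of \<gamma>] by (cases "t = \<gamma>") (auto simp: less_imp_le)
              also have "\<dots> \<le> H \<gamma> - 1 + \<gamma> * H \<gamma>" using ln_le_minus_one[of "H \<gamma>"] H\<gamma> by simp
              also have "\<dots> = \<gamma> + (1 + \<gamma>) * (H \<gamma> - 1)" by (simp add: algebra_simps)
              also have "(1 + \<gamma>) * (H \<gamma> - 1) \<le> (1 + \<gamma>) * (C / sqrt k)"
                using H\<gamma> g1 by (intro mult_left_mono) auto
              also have "\<dots> \<le> (1 + \<bar>\<gamma>\<bar>) * (C / sqrt k)"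
                using C sk by (intro mult_right_mono) auto
              also have "\<dots> \<le> \<eta> * (1 + \<gamma>) / 4"
                unfolding times_divide_eq_right[of "1 + \<bar>\<gamma>\<bar>"] using sm(4) ee(4) by linarith
              finally have up: "1 + (ln (H t) + t * H t) \<le> 1 + \<gamma> + \<eta> * (1 + \<gamma>) / 4" by simp
              have st: "s + \<tau> = s * (1 + g)" by (simp add: s_def \<tau>_def add_divide_distrib)
              have "(1 - 2 * \<epsilon>) * (1 + \<gamma> - \<epsilon>) \<le> s * (1 + g)"
                using c \<epsilon>1 \<gamma> s by (intro mult_mono) auto
              moreover have "(1 - 2 * \<epsilon>) * (1 + \<gamma> - \<epsilon>) \<ge> (1 + \<gamma>) - \<epsilon> - 2 * \<epsilon> * (1 + \<gamma>)"
                using \<epsilon>0 by (simp add: algebra_simps)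
              ultimately have st2: "(1 + \<gamma>) - \<epsilon> - 2 * \<epsilon> * (1 + \<gamma>) \<le> s + \<tau>" unfolding st by linarith
              have pos: "0 \<le> s + \<tau>" unfolding st using s c by simp
              have "ln s \<le> 2 * \<epsilon>" using ln_le_minus_one[OF s] c by linarith
              moreover have "(s + \<tau>) * (1 + \<eta>) \<le> (s + \<tau>) * H \<tau>"
                using H\<tau> pos by (intro mult_left_mono) auto
              moreover have "((1 + \<gamma>) - \<epsilon> - 2 * \<epsilon> * (1 + \<gamma>)) * (1 + \<eta>) \<le> (s + \<tau>) * (1 + \<eta>)"
                using st2 \<eta> by (intro mult_right_mono) auto
              moreover have "((1 + \<gamma>) - \<epsilon> - 2 * \<epsilon> * (1 + \<gamma>)) * (1 + \<eta>)
                  = (1 + \<gamma>) + \<eta> * (1 + \<gamma>) - (\<epsilon> + 2 * \<epsilon> * (1 + \<gamma>)) * (1 + \<eta>)" by (simp add: algebra_simps)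
              moreover have "(\<epsilon> + 2 * \<epsilon> * (1 + \<gamma>)) * (1 + \<eta>) \<le> (\<epsilon> + 2 * \<epsilon> * (1 + \<gamma>)) * 2"
                using \<epsilon>0 g1 \<eta>80 by (intro mult_left_mono) auto
              moreover have "(\<epsilon> + 2 * \<epsilon> * (1 + \<gamma>)) * 2 + 2 * \<epsilon> = \<epsilon> * (4 + 4 * (1 + \<gamma>))" by (simp add: algebra_simps)
              moreover have "0 < \<eta> * (1 + \<gamma>)" using \<eta> g1 by simp
              ultimately show ?thesis using up \<epsilon>3 by linarith
            qed
            then show ?thesis by (simp add: L' L\<theta>)
          qed
        qed
        show "\<exists>\<theta>. {\<theta>. is_arg_max (\<lambda>\<theta>. ereal (1 / real k) * (\<Sum>i=1..k. gpd_loglik \<theta> (z i)))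
              (\<lambda>\<theta>. \<theta> \<in> Theta \<and> norm (\<theta> - (\<gamma>, 1)) < \<epsilon>) \<theta>} = {\<theta>}
            \<and> norm (\<theta> - (\<gamma>, 1)) \<le> C' / sqrt k"
          unfolding L_def[symmetric]
        proof (rule exI[of _ \<theta>], rule conjI[OF _ n], intro set_eqI iffI)
          fix x assume "x \<in> {\<theta>. is_arg_max L (\<lambda>\<theta>. \<theta> \<in> Theta \<and> norm (\<theta> - (\<gamma>, 1)) < \<epsilon>) \<theta>}"
          then show "x \<in> {\<theta>}" using better[of x] \<theta>T n\<epsilon> unfolding is_arg_max_def by blast
        next
          fix x assume "x \<in> {\<theta>}"
          then show "x \<in> {\<theta>. is_arg_max L (\<lambda>\<theta>. \<theta> \<in> Theta \<and> norm (\<theta> - (\<gamma>, 1)) < \<epsilon>) \<theta>}"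
            using better \<theta>T n\<epsilon> unfolding is_arg_max_def by (blast dest: less_asym)
        qed
      qed
    qed
  qed
qed

section \<open>Uniform second-order regular variation\<close>

text \<open>The exceptional sets are contained in a decreasing sequence of sets of finite measure with empty intersection.\<close>

lemma emeasure_complement_tendsto_0:
  fixes P :: "nat \<Rightarrow> real \<Rightarrow> bool"
  assumes S: "\<And>n. {y \<in> {a..b}. P n y} \<in> sets lebesgue"
    and ev: "\<And>y. y \<in> {a..b} \<Longrightarrow> \<forall>\<^sub>F n in sequentially. P n y"
  shows "(\<lambda>n. emeasure lebesgue ({a..b} - {y \<in> {a..b}. P n y})) \<longlonglongrightarrow> 0"
proof -
  define V where "V = (\<lambda>m. \<Union>n\<in>{m..}. {a..b} - {y \<in> {a..b}. P n y})"
  have Vs: "V m \<in> sets lebesgue" for m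
    unfolding V_def using S by (intro sets.countable_UN' sets.Diff) auto
  have "(\<lambda>m. emeasure lebesgue (V m)) \<longlonglongrightarrow> emeasure lebesgue (\<Inter>m. V m)"
  proof (rule Lim_emeasure_decseq)
    show "range V \<subseteq> sets lebesgue" using Vs by auto
    show "decseq V" unfolding V_def decseq_def by (auto intro: order_trans)
    fix m
    have "emeasure lebesgue (V m) \<le> emeasure lebesgue {a..b}"
      unfolding V_def by (intro emeasure_mono) auto
    also have "\<dots> < \<infinity>" by (simp add: emeasure_lborel_Icc_eq)
    finally show "emeasure lebesgue (V m) \<noteq> \<infinity>" by simp
  qed
  also have "(\<Inter>m. V m) = {}"
  proof -
    have False if "\<And>m. y \<in> V m" for y
    proof -
      have y: "y \<in> {a..b}" using that[of 0] by (auto simp: V_def)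
      obtain N where "\<And>n. n \<ge> N \<Longrightarrow> P n y" using ev[OF y] by (auto simp: eventually_sequentially)
      then show False using that[of N] by (auto simp: V_def)
    qed
    then show ?thesis by blast
  qed
  finally have *: "(\<lambda>m. emeasure lebesgue (V m)) \<longlonglongrightarrow> 0" by simp
  show ?thesis
  proof (rule tendsto_sandwich[OF _ _ tendsto_const *])
    show "\<forall>\<^sub>F n in sequentially. emeasure lebesgue ({a..b} - {y \<in> {a..b}. P n y}) \<le> emeasure lebesgue (V n)"
      by (intro always_eventually allI emeasure_mono Vs) (auto simp: V_def)
  qed auto
qed

text \<open>Both exceptional sets have small measure, and a dilation by \<open>x n \<in> [1/2, 2]\<close> distorts measure
  by a factor of at most two; hence the good set of \<open>Q\<close>, dilated, meets the good set of
  \<open>P\<close>. This replaces the uniformity in \<open>x\<close> that pointwise convergence lacks.\<close>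

lemma eventually_common_point:
  fixes P Q :: "nat \<Rightarrow> real \<Rightarrow> bool" and x :: "nat \<Rightarrow> real"
  assumes ab: "0 < \<alpha>" "\<alpha> < \<beta>" and x: "\<And>n. x n \<in> {1/2..2}"
    and PS: "\<And>n. {y \<in> {\<alpha>/2..2*\<beta>}. P n y} \<in> sets lebesgue"
    and QS: "\<And>n. {y \<in> {\<alpha>..\<beta>}. Q n y} \<in> sets lebesgue"
    and P: "\<And>y. y \<in> {\<alpha>/2..2*\<beta>} \<Longrightarrow> \<forall>\<^sub>F n in sequentially. P n y"
    and Q: "\<And>y. y \<in> {\<alpha>..\<beta>} \<Longrightarrow> \<forall>\<^sub>F n in sequentially. Q n y"
  shows "\<forall>\<^sub>F n in sequentially. \<exists>y\<in>{\<alpha>..\<beta>}. Q n y \<and> P n (x n * y)"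
proof -
  let ?p = "\<lambda>n. {\<alpha>/2..2*\<beta>} - {y \<in> {\<alpha>/2..2*\<beta>}. P n y}"
  let ?q = "\<lambda>n. {\<alpha>..\<beta>} - {y \<in> {\<alpha>..\<beta>}. Q n y}"
  have "\<forall>\<^sub>F n in sequentially. emeasure lebesgue (?p n) < ennreal ((\<beta> - \<alpha>) / 4)"
    by (rule order_tendstoD(2)[OF emeasure_complement_tendsto_0[OF PS P]]) (use ab in simp_all)
  moreover have "\<forall>\<^sub>F n in sequentially. emeasure lebesgue (?q n) < ennreal ((\<beta> - \<alpha>) / 2)"
    by (rule order_tendstoD(2)[OF emeasure_complement_tendsto_0[OF QS Q]]) (use ab in simp_all)
  ultimately show ?thesis
  proof eventually_elim
    case (elim n)
    show ?case
    proof (rule ccontr)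
      assume no: "\<not> ?thesis"
      let ?W = "{y \<in> {\<alpha>..\<beta>}. Q n y}"
      have xn: "1/2 \<le> x n" "x n \<le> 2" using x[of n] by auto
      have sub: "(*) (x n) ` ?W \<subseteq> ?p n"
      proof
        fix w assume "w \<in> (*) (x n) ` ?W"
        then obtain y where y: "y \<in> ?W" "w = x n * y" by auto
        have "1/2 * \<alpha> \<le> x n * y" "x n * y \<le> 2 * \<beta>" using y xn ab by (intro mult_mono; simp)+
        moreover have "\<not> P n w" using no y by blast
        ultimately show "w \<in> ?p n" using y by auto
      qed
      have psets: "?p n \<in> sets lebesgue" using PS by (intro sets.Diff) auto
      have "ennreal (1/2) * emeasure lebesgue ?W \<le> ennreal (x n) * emeasure lebesgue ?W"
        using xn by (intro mult_right_mono ennreal_leI) auto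
      also have "\<dots> = emeasure lebesgue ((*) (x n) ` ?W)"
        using emeasure_lebesgue_affine[of "x n" 0 ?W] xn by simp
      also have "\<dots> \<le> emeasure lebesgue (?p n)" by (intro emeasure_mono sub psets)
      also have "\<dots> < ennreal ((\<beta> - \<alpha>) / 4)" by fact
      also have "\<dots> = ennreal (1/2) * ennreal ((\<beta> - \<alpha>) / 2)"
        using ab by (subst ennreal_mult[symmetric]) auto
      finally have "ennreal (1/2) * emeasure lebesgue ?W < ennreal (1/2) * ennreal ((\<beta> - \<alpha>) / 2)" .
      then have W: "emeasure lebesgue ?W < ennreal ((\<beta> - \<alpha>) / 2)"
        by (meson linorder_not_less mult_left_mono zero_le)
      have "ennreal (\<beta> - \<alpha>) = emeasure lebesgue {\<alpha>..\<beta>}" using ab by simp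
      also have "{\<alpha>..\<beta>} = ?W \<union> ?q n" by auto
      also have "emeasure lebesgue \<dots> \<le> emeasure lebesgue ?W + emeasure lebesgue (?q n)"
        using QS by (intro emeasure_subadditive sets.Diff) auto
      also have "\<dots> < ennreal ((\<beta> - \<alpha>) / 2) + ennreal ((\<beta> - \<alpha>) / 2)"
        by (intro add_strict_mono W elim)
      also have "\<dots> = ennreal (\<beta> - \<alpha>)" using ab by (simp add: ennreal_plus[symmetric] del: ennreal_plus)
      finally show False by simp
    qed
  qed
qed

lemma box_cox_mult:
  assumes "x > 0" "y > 0"
  shows "box_cox \<gamma> (x * y) = box_cox \<gamma> x + x powr \<gamma> * box_cox \<gamma> y"
  using assms by (auto simp: box_cox_def ln_mult powr_mult field_simps)

lemma box_cox_eq_zeta: "x > 0 \<Longrightarrow> box_cox \<gamma> x = zeta \<gamma> (ln x)"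
  by (simp add: zeta_def)

lemma box_cox_strict_mono: "0 < x \<Longrightarrow> x < y \<Longrightarrow> box_cox \<gamma> x < box_cox \<gamma> y"
  using strict_monoD[OF zeta_strict_mono, of "ln x" "ln y" \<gamma>] by (simp add: box_cox_eq_zeta)

lemma box_cox_mono: "0 < x \<Longrightarrow> x \<le> y \<Longrightarrow> box_cox \<gamma> x \<le> box_cox \<gamma> y"
  using box_cox_strict_mono[of x y \<gamma>] by (cases "x = y") auto

lemma box_cox_1 [simp]: "box_cox \<gamma> 1 = 0" by (simp add: box_cox_def)

lemma box_cox_measurable [measurable]: "box_cox \<gamma> \<in> borel_measurable borel"
  unfolding box_cox_def[abs_def] by (cases "\<gamma> = 0") simp_all

text \<open>The second-order condition as a statement about an arbitrary monotone \<open>U\<close>: the remainder of order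
  \<open>A(t)\<close> converges pointwise, to a limit of any form.\<close>

locale second_order_tail =
  fixes U a A :: "real \<Rightarrow> real" and \<gamma> \<rho> :: real
  assumes U_mono: "mono_on {1<..} U"
    and a_pos: "\<And>t. t > 1 \<Longrightarrow> a t > 0"
    and A_nz: "\<And>t. t > 1 \<Longrightarrow> A t \<noteq> 0"
    and A_0: "(A \<longlongrightarrow> 0) at_top"
    and rho: "\<rho> \<le> 0"
    and A_meas: "A \<in> borel_measurable (lebesgue_on {1<..})"
    and A_rv: "\<And>x. x > 0 \<Longrightarrow> ((\<lambda>t. A (t * x) / A t) \<longlongrightarrow> x powr \<rho>) at_top"
    and A_limit: "\<And>x. x > 0 \<Longrightarrow>
      \<exists>h. ((\<lambda>t. ((U (t * x) - U t) / a t - box_cox \<gamma> x) / A t) \<longlongrightarrow> h) at_top"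
begin

definition rem :: "real \<Rightarrow> real \<Rightarrow> real" where
  "rem t x = (U (t * x) - U t) / a t - box_cox \<gamma> x"

text \<open>Going from \<open>t\<close> to \<open>txy\<close> in one step or via \<open>tx\<close> gives the same
  increment of \<open>U\<close>. The identity couples the remainder with the error of \<open>a(tx)/a(t)\<close>,
  so both are bounded together.\<close>

lemma rem_cocycle:
  assumes "t > 1" "t * x > 1" "x > 0" "y > 0"
  shows "rem t (x * y) = rem t x + (a (t * x) / a t - x powr \<gamma>) * box_cox \<gamma> y + a (t * x) / a t * rem (t * x) y"
proof -
  have p: "a t > 0" "a (t * x) > 0" using assms a_pos by auto
  have "(U (t * (x * y)) - U t) / a t = a (t * x) / a t * ((U (t * x * y) - U (t * x)) / a (t * x)) + (U (t * x) - U t) / a t"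
    using p by (simp add: field_simps)
  then show ?thesis using assms by (simp add: rem_def box_cox_mult algebra_simps)
qed

lemma U_scaled_measurable:
  assumes "0 < t"
  shows "(\<lambda>y. if t * y > 1 then U (t * y) else 0) \<in> borel_measurable borel"
proof -
  have "U \<in> borel_measurable (restrict_space borel {1<..})"
    by (rule borel_measurable_mono_on_fnc[OF U_mono])
  then have "(\<lambda>s. indicator {1<..} s *\<^sub>R U s) \<in> borel_measurable borel"
    by (subst (asm) borel_measurable_restrict_space_iff) auto
  then have "(\<lambda>y. indicator {1<..} (t * y) *\<^sub>R U (t * y)) \<in> borel_measurable borel"
    by (rule measurable_compose[rotated]) measurable
  moreover have "(\<lambda>y. indicator {1<..} (t * y) *\<^sub>R U (t * y)) = (\<lambda>y. if t * y > 1 then U (t * y) else 0)"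
    by (auto simp: indicator_def)
  ultimately show ?thesis by simp
qed

lemma A_scaled_measurable:
  "(\<lambda>y. if t * y > 1 then A (t * y) else 0) \<in> borel_measurable lebesgue"
proof -
  have "(\<lambda>s. indicator {1<..} s *\<^sub>R A s) \<in> borel_measurable lebesgue"
    using A_meas by (subst (asm) borel_measurable_restrict_space_iff) auto
  then have "(\<lambda>y. indicator {1<..} (t *\<^sub>R y) *\<^sub>R A (t *\<^sub>R y)) \<in> borel_measurable lebesgue"
    by (rule measurable_compose[OF lebesgue_measurable_scaling])
  moreover have "(\<lambda>y. indicator {1<..} (t *\<^sub>R y) *\<^sub>R A (t *\<^sub>R y)) = (\<lambda>y. if t * y > 1 then A (t * y) else 0)"
    by (auto simp: indicator_def)
  ultimately show ?thesis by simp
qed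

lemma sets_A_le:
  assumes "t * lo > 1" "t > 0"
  shows "{y \<in> {lo..hi}. \<bar>A (t * y)\<bar> \<le> c} \<in> sets lebesgue" "{y \<in> {lo..hi}. c \<le> \<bar>A (t * y)\<bar>} \<in> sets lebesgue"
proof -
  define f where "f = (\<lambda>y. if t * y > 1 then A (t * y) else 0)"
  have f: "f \<in> borel_measurable lebesgue" unfolding f_def by (rule A_scaled_measurable)
  have e: "f y = A (t * y)" if "y \<in> {lo..hi}" for y
  proof -
    have "t * lo \<le> t * y" using that assms by (intro mult_left_mono) auto
    then have "t * y > 1" using assms by linarith
    then show ?thesis by (simp add: f_def)
  qed
  have "{y \<in> space lebesgue. \<bar>f y\<bar> \<le> c} \<inter> {lo..hi} \<in> sets lebesgue"
    "{y \<in> space lebesgue. c \<le> \<bar>f y\<bar>} \<inter> {lo..hi} \<in> sets lebesgue"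
    by (intro sets.Int borel_measurable_le borel_measurable_abs f borel_measurable_const; simp)+
  moreover have "{y \<in> space lebesgue. \<bar>f y\<bar> \<le> c} \<inter> {lo..hi} = {y \<in> {lo..hi}. \<bar>A (t * y)\<bar> \<le> c}"
    "{y \<in> space lebesgue. c \<le> \<bar>f y\<bar>} \<inter> {lo..hi} = {y \<in> {lo..hi}. c \<le> \<bar>A (t * y)\<bar>}"
    using e by auto
  ultimately show "{y \<in> {lo..hi}. \<bar>A (t * y)\<bar> \<le> c} \<in> sets lebesgue" "{y \<in> {lo..hi}. c \<le> \<bar>A (t * y)\<bar>} \<in> sets lebesgue"
    by (simp_all only:)
qed

lemma sets_rem_le:
  assumes "t * lo > 1" "t > 0"
  shows "{y \<in> {lo..hi}. \<bar>rem t y\<bar> \<le> c} \<in> sets lebesgue"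
proof -
  define f where "f = (\<lambda>y. ((if t * y > 1 then U (t * y) else 0) - U t) / a t - box_cox \<gamma> y)"
  have f: "f \<in> borel_measurable borel" unfolding f_def
    by (intro borel_measurable_diff borel_measurable_divide U_scaled_measurable assms
        borel_measurable_const box_cox_measurable)
  have e: "f y = rem t y" if "y \<in> {lo..hi}" for y
  proof -
    have "t * lo \<le> t * y" using that assms by (intro mult_left_mono) auto
    then have "t * y > 1" using assms by linarith
    then show ?thesis by (simp add: f_def rem_def)
  qed
  have "{y \<in> space borel. \<bar>f y\<bar> \<le> c} \<inter> {lo..hi} \<in> sets borel"
    by (intro sets.Int borel_measurable_le borel_measurable_abs f borel_measurable_const) simp
  then have "{y \<in> space borel. \<bar>f y\<bar> \<le> c} \<inter> {lo..hi} \<in> sets lebesgue" by simp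
  moreover have "{y \<in> space borel. \<bar>f y\<bar> \<le> c} \<inter> {lo..hi} = {y \<in> {lo..hi}. \<bar>rem t y\<bar> \<le> c}"
    using e by auto
  ultimately show ?thesis by simp
qed

lemma seq_A_ratio:
  fixes t :: "nat \<Rightarrow> real"
  assumes t: "filterlim t at_top sequentially" and x: "x > 0"
  shows "(\<lambda>n. \<bar>A (t n * x)\<bar> / \<bar>A (t n)\<bar>) \<longlonglongrightarrow> x powr \<rho>"
  using tendsto_rabs[OF filterlim_compose[OF A_rv[OF x] t]] x by (simp add: abs_divide)

lemma eventually_seq_gt_1:
  fixes t :: "nat \<Rightarrow> real"
  assumes t: "filterlim t at_top sequentially"
  shows "\<forall>\<^sub>F n in sequentially. t n > 1"
  using t by (simp add: filterlim_at_top_dense)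

text \<open>The factor \<open>\<surd>n\<close> stands for an arbitrary bound that tends to infinity more slowly than
  \<open>n\<close>: the constant valid at a single \<open>x\<close> is unknown, and the argument by
  contradiction compares it with \<open>n\<close>.\<close>

lemma eventually_rem_le:
  fixes t :: "nat \<Rightarrow> real"
  assumes t: "filterlim t at_top sequentially" and x: "x > 0"
  shows "\<forall>\<^sub>F n in sequentially. \<bar>rem (t n) x\<bar> \<le> sqrt (real n) * \<bar>A (t n)\<bar>"
proof -
  obtain h where "((\<lambda>t. rem t x / A t) \<longlongrightarrow> h) at_top" using A_limit[OF x] unfolding rem_def by blast
  then have "(\<lambda>n. \<bar>rem (t n) x / A (t n)\<bar>) \<longlonglongrightarrow> \<bar>h\<bar>"
    by (intro tendsto_rabs) (rule filterlim_compose[OF _ t])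
  then have "\<forall>\<^sub>F n in sequentially. \<bar>rem (t n) x / A (t n)\<bar> < \<bar>h\<bar> + 1"
    by (rule order_tendstoD) simp
  moreover have "\<forall>\<^sub>F n in sequentially. \<bar>h\<bar> + 1 \<le> sqrt (real n)"
    using filterlim_compose[OF sqrt_at_top filterlim_real_sequentially] by (simp add: filterlim_at_top)
  ultimately show ?thesis using eventually_seq_gt_1[OF t]
  proof eventually_elim
    case (elim n)
    then have "\<bar>rem (t n) x\<bar> / \<bar>A (t n)\<bar> \<le> sqrt (real n)" by (simp add: abs_divide)
    then show ?case using A_nz[OF elim(3)] by (simp add: pos_divide_le_eq)
  qed
qed

lemma eventually_rem_small:
  fixes t :: "nat \<Rightarrow> real"
  assumes t: "filterlim t at_top sequentially" and x: "x > 0" and e: "e > 0"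
  shows "\<forall>\<^sub>F n in sequentially. \<bar>rem (t n) x\<bar> \<le> e"
proof -
  obtain h where "((\<lambda>t. rem t x / A t) \<longlongrightarrow> h) at_top" using A_limit[OF x] unfolding rem_def by blast
  from tendsto_mult[OF this A_0] have "((\<lambda>t. rem t x / A t * A t) \<longlongrightarrow> 0) at_top" by simp
  then have "(\<lambda>n. \<bar>rem (t n) x / A (t n) * A (t n)\<bar>) \<longlonglongrightarrow> \<bar>0\<bar>"
    by (intro tendsto_rabs) (rule filterlim_compose[OF _ t])
  then have "\<forall>\<^sub>F n in sequentially. \<bar>rem (t n) x / A (t n) * A (t n)\<bar> < e"
    using e by (intro order_tendstoD) auto
  then show ?thesis using eventually_seq_gt_1[OF t]
    by eventually_elim (use A_nz in auto)
qed

text \<open>If the bound fails, there are \<open>t\<^sub>n \<rightarrow> \<infinity>\<close> and \<open>x\<^sub>n \<in>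
  [1/2, 2]\<close> that violate it with constant \<open>n + 1\<close>. For most \<open>y\<close> the remainders
  at \<open>(t\<^sub>n, x\<^sub>ny)\<close> and \<open>(t\<^sub>nx\<^sub>n, y)\<close> are simultaneously of
  order \<open>\<surd>n \<bar>A(t\<^sub>n)\<bar>\<close>. Two such points \<open>y\<close> with separated values
  of the Box--Cox transform turn the cocycle identity into two linear equations, which determine \<open>rem
  (t\<^sub>n) (x\<^sub>n)\<close> and \<open>a(t\<^sub>nx\<^sub>n)/a(t\<^sub>n) -
  x\<^sub>n\<^sup>\<gamma>\<close> up to the same order, a contradiction.\<close>

lemma local_uniform_bound:
  "\<exists>C>0. \<exists>t0>4. \<forall>t\<ge>t0. \<forall>x\<in>{1/2..2}. \<bar>rem t x\<bar> \<le> C * \<bar>A t\<bar> \<and>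
     \<bar>a (t * x) / a t - x powr \<gamma>\<bar> \<le> C * \<bar>A t\<bar> \<and> \<bar>A (t * x)\<bar> \<le> C * \<bar>A t\<bar>"
proof (rule ccontr)
  assume no: "\<not> ?thesis"
  have "\<exists>t x. t \<ge> real n + 5 \<and> x \<in> {1/2..2} \<and> \<not> (\<bar>rem t x\<bar> \<le> (real n + 1) * \<bar>A t\<bar> \<and>
     \<bar>a (t * x) / a t - x powr \<gamma>\<bar> \<le> (real n + 1) * \<bar>A t\<bar> \<and> \<bar>A (t * x)\<bar> \<le> (real n + 1) * \<bar>A t\<bar>)" for n :: nat
  proof -
    have "real n + 1 > 0" "real n + 5 > 4" by auto
    then show ?thesis using no by blast
  qed
  then obtain t x where t5: "\<And>n::nat. t n \<ge> real n + 5" and x: "\<And>n::nat. x n \<in> {1/2..2}"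
    and viol: "\<And>n. \<not> (\<bar>rem (t n) (x n)\<bar> \<le> (real n + 1) * \<bar>A (t n)\<bar> \<and>
     \<bar>a (t n * x n) / a (t n) - x n powr \<gamma>\<bar> \<le> (real n + 1) * \<bar>A (t n)\<bar> \<and>
     \<bar>A (t n * x n)\<bar> \<le> (real n + 1) * \<bar>A (t n)\<bar>)"
    by metis
  have x2: "1/2 \<le> x n" "x n \<le> 2" "0 < x n" for n using x[of n] by auto
  have tt: "filterlim t at_top sequentially"
    by (rule filterlim_at_top_mono[OF filterlim_real_sequentially]) (use t5 in \<open>auto intro!: always_eventually order_trans[OF _ t5]\<close>)
  have ttx: "filterlim (\<lambda>n. t n * x n) at_top sequentially"
  proof (rule filterlim_at_top_mono)
    show "filterlim (\<lambda>n. 1/2 * t n) at_top sequentially"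
      by (rule filterlim_tendsto_pos_mult_at_top[OF tendsto_const _ tt]) simp
    show "\<forall>\<^sub>F n in sequentially. 1/2 * t n \<le> t n * x n"
    proof (intro always_eventually allI)
      fix n
      have "t n * (1/2) \<le> t n * x n" using t5[of n] x2[of n] by (intro mult_left_mono) auto
      then show "1/2 * t n \<le> t n * x n" by simp
    qed
  qed
  \<comment> \<open>Since \<open>\<rho> \<le> 0\<close>, the ratio \<open>A(ty)/A(t)\<close> is eventually at most \<open>M\<close> for \<open>y \<ge> 1/2\<close> and at least \<open>m\<close> for \<open>y \<le> 8\<close>;
    comparing both at \<open>x n * y\<close> bounds \<open>A(tx)/A(t)\<close> by \<open>R\<close>. The gap \<open>d\<close> separates the points taken from \<open>[1, 2]\<close> and \<open>[4, 8]\<close>.\<close>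
  define M where "M = 1 + (1/2) powr \<rho>"
  define m where "m = 8 powr \<rho> / 2"
  define R where "R = M / m"
  define d where "d = box_cox \<gamma> 4 - box_cox \<gamma> 2"
  define X where "X = 2 powr \<bar>\<gamma>\<bar>"
  have pos: "M > 0" "m > 0" "R > 0" "d > 0" "X > 0"
    using box_cox_strict_mono[of 2 4 \<gamma>] by (auto simp: M_def m_def R_def d_def X_def intro!: add_pos_pos divide_pos_pos)
  define P where "P = (\<lambda>n y. \<bar>A (t n * y)\<bar> \<le> M * \<bar>A (t n)\<bar> \<and> \<bar>rem (t n) y\<bar> \<le> sqrt (real n) * \<bar>A (t n)\<bar>)"
  define Q where "Q = (\<lambda>n y. m * \<bar>A (t n * x n)\<bar> \<le> \<bar>A (t n * x n * y)\<bar> \<and>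
     \<bar>rem (t n * x n) y\<bar> \<le> sqrt (real n) * \<bar>A (t n * x n)\<bar> \<and> \<bar>rem (t n * x n) y\<bar> \<le> d / 4)"
  have key: "\<forall>\<^sub>F n in sequentially. \<exists>y\<in>{\<alpha>..\<beta>}. Q n y \<and> P n (x n * y)"
    if ab: "1 \<le> \<alpha>" "\<alpha> < \<beta>" "\<beta> \<le> 8" for \<alpha> \<beta>
  proof (rule eventually_common_point[OF _ ab(2) x])
    show "0 < \<alpha>" using ab by simp
    fix n
    have t: "t n * (\<alpha> / 2) > 1" "t n > 0"
    proof -
      have "5 * (1/2) \<le> t n * (\<alpha> / 2)" using t5[of n] ab by (intro mult_mono) auto
      then show "t n * (\<alpha> / 2) > 1" by simp
      show "t n > 0" using t5[of n] by simp
    qed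
    have t': "t n * x n * \<alpha> > 1" "t n * x n > 0"
    proof -
      have "t n * x n * \<alpha> = t n * (\<alpha> / 2) * (2 * x n)" by simp
      moreover have "t n * (\<alpha> / 2) * 1 \<le> t n * (\<alpha> / 2) * (2 * x n)"
        using t x2[of n] by (intro mult_left_mono) auto
      ultimately show "t n * x n * \<alpha> > 1" using t by linarith
      show "t n * x n > 0" using t x2[of n] by simp
    qed
    have "{y \<in> {\<alpha>/2..2*\<beta>}. P n y} = {y \<in> {\<alpha>/2..2*\<beta>}. \<bar>A (t n * y)\<bar> \<le> M * \<bar>A (t n)\<bar>} \<inter>
        {y \<in> {\<alpha>/2..2*\<beta>}. \<bar>rem (t n) y\<bar> \<le> sqrt (real n) * \<bar>A (t n)\<bar>}" by (auto simp: P_def)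
    also have "\<dots> \<in> sets lebesgue" by (intro sets.Int sets_A_le sets_rem_le t)
    finally show "{y \<in> {\<alpha>/2..2*\<beta>}. P n y} \<in> sets lebesgue" .
    have "{y \<in> {\<alpha>..\<beta>}. Q n y} = {y \<in> {\<alpha>..\<beta>}. m * \<bar>A (t n * x n)\<bar> \<le> \<bar>A (t n * x n * y)\<bar>} \<inter>
       ({y \<in> {\<alpha>..\<beta>}. \<bar>rem (t n * x n) y\<bar> \<le> sqrt (real n) * \<bar>A (t n * x n)\<bar>} \<inter>
        {y \<in> {\<alpha>..\<beta>}. \<bar>rem (t n * x n) y\<bar> \<le> d / 4})" by (auto simp: Q_def)
    also have "\<dots> \<in> sets lebesgue" by (intro sets.Int sets_A_le sets_rem_le t')
    finally show "{y \<in> {\<alpha>..\<beta>}. Q n y} \<in> sets lebesgue" .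
  next
    fix y assume y: "y \<in> {\<alpha>/2..2*\<beta>}"
    then have y0: "y > 0" "1/2 \<le> y" using ab by auto
    have "y powr \<rho> \<le> (1/2) powr \<rho>" using y0 rho by (intro powr_mono2') auto
    then have "y powr \<rho> < M" by (simp add: M_def)
    then have "\<forall>\<^sub>F n in sequentially. \<bar>A (t n * y)\<bar> / \<bar>A (t n)\<bar> < M"
      using seq_A_ratio[OF tt y0(1)] by (intro order_tendstoD)
    then show "\<forall>\<^sub>F n in sequentially. P n y"
      using eventually_rem_le[OF tt y0(1)] eventually_seq_gt_1[OF tt]
    proof eventually_elim
      case (elim n)
      then show ?case using A_nz[of "t n"] by (auto simp: P_def pos_divide_less_eq)
    qed
  next
    fix y assume y: "y \<in> {\<alpha>..\<beta>}"
    then have y0: "y > 0" "y \<le> 8" using ab by auto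
    have d4: "d / 4 > 0" using pos by simp
    have "8 powr \<rho> \<le> y powr \<rho>" using y0 rho by (intro powr_mono2') auto
    moreover have "m < 8 powr \<rho>" by (simp add: m_def)
    ultimately have "m < y powr \<rho>" by linarith
    then have "\<forall>\<^sub>F n in sequentially. m < \<bar>A (t n * x n * y)\<bar> / \<bar>A (t n * x n)\<bar>"
      using seq_A_ratio[OF ttx y0(1)] by (intro order_tendstoD)
    then show "\<forall>\<^sub>F n in sequentially. Q n y"
      using eventually_rem_le[OF ttx y0(1)] eventually_rem_small[OF ttx y0(1) d4]
        eventually_seq_gt_1[OF ttx]
    proof eventually_elim
      case (elim n)
      then show ?case using A_nz[of "t n * x n"] by (auto simp: Q_def pos_less_divide_eq)
    qed
  qed
  define C1 where "C1 = 4 * (1 + X * R) / d"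
  define C2 where "C2 = 1 + C1 * (\<bar>box_cox \<gamma> 2\<bar> + d) + X * R"
  have C: "C1 > 0" "C2 > 0" using pos by (auto simp: C1_def C2_def intro!: add_pos_pos add_pos_nonneg mult_nonneg_nonneg divide_pos_pos)
  define C3 where "C3 = C1 + C2 + R + 1"
  have "\<forall>\<^sub>F n in sequentially. \<exists>y\<in>{1..2}. Q n y \<and> P n (x n * y)" by (rule key) auto
  moreover have "\<forall>\<^sub>F n in sequentially. \<exists>y\<in>{4..8}. Q n y \<and> P n (x n * y)" by (rule key) auto
  moreover have "\<forall>\<^sub>F n in sequentially. C3 \<le> sqrt (real n)"
    using filterlim_compose[OF sqrt_at_top filterlim_real_sequentially] by (simp add: filterlim_at_top)
  ultimately have "\<forall>\<^sub>F n::nat in sequentially. False"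
  proof eventually_elim
    case (elim n)
    then obtain y z where y: "y \<in> {1..2}" "Q n y" "P n (x n * y)" and z: "z \<in> {4..8}" "Q n z" "P n (x n * z)"
      by blast
    define T where "T = t n"
    define u where "u = x n"
    define q where "q = sqrt (real n)"
    have q: "q \<ge> C3" "q * q = real n" "q \<ge> 1" 
    proof -
      show "q \<ge> C3" using elim(3) by (simp add: q_def)
      then show "q \<ge> 1" using C pos by (simp add: C3_def)
      show "q * q = real n" by (simp add: q_def)
    qed
    have T: "T > 1" "T * u > 1" using t5[of n] x2[of n] mult_mono[of 5 "t n" "1/2" "x n"] by (auto simp: T_def u_def)
    have u: "1/2 \<le> u" "u \<le> 2" "u > 0" using x2[of n] by (auto simp: u_def)
    have RR: "\<bar>A (T * u)\<bar> \<le> R * \<bar>A T\<bar>"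
    proof -
      have "m * \<bar>A (T * u)\<bar> \<le> \<bar>A (T * u * y)\<bar>" using y by (auto simp: Q_def T_def u_def)
      also have "\<dots> \<le> M * \<bar>A T\<bar>" using y by (auto simp: P_def T_def u_def mult.assoc)
      finally show ?thesis using pos by (simp add: R_def field_simps)
    qed
    define c where "c = a (T * u) / a T - u powr \<gamma>"
    have uX: "0 < u powr \<gamma>" "u powr \<gamma> \<le> X"
    proof -
      show "0 < u powr \<gamma>" using u by simp
      have "\<bar>ln u\<bar> \<le> ln 2"
      proof -
        have "ln u \<le> ln 2" using u by simp
        moreover have "ln (1/2) \<le> ln u" using u by (subst ln_le_cancel_iff) auto
        ultimately show ?thesis by (simp add: ln_div)
      qed
      then have "\<gamma> * ln u \<le> \<bar>\<gamma>\<bar> * ln 2"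
        by (metis abs_ge_self abs_ge_zero abs_mult mult_left_mono order_trans)
      then show "u powr \<gamma> \<le> X" using u by (simp add: X_def powr_def)
    qed
    have id: "rem T (u * w) = rem T u + c * (box_cox \<gamma> w + rem (T * u) w) + u powr \<gamma> * rem (T * u) w" if "w > 0" for w
      using rem_cocycle[OF T u(3) that] by (simp add: c_def algebra_simps)
    have P': "\<bar>rem T (u * w)\<bar> \<le> q * \<bar>A T\<bar>" if "P n (x n * w)" for w
      using that by (auto simp: P_def T_def u_def q_def)
    have Q': "\<bar>rem (T * u) w\<bar> \<le> q * R * \<bar>A T\<bar>" "\<bar>rem (T * u) w\<bar> \<le> d / 4" if "Q n w" for w
    proof -
      have "\<bar>rem (T * u) w\<bar> \<le> q * \<bar>A (T * u)\<bar>" using that by (auto simp: Q_def T_def u_def q_def)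
      also have "\<dots> \<le> q * (R * \<bar>A T\<bar>)" using RR q by (intro mult_left_mono) auto
      finally show "\<bar>rem (T * u) w\<bar> \<le> q * R * \<bar>A T\<bar>" by simp
      show "\<bar>rem (T * u) w\<bar> \<le> d / 4" using that by (auto simp: Q_def T_def u_def)
    qed
    have uQ: "\<bar>u powr \<gamma> * rem (T * u) w\<bar> \<le> X * (q * R * \<bar>A T\<bar>)" if "Q n w" for w
      unfolding abs_mult using uX Q'[OF that] pos by (intro mult_mono) auto
    \<comment> \<open>Subtracting the cocycle identities at \<open>z\<close> and \<open>y\<close> eliminates \<open>rem T u\<close> and leaves an equation for \<open>c\<close>.\<close>
    define D where "D = box_cox \<gamma> z - box_cox \<gamma> y + rem (T * u) z - rem (T * u) y"
    have Dd: "D \<ge> d / 2"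
      using box_cox_mono[of 4 z \<gamma>] box_cox_mono[of y 2 \<gamma>] y(1) z(1) Q'(2)[OF y(2)] Q'(2)[OF z(2)]
      unfolding D_def d_def by auto
    have "c * D = rem T (u * z) - rem T (u * y) - (u powr \<gamma> * rem (T * u) z - u powr \<gamma> * rem (T * u) y)"
      using id[of z] id[of y] y(1) z(1) by (simp add: D_def algebra_simps)
    then have "\<bar>c * D\<bar> \<le> 2 * (q * \<bar>A T\<bar>) + 2 * (X * (q * R * \<bar>A T\<bar>))"
      using P'[OF y(3)] P'[OF z(3)] uQ[OF y(2)] uQ[OF z(2)] by linarith
    also have "\<dots> = (d / 2) * (C1 * q * \<bar>A T\<bar>)" using pos by (simp add: C1_def field_simps)
    finally have "\<bar>c\<bar> * \<bar>D\<bar> \<le> (d / 2) * (C1 * q * \<bar>A T\<bar>)" by (simp add: abs_mult)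
    moreover have "\<bar>c\<bar> * (d / 2) \<le> \<bar>c\<bar> * \<bar>D\<bar>" using Dd by (intro mult_left_mono) auto
    ultimately have "(d / 2) * \<bar>c\<bar> \<le> (d / 2) * (C1 * q * \<bar>A T\<bar>)" by (simp add: mult.commute)
    then have c: "\<bar>c\<bar> \<le> C1 * q * \<bar>A T\<bar>" using pos by simp
    have by': "\<bar>box_cox \<gamma> y + rem (T * u) y\<bar> \<le> \<bar>box_cox \<gamma> 2\<bar> + d"
      using box_cox_mono[of 1 y \<gamma>] box_cox_mono[of y 2 \<gamma>] y(1) Q'(2)[OF y(2)] pos by auto
    have cb: "\<bar>c * (box_cox \<gamma> y + rem (T * u) y)\<bar> \<le> (C1 * q * \<bar>A T\<bar>) * (\<bar>box_cox \<gamma> 2\<bar> + d)"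
      unfolding abs_mult using c by' by (intro mult_mono) auto
    have "\<bar>rem T u\<bar> \<le> q * \<bar>A T\<bar> + (C1 * q * \<bar>A T\<bar>) * (\<bar>box_cox \<gamma> 2\<bar> + d) + X * (q * R * \<bar>A T\<bar>)"
    proof -
      have "rem T (u * y) = rem T u + c * (box_cox \<gamma> y + rem (T * u) y) + u powr \<gamma> * rem (T * u) y"
        using id[of y] y(1) by simp
      with cb P'[OF y(3)] uQ[OF y(2)] show ?thesis
        by linarith
    qed
    also have "\<dots> = C2 * q * \<bar>A T\<bar>" by (simp add: C2_def algebra_simps)
    finally have r: "\<bar>rem T u\<bar> \<le> C2 * q * \<bar>A T\<bar>" .
    have fin: "v \<le> (real n + 1) * \<bar>A T\<bar>" if "v \<le> K * q * \<bar>A T\<bar>" "K \<le> C3" for v K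
    proof -
      have "K * q \<le> q * q" using that q by (intro mult_right_mono) auto
      then have "K * q * \<bar>A T\<bar> \<le> (real n + 1) * \<bar>A T\<bar>" using q by (intro mult_right_mono) auto
      then show ?thesis using that by linarith
    qed
    have "\<bar>A (T * u)\<bar> \<le> R * q * \<bar>A T\<bar>"
    proof -
      have "R * \<bar>A T\<bar> * 1 \<le> R * \<bar>A T\<bar> * q" using q pos by (intro mult_left_mono) auto
      then show ?thesis using RR by (simp add: mult_ac)
    qed
    then show False
      using viol[of n] fin[OF r] fin[OF c] fin[of _ R] C pos
      unfolding T_def[symmetric] u_def[symmetric] c_def[symmetric] C3_def by auto
  qed
  then show False by simp
qed

text \<open>By the local bound each doubling multiplies \<open>a\<close> by at most \<open>2\<^sup>\<gamma>w\<close> and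
  \<open>\<bar>A\<bar>\<close> by at most \<open>w\<close>, where \<open>w = 2\<^sup>e\<close> with \<open>e >
  0\<close> small. The cocycle identity, iterated over doublings, sums these errors geometrically.\<close>

lemma uniform_bound:
  assumes \<epsilon>: "\<epsilon> > 0"
  shows "\<exists>C>0. \<exists>t0>4. \<forall>t\<ge>t0. \<forall>x\<ge>1/2. \<bar>rem t x\<bar> \<le> C * \<bar>A t\<bar> * x powr (max \<gamma> 0 + \<epsilon>)"
proof -
  obtain C t0 where C: "C > 0" and t0: "t0 > 4"
    and loc: "\<And>t x. t \<ge> t0 \<Longrightarrow> x \<in> {1/2..2} \<Longrightarrow> \<bar>rem t x\<bar> \<le> C * \<bar>A t\<bar>"
      "\<And>t x. t \<ge> t0 \<Longrightarrow> x \<in> {1/2..2} \<Longrightarrow> \<bar>a (t * x) / a t - x powr \<gamma>\<bar> \<le> C * \<bar>A t\<bar>"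
    using local_uniform_bound by blast
  define e where "e = \<epsilon> / 4"
  define w where "w = 2 powr e"
  define p where "p = 2 powr \<gamma>"
  have e: "e > 0" using \<epsilon> by (simp add: e_def)
  have w: "w > 1" using e by (simp add: w_def)
  have p: "p > 0" by (simp add: p_def)
  have "2 powr \<rho> \<le> 2 powr 0" using rho by (intro powr_mono) auto
  then have "2 powr \<rho> < w" using w by simp
  have "((\<lambda>t. \<bar>A (t * 2) / A t\<bar>) \<longlongrightarrow> \<bar>2 powr \<rho>\<bar>) at_top"
    by (intro tendsto_rabs A_rv) simp
  then have "\<forall>\<^sub>F t in at_top. \<bar>A (t * 2) / A t\<bar> < w"
    by (rule order_tendstoD) (use \<open>2 powr \<rho> < w\<close> in simp)
  moreover have "\<forall>\<^sub>F t in at_top. \<bar>A t\<bar> < p * (w - 1) / C"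
    using tendsto_rabs[OF A_0] p w C by (intro order_tendstoD) auto
  ultimately have "\<forall>\<^sub>F t in at_top. \<bar>A (t * 2) / A t\<bar> < w \<and> \<bar>A t\<bar> < p * (w - 1) / C \<and> t \<ge> t0"
    using eventually_ge_at_top[of t0] by eventually_elim auto
  then obtain t1 where t1: "\<And>t. t \<ge> t1 \<Longrightarrow> \<bar>A (t * 2) / A t\<bar> < w \<and> \<bar>A t\<bar> < p * (w - 1) / C \<and> t \<ge> t0"
    by (auto simp: eventually_at_top_linorder)
  have tt0: "t \<ge> t0" "t > 1" if "t \<ge> t1" for t using t1[OF that] t0 by auto
  have A2: "\<bar>A (t * 2)\<bar> \<le> w * \<bar>A t\<bar>" if "t \<ge> t1" for t
    using t1[OF that] A_nz[OF tt0(2)[OF that]] by (simp add: abs_divide divide_less_eq less_imp_le)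
  have a2: "a (t * 2) / a t \<le> p * w" if "t \<ge> t1" for t
  proof -
    have "a (t * 2) / a t \<le> p + C * \<bar>A t\<bar>" using loc(2)[OF tt0(1)[OF that], of 2] by (simp add: p_def abs_le_iff)
    also have "C * \<bar>A t\<bar> \<le> p * (w - 1)" using t1[OF that] C by (simp add: pos_less_divide_eq mult.commute less_imp_le)
    finally show ?thesis by (simp add: algebra_simps)
  qed
  \<comment> \<open>\<open>K\<close> solves \<open>p K + C = K p w\<^sup>3\<close> and \<open>L\<close> below solves \<open>L + K D + C = L w\<^sup>4\<close>, the recursions for the errors over doublings.\<close>
  define K where "K = C / (p * (w ^ 3 - 1))"
  have w3: "w ^ 3 > 1" "w ^ 4 > 1" using w by simp_all
  have K: "K > 0" using C p w3 by (simp add: K_def)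
  define m where "m = max p 1 * w ^ 4"
  define D where "D = \<bar>box_cox \<gamma> 2\<bar> + \<bar>box_cox \<gamma> (1/2)\<bar>"
  have D: "D \<ge> 0" by (simp add: D_def)
  define L where "L = (K * D + C) / (w ^ 4 - 1)"
  have L: "L > 0" using K D C w3 by (auto simp: L_def intro!: divide_pos_pos add_nonneg_pos)
  have pm: "p * w ^ 3 \<le> m" "p * w ^ 2 \<le> m" "0 < p * w ^ 3"
  proof -
    have "p * w ^ j \<le> m" if "j \<le> 4" for j
    proof -
      have "p * w ^ j \<le> max p 1 * w ^ 4" using w p that by (intro mult_mono power_increasing) auto
      then show ?thesis by (simp add: m_def)
    qed
    then show "p * w ^ 3 \<le> m" "p * w ^ 2 \<le> m" by auto
    show "0 < p * w ^ 3" using p w by simp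
  qed
  have m1: "m \<ge> w ^ 4"
    using mult_right_mono[of 1 "max p 1" "w ^ 4"] w by (simp add: m_def)
  then have m0: "m > 1" using w3 by linarith
  define B where "B = 2 powr (max \<gamma> 0 + \<epsilon>)"
  have main: "\<bar>rem t x\<bar> \<le> (L + K * D + C) * B * \<bar>A t\<bar> * x powr (max \<gamma> 0 + \<epsilon>)" if t: "t \<ge> t1" and x: "x \<ge> 1/2" for t x
  proof -
    define T where "T = (\<lambda>j::nat. t * 2 ^ j)"
    have TS: "T (Suc j) = T j * 2" for j by (simp add: T_def)
    have Tge: "T j \<ge> t1" for j
    proof -
      have "t * 1 \<le> t * 2 ^ j" using tt0[OF t] by (intro mult_left_mono) auto
      then show ?thesis using t by (simp add: T_def)
    qed
    have T1: "T j > 1" for j using tt0(2)[OF Tge] .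
    have ap0: "a t > 0" using a_pos tt0[OF t] by auto
    have ap1: "a (T j) > 0" for j using a_pos T1 by auto
    have Aj: "\<bar>A (T j)\<bar> \<le> w ^ j * \<bar>A t\<bar>" for j
    proof (induction j)
      case (Suc j)
      have "\<bar>A (T (Suc j))\<bar> \<le> w * \<bar>A (T j)\<bar>" unfolding TS by (rule A2[OF Tge])
      also have "\<dots> \<le> w * (w ^ j * \<bar>A t\<bar>)" using Suc w by (intro mult_left_mono) auto
      finally show ?case by simp
    qed (simp add: T_def)
    have aj: "a (T j) / a t \<le> (p * w) ^ j" for j
    proof (induction j)
      case (Suc j)
      have "a (T (Suc j)) / a t = a (T j * 2) / a (T j) * (a (T j) / a t)" using ap0 ap1[of j] by (simp add: TS)
      also have "\<dots> \<le> (p * w) * (p * w) ^ j"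
        using Suc a2[OF Tge[of j]] ap0 ap1 p w by (intro mult_mono) (auto intro: less_imp_le)
      finally show ?case by simp
    qed (use ap0 ap1 in \<open>simp add: T_def\<close>)
    have remj: "\<bar>a (T j) / a t * rem (T j) y\<bar> \<le> C * \<bar>A t\<bar> * (p * w ^ 2) ^ j" if "y \<in> {1/2..2}" for j y
    proof -
      have "\<bar>a (T j) / a t * rem (T j) y\<bar> = a (T j) / a t * \<bar>rem (T j) y\<bar>"
        using ap0 ap1[of j] by (simp add: abs_mult)
      also have "\<dots> \<le> (p * w) ^ j * (C * (w ^ j * \<bar>A t\<bar>))"
      proof (intro mult_mono aj)
        show "\<bar>rem (T j) y\<bar> \<le> C * (w ^ j * \<bar>A t\<bar>)"
          by (rule order_trans[OF loc(1)[OF tt0(1)[OF Tge] that] mult_left_mono[OF Aj]]) (use C in simp)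
      qed (use p w in auto)
      also have "\<dots> = C * \<bar>A t\<bar> * (p * w ^ 2) ^ j" by (simp add: power_mult_distrib power2_eq_square power_add[symmetric] mult_ac)
      finally show ?thesis .
    qed
    have cj: "\<bar>a (T j) / a t - p ^ j\<bar> \<le> K * \<bar>A t\<bar> * (p * w ^ 3) ^ j" for j
    proof (induction j)
      case (Suc j)
      have "a (T (Suc j)) / a t - p ^ Suc j = p * (a (T j) / a t - p ^ j) + (a (T j * 2) / a (T j) - p) * (a (T j) / a t)"
        using ap0 ap1[of j] by (simp add: TS field_simps)
      also have "\<bar>\<dots>\<bar> \<le> p * \<bar>a (T j) / a t - p ^ j\<bar> + \<bar>a (T j * 2) / a (T j) - p\<bar> * (a (T j) / a t)"
        using abs_triangle_ineq[of "p * (a (T j) / a t - p ^ j)" "(a (T j * 2) / a (T j) - p) * (a (T j) / a t)"] p ap0 ap1[of j]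
        by (simp add: abs_mult)
      also have "\<dots> \<le> p * (K * \<bar>A t\<bar> * (p * w ^ 3) ^ j) + C * (w ^ j * \<bar>A t\<bar>) * (p * w) ^ j"
      proof (intro add_mono mult_mono aj Suc)
        show "\<bar>a (T j * 2) / a (T j) - p\<bar> \<le> C * (w ^ j * \<bar>A t\<bar>)"
          unfolding p_def by (rule order_trans[OF loc(2)[OF tt0(1)[OF Tge]] mult_left_mono[OF Aj]]) (use C in simp_all)
      qed (use p w K C ap0 ap1 in \<open>auto intro: less_imp_le\<close>)
      also have "C * (w ^ j * \<bar>A t\<bar>) * (p * w) ^ j = C * \<bar>A t\<bar> * (p * w ^ 2) ^ j"
        by (simp add: power_mult_distrib power2_eq_square power_add[symmetric] mult_ac)
      also have "\<dots> \<le> C * \<bar>A t\<bar> * (p * w ^ 3) ^ j"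
        using C p w by (intro mult_left_mono power_mono power_increasing) auto
      also have "p * (K * \<bar>A t\<bar> * (p * w ^ 3) ^ j) + \<dots> = (p * K + C) * \<bar>A t\<bar> * (p * w ^ 3) ^ j"
        by (simp add: algebra_simps)
      also have "p * K + C = K * (p * w ^ 3)"
      proof -
        have "K * (p * (w ^ 3 - 1)) = C" using p w3 by (simp add: K_def)
        then show ?thesis by (simp add: algebra_simps)
      qed
      also have "K * (p * w ^ 3) * \<bar>A t\<bar> * (p * w ^ 3) ^ j = K * \<bar>A t\<bar> * (p * w ^ 3) ^ Suc j" by simp
      finally show ?case by simp
    qed (use ap0 ap1 K in \<open>simp add: T_def\<close>)
    have pj: "(2 ^ j) powr \<gamma> = p ^ j" for j
      by (simp add: p_def powr_realpow[symmetric] powr_powr mult.commute)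
    have step: "\<bar>rem t (2 ^ j * y) - rem t (2 ^ j)\<bar> \<le> (K * D + C) * \<bar>A t\<bar> * m ^ j" if y: "y \<in> {1/2..2}" for j y
    proof -
      have "rem t (2 ^ j * y) - rem t (2 ^ j) = (a (T j) / a t - p ^ j) * box_cox \<gamma> y + a (T j) / a t * rem (T j) y"
        using rem_cocycle[of t "2 ^ j" y] tt0[OF t] T1[of j] y by (simp add: T_def pj)
      also have "\<bar>\<dots>\<bar> \<le> \<bar>a (T j) / a t - p ^ j\<bar> * \<bar>box_cox \<gamma> y\<bar> + \<bar>a (T j) / a t * rem (T j) y\<bar>"
        unfolding abs_mult[of "a (T j) / a t - p ^ j", symmetric] by (rule abs_triangle_ineq)
      also have "\<dots> \<le> K * \<bar>A t\<bar> * (p * w ^ 3) ^ j * D + C * \<bar>A t\<bar> * (p * w ^ 2) ^ j"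
      proof (intro add_mono mult_mono cj remj y)
        show "\<bar>box_cox \<gamma> y\<bar> \<le> D"
          using box_cox_mono[of "1/2" y \<gamma>] box_cox_mono[of y 2 \<gamma>] y by (auto simp: D_def)
      qed (use K p w in auto)
      also have "\<dots> \<le> K * \<bar>A t\<bar> * m ^ j * D + C * \<bar>A t\<bar> * m ^ j"
        using pm p w K C D by (intro add_mono mult_right_mono mult_left_mono power_mono) auto
      finally show ?thesis by (simp add: algebra_simps)
    qed
    have bj: "\<bar>rem t (2 ^ j)\<bar> \<le> L * \<bar>A t\<bar> * m ^ j" for j
    proof (induction j)
      case 0
      have "rem t 1 = 0" by (simp add: rem_def)
      then show ?case using L by simp
    next
      case (Suc j)
      have "\<bar>rem t (2 ^ Suc j)\<bar> \<le> \<bar>rem t (2 ^ j)\<bar> + (K * D + C) * \<bar>A t\<bar> * m ^ j"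
        using step[of 2 j] by (simp add: mult.commute)
      also have "\<dots> \<le> L * \<bar>A t\<bar> * m ^ j + (K * D + C) * \<bar>A t\<bar> * m ^ j" using Suc by simp
      also have "\<dots> = (L + (K * D + C)) * (\<bar>A t\<bar> * m ^ j)" by (simp add: algebra_simps)
      also have "\<dots> \<le> L * m * (\<bar>A t\<bar> * m ^ j)"
      proof (rule mult_right_mono)
        have "K * D + C = L * (w ^ 4 - 1)" using w3 by (simp add: L_def)
        then have "L + (K * D + C) = L * w ^ 4" by (simp add: algebra_simps)
        also have "\<dots> \<le> L * m" using m1 L by (intro mult_left_mono) auto
        finally show "L + (K * D + C) \<le> L * m" .
      qed (use m0 in simp)
      finally show ?case by (simp add: mult_ac)
    qed
    obtain j :: nat and y where jy: "x = 2 ^ j * y" "y \<in> {1/2..2}" "2 ^ j \<le> 2 * x"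
    proof (cases "x \<ge> 1")
      case True
      define j where "j = nat \<lfloor>log 2 x\<rfloor>"
      have l: "log 2 x \<ge> 0" using True by simp
      have "real j \<le> log 2 x" "log 2 x < real j + 1" using l unfolding j_def by linarith+
      then have "2 powr real j \<le> x" "x < 2 powr (real j + 1)"
        using True by (simp_all add: le_log_iff log_less_iff)
      then have "2 ^ j \<le> x" "x < 2 * 2 ^ j" by (simp_all add: powr_realpow powr_add)
      then show ?thesis using that[of j "x / 2 ^ j"] True by (simp add: field_simps)
    next
      case False
      then show ?thesis using that[of 0 x] x by simp
    qed
    have mj: "m ^ j \<le> B * x powr (max \<gamma> 0 + \<epsilon>)"
    proof -
      have "m = 2 powr (max \<gamma> 0 + \<epsilon>)"
      proof -
        have "max p 1 = 2 powr (max \<gamma> 0)" 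
        proof (cases "\<gamma> \<le> 0")
          case True
          then have "p \<le> 1" using powr_mono[of \<gamma> 0 "2::real"] by (simp add: p_def)
          then show ?thesis using True by simp
        next
          case False
          then have "1 \<le> p" using powr_mono[of 0 \<gamma> "2::real"] by (simp add: p_def)
          then show ?thesis using False by (simp add: p_def)
        qed
        moreover have "w ^ 4 = 2 powr \<epsilon>" by (simp add: w_def e_def powr_realpow[symmetric] powr_powr)
        ultimately show ?thesis by (simp add: m_def powr_add)
      qed
      then have "m ^ j = (2 ^ j) powr (max \<gamma> 0 + \<epsilon>)"
        by (simp add: powr_realpow[symmetric] powr_powr mult.commute)
      also have "\<dots> \<le> (2 * x) powr (max \<gamma> 0 + \<epsilon>)" using jy(3) \<epsilon> by (intro powr_mono2) auto
      also have "\<dots> = B * x powr (max \<gamma> 0 + \<epsilon>)" using x by (simp add: powr_mult B_def)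
      finally show ?thesis .
    qed
    have "\<bar>rem t x\<bar> \<le> L * \<bar>A t\<bar> * m ^ j + (K * D + C) * \<bar>A t\<bar> * m ^ j"
      using bj[of j] step[OF jy(2), of j] unfolding jy(1) by linarith
    also have "\<dots> = (L + K * D + C) * \<bar>A t\<bar> * m ^ j" by (simp add: algebra_simps)
    also have "\<dots> \<le> (L + K * D + C) * \<bar>A t\<bar> * (B * x powr (max \<gamma> 0 + \<epsilon>))"
      using mj L K D C by (intro mult_left_mono mult_nonneg_nonneg) auto
    finally show ?thesis by (simp add: mult_ac)
  qed
  show ?thesis
  proof (intro exI conjI allI impI)
    show "(L + K * D + C) * B > 0" using L K D C by (auto simp: B_def intro!: add_pos_pos add_pos_nonneg mult_pos_pos)
    show "max t1 t0 > 4" using t0 by simp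
  qed (use main in auto)
qed

end

section \<open>Order statistics\<close>

lemma sorted_sample:
  fixes y :: "nat \<Rightarrow> real"
  shows "length (sort (map y [1..<Suc n])) = n" "mset (sort (map y [1..<Suc n])) = image_mset y (mset_set {1..n})"
proof -
  show "length (sort (map y [1..<Suc n])) = n" by simp
  have "mset [1..<Suc n] = mset_set {1..n}" by (metis atLeastLessThanSuc_atLeastAtMost mset_upt)
  then show "mset (sort (map y [1..<Suc n])) = image_mset y (mset_set {1..n})" by simp
qed

lemma sum_order_stat:
  fixes f :: "real \<Rightarrow> 'b::comm_monoid_add"
  shows "(\<Sum>j=1..n. f (order_stat y j n)) = (\<Sum>i=1..n. f (y i))"
proof -
  let ?s = "sort (map y [1..<Suc n])"
  have "(\<Sum>j=1..n. f (order_stat y j n)) = (\<Sum>j<n. f (?s ! j))"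
    unfolding order_stat_def
    by (rule sum.reindex_bij_witness[of _ Suc "\<lambda>j. j - 1"]) auto
  also have "\<dots> = sum_mset (image_mset f (mset ?s))"
  proof -
    have "sum_mset (image_mset f (mset ?s)) = sum_list (map f ?s)" by (metis mset_map sum_mset_sum_list)
    also have "\<dots> = (\<Sum>j<n. f (?s ! j))"
      unfolding sum_list_sum_nth length_map sorted_sample(1) atLeast0LessThan
      by (rule sum.cong[OF refl], rule nth_map) (simp only: lessThan_iff sorted_sample(1))
    finally show ?thesis by simp
  qed
  also have "\<dots> = (\<Sum>i=1..n. f (y i))"
    unfolding sorted_sample(2) by (simp add: sum_unfold_sum_mset image_mset.compositionality comp_def)
  finally show ?thesis .
qed

lemma order_stat_mono:
  assumes "1 \<le> i" "i \<le> j" "j \<le> n"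
  shows "order_stat y i n \<le> order_stat y j n"
  unfolding order_stat_def by (rule sorted_nth_mono) (use assms in auto)

lemma order_stat_in:
  assumes "1 \<le> j" "j \<le> n"
  shows "\<exists>i\<in>{1..n}. order_stat y j n = y i"
proof -
  have "order_stat y j n \<in> set (sort (map y [1..<Suc n]))"
    unfolding order_stat_def by (rule nth_mem) (use assms in auto)
  then show ?thesis by (auto simp: set_upt simp del: upt_Suc)
qed

text \<open>Sorting commutes with a monotone map. This is what transfers order statistics through the tail quantile
  function, which need be neither continuous nor strictly monotone.\<close>

lemma order_stat_image:
  assumes U: "mono_on S U" and v: "\<And>i. i \<in> {1..n} \<Longrightarrow> v i \<in> S" and j: "1 \<le> j" "j \<le> n"
  shows "order_stat (\<lambda>i. U (v i)) j n = U (order_stat v j n)"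
proof -
  let ?s = "sort (map v [1..<Suc n])"
  have sub: "set ?s \<subseteq> S" using v by (auto simp del: upt_Suc)
  have "sorted (map U ?s)"
    unfolding sorted_map
  proof (rule sorted_wrt_mono_rel[of ?s "(\<le>)"])
    fix x y assume "x \<in> set ?s" "y \<in> set ?s" "x \<le> y"
    then have "x \<in> S" "y \<in> S" using sub by (meson subsetD)+
    then show "U x \<le> U y" using U \<open>x \<le> y\<close> by (auto simp: mono_on_def)
  qed simp
  moreover have "mset (map U ?s) = mset (map (\<lambda>i. U (v i)) [1..<Suc n])"
    by (simp add: comp_def image_mset.compositionality del: upt_Suc)
  ultimately have "map U ?s = sort (map (\<lambda>i. U (v i)) [1..<Suc n])"
    by (metis properties_for_sort)
  then show ?thesis unfolding order_stat_def using j
    by (metis One_nat_def Suc_pred' diff_less_mono2 length_map less_eq_Suc_le less_le_trans nth_map not_less_eq sorted_sample(1) less_Suc_eq_le linorder_not_le)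
qed

lemma card_order_stat:
  "card {j\<in>{1..n}. P (order_stat y j n)} = card {i\<in>{1..n}. P (y i)}"
proof -
  have "(\<Sum>j=1..n. if P (order_stat y j n) then 1 else 0 :: nat) = (\<Sum>i=1..n. if P (y i) then 1 else 0)"
    by (rule sum_order_stat[where f = "\<lambda>x. if P x then 1 else 0"])
  then show ?thesis by (simp add: sum.If_cases Int_def)
qed

lemma order_stat_le_iff:
  assumes "1 \<le> j" "j \<le> n"
  shows "order_stat y j n \<le> x \<longleftrightarrow> j \<le> card {i\<in>{1..n}. y i \<le> x}"
proof
  assume a: "order_stat y j n \<le> x"
  have "{1..j} \<subseteq> {i\<in>{1..n}. order_stat y i n \<le> x}"
  proof
    fix i assume i: "i \<in> {1..j}"
    then have "order_stat y i n \<le> order_stat y j n" using assms by (intro order_stat_mono) auto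
    then show "i \<in> {i\<in>{1..n}. order_stat y i n \<le> x}" using a i assms by simp
  qed
  then have "card {1..j} \<le> card {i\<in>{1..n}. order_stat y i n \<le> x}" by (intro card_mono) auto
  then show "j \<le> card {i\<in>{1..n}. y i \<le> x}" unfolding card_order_stat[of n "\<lambda>u. u \<le> x"] by simp
next
  assume a: "j \<le> card {i\<in>{1..n}. y i \<le> x}"
  show "order_stat y j n \<le> x"
  proof (rule ccontr)
    assume n: "\<not> ?thesis"
    have "{i\<in>{1..n}. order_stat y i n \<le> x} \<subseteq> {1..<j}"
      using n assms order_stat_mono[of j _ n y] by (force simp: not_le)
    then have "card {i\<in>{1..n}. order_stat y i n \<le> x} \<le> card {1..<j}" by (intro card_mono) auto
    then show False using a assms unfolding card_order_stat[of n "\<lambda>u. u \<le> x"] by simp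
  qed
qed

lemma order_stat_gt_iff:
  assumes "k < n"
  shows "x < order_stat y (n - k) n \<longleftrightarrow> k < card {i\<in>{1..n}. x < y i}"
proof -
  have "card {i\<in>{1..n}. y i \<le> x} + card {i\<in>{1..n}. x < y i} = card {1..n}"
  proof -
    have "{1..n} = {i\<in>{1..n}. y i \<le> x} \<union> {i\<in>{1..n}. x < y i}" by auto
    then show ?thesis by (metis (no_types, lifting) card_Un_disjoint disjoint_iff finite_Un finite_atLeastAtMost linorder_not_less mem_Collect_eq)
  qed
  then show ?thesis using order_stat_le_iff[of "n - k" n y x] assms by fastforce
qed

lemma sum_top_order_stat:
  fixes f :: "real \<Rightarrow> real"
  assumes "k \<le> n"
  shows "(\<Sum>i=1..k. f (order_stat y (n - i + 1) n)) = (\<Sum>i=1..n. f (y i)) - (\<Sum>j=1..n-k. f (order_stat y j n))"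
proof -
  have "(\<Sum>i=1..k. f (order_stat y (n - i + 1) n)) = (\<Sum>j=n-k+1..n. f (order_stat y j n))"
    by (rule sum.reindex_bij_witness[of _ "\<lambda>j. n - j + 1" "\<lambda>i. n - i + 1"]) (use assms in auto)
  moreover have "(\<Sum>j=1..n. f (order_stat y j n)) = (\<Sum>j=1..n-k. f (order_stat y j n)) + (\<Sum>j=n-k+1..n. f (order_stat y j n))"
  proof -
    have "{1..n} = {1..n-k} \<union> {n-k+1..n}" using assms by auto
    then show ?thesis by (simp only:) (rule sum.union_disjoint, auto)
  qed
  ultimately show ?thesis unfolding sum_order_stat by simp
qed

lemma sum_top_nonneg_le:
  fixes f :: "real \<Rightarrow> real"
  assumes "k \<le> n" "\<And>x. 0 \<le> f x"
  shows "(\<Sum>i=1..k. f (order_stat y (n - i + 1) n)) \<le> (\<Sum>i=1..n. f (y i))"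
  unfolding sum_top_order_stat[OF assms(1)] using assms(2) by (simp add: sum_nonneg)

text \<open>The sum over the \<open>k\<close> largest values and the sum over all values differ only in terms that vanish
  or have an argument in \<open>(0, L]\<close>, and at most \<open>\<bar>N - k\<bar>\<close> are of the latter
  kind, where \<open>N\<close> counts the positive values.\<close>

lemma sum_top_diff_le:
  fixes f :: "real \<Rightarrow> real"
  assumes k: "k < n" and f0: "\<And>x. x \<le> 0 \<Longrightarrow> f x = 0" and fB: "\<And>x. x \<le> L \<Longrightarrow> \<bar>f x\<bar> \<le> B"
    and top: "order_stat y (n - k) n \<le> L" and B: "0 \<le> B"
  shows "\<bar>(\<Sum>i=1..k. f (order_stat y (n - i + 1) n)) - (\<Sum>i=1..n. f (y i))\<bar>
    \<le> B * \<bar>real (card {i\<in>{1..n}. 0 < y i}) - real k\<bar>"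
proof -
  let ?S = "{j\<in>{1..n-k}. 0 < order_stat y j n}"
  have "\<bar>\<Sum>j=1..n-k. f (order_stat y j n)\<bar> = \<bar>\<Sum>j\<in>?S. f (order_stat y j n)\<bar>"
    by (rule arg_cong[where f = abs], rule sum.mono_neutral_right) (use f0 in \<open>auto simp: not_less\<close>)
  also have "\<dots> \<le> (\<Sum>j\<in>?S. B)"
  proof (rule order_trans[OF sum_abs], rule sum_mono)
    fix j assume "j \<in> ?S"
    then have "order_stat y j n \<le> L" using order_stat_mono[of j "n - k" n y] top k by auto
    then show "\<bar>f (order_stat y j n)\<bar> \<le> B" by (rule fB)
  qed
  also have "\<dots> = B * real (card ?S)" by simp
  also have "\<dots> \<le> B * \<bar>real (card {i\<in>{1..n}. 0 < y i}) - real k\<bar>"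
  proof (rule mult_left_mono[OF _ B])
    show "real (card ?S) \<le> \<bar>real (card {i\<in>{1..n}. 0 < y i}) - real k\<bar>"
    proof (cases "?S = {}")
      case True
      then have "real (card ?S) = 0" by (simp only: card.empty of_nat_0)
      then show ?thesis by linarith
    next
      case False
      then obtain j where j: "1 \<le> j" "j \<le> n - k" "0 < order_stat y j n" by auto
      have "?S \<union> {n-k+1..n} \<subseteq> {i\<in>{1..n}. 0 < order_stat y i n}"
      proof
        fix i assume i: "i \<in> ?S \<union> {n-k+1..n}"
        show "i \<in> {i\<in>{1..n}. 0 < order_stat y i n}"
        proof (cases "i \<in> ?S")
          case False
          then have "order_stat y j n \<le> order_stat y i n" using i j by (intro order_stat_mono) auto
          then show ?thesis using i j False by auto
        qed auto
      qed
      then have "card (?S \<union> {n-k+1..n}) \<le> card {i\<in>{1..n}. 0 < order_stat y i n}" by (intro card_mono) auto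
      moreover have "card (?S \<union> {n-k+1..n}) = card ?S + k" using k by (subst card_Un_disjoint) auto
      ultimately have "card ?S + k \<le> card {i\<in>{1..n}. 0 < y i}" unfolding card_order_stat[of n "\<lambda>u. 0 < u"] by simp
      then show ?thesis by linarith
    qed
  qed
  finally show ?thesis unfolding sum_top_order_stat[OF less_imp_le[OF k]] by simp
qed

lemma order_stat_measurable:
  assumes "1 \<le> j" "j \<le> n"
  shows "(\<lambda>y. order_stat y j n) \<in> borel_measurable (PiM {1..n} (\<lambda>_. borel))"
proof (rule borel_measurableI_le)
  fix x :: real
  have "{y \<in> space (PiM {1..n} (\<lambda>_. borel)). order_stat y j n \<le> x} =
      {y \<in> space (PiM {1..n} (\<lambda>_. borel)). real j \<le> (\<Sum>i\<in>{1..n}. indicator {..x} (y i))}"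
  proof (rule Collect_cong, rule conj_cong[OF refl])
    fix y :: "nat \<Rightarrow> real"
    have "(\<Sum>i\<in>{1..n}. indicator {..x} (y i) :: real) = real (card {i\<in>{1..n}. y i \<le> x})"
      by (simp add: indicator_def sum.If_cases Int_def)
    then show "(order_stat y j n \<le> x) = (real j \<le> (\<Sum>i\<in>{1..n}. indicator {..x} (y i)))"
      using order_stat_le_iff[OF assms, of y x] by simp
  qed
  also have "\<dots> \<in> sets (PiM {1..n} (\<lambda>_. borel))" by measurable
  finally show "{y \<in> space (PiM {1..n} (\<lambda>_. borel)). order_stat y j n \<le> x} \<in> sets (PiM {1..n} (\<lambda>_. borel))" .
qed

section \<open>Exponential samples\<close>

definition expo :: "real measure" where
  "expo = density lborel (\<lambda>x. ennreal (exponential_density 1 x))"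

lemma prob_space_expo: "prob_space expo"
  unfolding expo_def by (rule prob_space_exponential_density) simp

lemma sets_expo [simp, measurable_cong]: "sets expo = sets borel"
  by (simp add: expo_def)

lemma space_expo [simp]: "space expo = UNIV"
  by (simp add: expo_def)

lemma distributed_expo: "distributed expo lborel (\<lambda>x. x) (exponential_density 1)"
  by (auto simp: distributed_def expo_def intro!: distr_id2)

lemma expo_gt: "0 \<le> c \<Longrightarrow> measure expo {c<..} = exp (- c)"
  using prob_space.exponential_distributedD_gt[OF prob_space_expo distributed_expo, of c]
  by (simp add: greaterThan_def)

lemma expo_le: "0 \<le> c \<Longrightarrow> measure expo {..c} = 1 - exp (- c)"
  using prob_space.exponential_distributedD_le[OF prob_space_expo distributed_expo, of c]
  by (simp add: atMost_def)

lemma AE_expo_pos: "AE e in expo. 0 < e"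
proof -
  interpret prob_space expo by (rule prob_space_expo)
  have "prob {0<..} = 1" using expo_gt[of 0] by simp
  then have "AE e in expo. e \<in> {0<..}" by (subst prob_eq_1[symmetric]) auto
  then show ?thesis by simp
qed

lemma expo_ge: "0 \<le> c \<Longrightarrow> emeasure expo {c..} = ennreal (exp (- c))"
proof -
  assume c: "0 \<le> c"
  interpret prob_space expo by (rule prob_space_expo)
  have "emeasure expo {c} = 0"
    by (simp add: expo_def emeasure_density nn_integral_indicator_singleton')
  moreover have "emeasure expo {c..} = emeasure expo {c} + emeasure expo {c<..}"
    by (subst plus_emeasure) (auto intro!: arg_cong[where f = "emeasure expo"])
  ultimately show ?thesis using expo_gt[OF c] by (simp add: emeasure_eq_measure)
qed

text \<open>Lack of memory of the exponential law.\<close>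

lemma integral_expo_shift:
  fixes \<psi> :: "real \<Rightarrow> real"
  assumes [measurable]: "\<psi> \<in> borel_measurable borel" and 0: "\<And>p. p \<le> 0 \<Longrightarrow> \<psi> p = 0" and s: "0 \<le> s"
    and int: "integrable expo \<psi>"
  shows "integrable expo (\<lambda>e. \<psi> (e - s))" "(\<integral>e. \<psi> (e - s) \<partial>expo) = exp (- s) * (\<integral>e. \<psi> e \<partial>expo)"
proof -
  have e0: "exponential_density 1 x \<ge> 0" for x :: real by (rule exponential_density_nonneg) simp
  have "has_bochner_integral lborel (\<lambda>x. exponential_density 1 x *\<^sub>R \<psi> x) (\<integral>e. \<psi> e \<partial>expo)"
    using int e0 unfolding expo_def
    by (subst (asm) integrable_density) (auto simp: integral_density has_bochner_integral_iff)
  then have "has_bochner_integral lborel (\<lambda>x. exp (- s) *\<^sub>R (exponential_density 1 x *\<^sub>R \<psi> x)) (exp (- s) *\<^sub>R (\<integral>e. \<psi> e \<partial>expo))"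
    by (rule has_bochner_integral_scaleR_right)
  then have "has_bochner_integral lborel (\<lambda>x. exp (- s) *\<^sub>R (exponential_density 1 (- s + 1 * x) *\<^sub>R \<psi> (- s + 1 * x))) (exp (- s) *\<^sub>R (\<integral>e. \<psi> e \<partial>expo))"
    using lborel_has_bochner_integral_real_affine_iff[of 1 "\<lambda>x. exp (- s) *\<^sub>R (exponential_density 1 x *\<^sub>R \<psi> x)" _ "- s"] by simp
  also have "(\<lambda>x. exp (- s) *\<^sub>R (exponential_density 1 (- s + 1 * x) *\<^sub>R \<psi> (- s + 1 * x))) = (\<lambda>x. exponential_density 1 x *\<^sub>R \<psi> (x - s))"
    using 0 s by (auto simp: exponential_density_def fun_eq_iff not_less exp_diff exp_minus field_simps)
  finally have *: "has_bochner_integral lborel (\<lambda>x. exponential_density 1 x *\<^sub>R \<psi> (x - s)) (exp (- s) *\<^sub>R (\<integral>e. \<psi> e \<partial>expo))" .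
  show "integrable expo (\<lambda>e. \<psi> (e - s))" "(\<integral>e. \<psi> (e - s) \<partial>expo) = exp (- s) * (\<integral>e. \<psi> e \<partial>expo)"
    using * e0 unfolding expo_def
    by (auto simp: integrable_density integral_density has_bochner_integral_iff)
qed

lemma nn_integral_expo_tail:
  fixes h :: "real \<Rightarrow> ennreal"
  assumes [measurable]: "h \<in> borel_measurable borel"
  shows "(\<integral>\<^sup>+p. (\<integral>\<^sup>+r. h r * indicator {0..p} r \<partial>lborel) \<partial>expo) = (\<integral>\<^sup>+r. h r * ennreal (exp (- r)) * indicator {0..} r \<partial>lborel)"
proof -
  interpret E: prob_space expo by (rule prob_space_expo)
  interpret P: pair_sigma_finite expo lborel ..
  have [measurable]: "Measurable.pred (expo \<Otimes>\<^sub>M lborel) (\<lambda>x. snd x \<in> {0..fst x})"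
    unfolding atLeastAtMost_iff by measurable
  have "(\<integral>\<^sup>+p. (\<integral>\<^sup>+r. h r * indicator {0..p} r \<partial>lborel) \<partial>expo) = (\<integral>\<^sup>+r. (\<integral>\<^sup>+p. h r * indicator {0..p} r \<partial>expo) \<partial>lborel)"
    by (rule P.Fubini'[symmetric]) (auto simp: indicator_def split_beta)
  also have "\<dots> = (\<integral>\<^sup>+r. h r * ennreal (exp (- r)) * indicator {0..} r \<partial>lborel)"
  proof (rule nn_integral_cong)
    fix r :: real
    show "(\<integral>\<^sup>+p. h r * indicator {0..p} r \<partial>expo) = h r * ennreal (exp (- r)) * indicator {0..} r"
    proof (cases "0 \<le> r")
      case True
      have "(\<integral>\<^sup>+p. h r * indicator {0..p} r \<partial>expo) = (\<integral>\<^sup>+p. h r * indicator {r..} p \<partial>expo)"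
        by (intro nn_integral_cong) (use True in \<open>auto simp: indicator_def\<close>)
      also have "\<dots> = h r * emeasure expo {r..}" by (rule nn_integral_cmult_indicator) simp
      finally show ?thesis using True by (simp add: expo_ge)
    qed simp
  qed
  finally show ?thesis .
qed

text \<open>Tonelli's theorem: an antiderivative has mean \<open>\<integral> h(r) exp(-r) dr\<close>, since
  \<open>exp(-r)\<close> is the probability of exceeding \<open>r\<close>.\<close>

lemma expo_mean:
  fixes h \<Psi> :: "real \<Rightarrow> real"
  assumes [measurable]: "h \<in> borel_measurable borel" "\<Psi> \<in> borel_measurable borel"
    and h: "\<And>r. 0 \<le> h r" and \<Psi>: "\<And>p. 0 < p \<Longrightarrow> (h has_integral \<Psi> p) {0..p}"
    and \<Psi>0: "\<And>p. p \<le> 0 \<Longrightarrow> \<Psi> p = 0"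
    and T: "(\<integral>\<^sup>+r. ennreal (h r * exp (- r)) * indicator {0..} r \<partial>lborel) = ennreal T" and T0: "0 \<le> T"
  shows "integrable expo \<Psi>" "(\<integral>p. \<Psi> p \<partial>expo) = T"
proof -
  have pos: "0 \<le> \<Psi> p" for p
    using has_integral_nonneg[OF \<Psi>[of p]] h \<Psi>0[of p] by (cases "0 < p") auto
  have "(\<integral>\<^sup>+p. ennreal (\<Psi> p) \<partial>expo) = (\<integral>\<^sup>+p. (\<integral>\<^sup>+r. ennreal (h r) * indicator {0..p} r \<partial>lborel) \<partial>expo)"
  proof (rule nn_integral_cong_AE)
    show "AE p in expo. ennreal (\<Psi> p) = (\<integral>\<^sup>+r. ennreal (h r) * indicator {0..p} r \<partial>lborel)"
      using AE_expo_pos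
    proof eventually_elim
      case (elim p)
      show ?case
        using nn_integral_has_integral_lebesgue'[OF h \<Psi>[OF elim]] by simp
    qed
  qed
  also have "\<dots> = ennreal T"
    unfolding T[symmetric] using h by (subst nn_integral_expo_tail) (auto simp: ennreal_mult)
  finally have *: "(\<integral>\<^sup>+p. ennreal (\<Psi> p) \<partial>expo) = ennreal T" .
  have "\<Psi> \<in> borel_measurable expo" by measurable
  then have "has_bochner_integral expo \<Psi> T"
    by (rule has_bochner_integral_nn_integral[OF _ _ T0 *]) (simp add: pos)
  then show "integrable expo \<Psi>" "(\<integral>p. \<Psi> p \<partial>expo) = T"
    by (simp_all add: has_bochner_integral_iff)
qed

text \<open>The value for \<open>e \<le> 0\<close>, an event of probability zero, is arbitrary; it keeps the function
  measurable on the whole line.\<close>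

definition exp_quantile :: "(real \<Rightarrow> real) \<Rightarrow> real \<Rightarrow> real" where
  "exp_quantile F e = (if e > 0 then tail_quantile F (exp e) else 0)"

lemma tail_quantile_mono:
  assumes "real_distribution D"
  shows "mono_on {1<..} (tail_quantile (cdf D))"
proof -
  interpret cdf_distribution D by (rule cdf_distribution.intro[OF assms])
  show ?thesis
  proof (rule mono_onI)
    fix r s :: real assume rs: "r \<in> {1<..}" "s \<in> {1<..}" "r \<le> s"
    then have "1 / s \<le> 1 / r" by (simp add: divide_left_mono)
    then show "tail_quantile (cdf D) r \<le> tail_quantile (cdf D) s"
      unfolding tail_quantile_def quantile_def
      using rs by (intro mono_onD[OF mono_I]) auto
  qed
qed

lemma exp_quantile_measurable:
  assumes "real_distribution D"
  shows "exp_quantile (cdf D) \<in> borel_measurable borel"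
proof -
  have "mono_on {0<..} (\<lambda>e. tail_quantile (cdf D) (exp e))"
    using tail_quantile_mono[OF assms] by (auto simp: mono_on_def)
  from borel_measurable_mono_on_fnc[OF this]
  have "(\<lambda>e. indicator {0<..} e *\<^sub>R tail_quantile (cdf D) (exp e)) \<in> borel_measurable borel"
    by (subst (asm) borel_measurable_restrict_space_iff) auto
  moreover have "(\<lambda>e. indicator {0<..} e *\<^sub>R tail_quantile (cdf D) (exp e)) = exp_quantile (cdf D)"
    by (auto simp: exp_quantile_def indicator_def)
  ultimately show ?thesis by simp
qed

lemma distr_exp_quantile:
  assumes "real_distribution D"
  shows "distr expo borel (exp_quantile (cdf D)) = D"
proof (rule cdf_unique)
  interpret cdf_distribution D by (rule cdf_distribution.intro[OF assms])
  interpret E: prob_space expo by (rule prob_space_expo)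
  note exp_quantile_measurable[OF assms, measurable]
  show "real_distribution (distr expo borel (exp_quantile (cdf D)))"
    by (rule E.real_distribution_distr) simp
  show "real_distribution D" by fact
  show "cdf (distr expo borel (exp_quantile (cdf D))) = cdf D"
  proof
    fix x
    have c: "0 \<le> cdf D x" "cdf D x \<le> 1" by (auto simp: cdf_nonneg cdf_bounded_prob)
    define B where "B = (if cdf D x < 1 then {..- ln (1 - cdf D x)} else UNIV)"
    have "cdf (distr expo borel (exp_quantile (cdf D))) x = E.prob {e. exp_quantile (cdf D) e \<le> x}"
      by (subst cdf_def) (simp add: measure_distr vimage_def)
    also have "\<dots> = E.prob B"
    proof (rule E.finite_measure_eq_AE)
      show "AE e in expo. (e \<in> {e. exp_quantile (cdf D) e \<le> x}) = (e \<in> B)"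
        using AE_expo_pos
      proof eventually_elim
        case (elim e)
        have "exp_quantile (cdf D) e \<le> x \<longleftrightarrow> 1 - exp (- e) \<le> cdf D x"
          unfolding exp_quantile_def tail_quantile_def quantile_def
          using pseudoinverse[of "1 - exp (- e)" x] elim by (simp add: exp_minus inverse_eq_divide)
        also have "\<dots> \<longleftrightarrow> e \<in> B"
        proof (cases "cdf D x < 1")
          case True
          have "1 - exp (- e) \<le> cdf D x \<longleftrightarrow> 1 - cdf D x \<le> exp (- e)" by linarith
          also have "\<dots> \<longleftrightarrow> ln (1 - cdf D x) \<le> - e" using True by (metis diff_gt_0_iff_gt exp_le_cancel_iff exp_ln)
          finally show ?thesis using True by (auto simp: B_def)
        next
          case False
          then show ?thesis using c by (simp add: B_def)
        qed
        finally show ?case by simp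
      qed
    qed (auto simp: B_def)
    also have "\<dots> = cdf D x"
    proof (cases "cdf D x < 1")
      case True
      have "0 \<le> - ln (1 - cdf D x)" using c True by simp
      then show ?thesis using True expo_le[of "- ln (1 - cdf D x)"] by (simp add: B_def)
    next
      case False
      then show ?thesis using c E.prob_space by (simp add: B_def)
    qed
    finally show "cdf (distr expo borel (exp_quantile (cdf D))) x = cdf D x" .
  qed
qed

definition expo_sample :: "nat \<Rightarrow> (nat \<Rightarrow> real) measure" where
  "expo_sample n = PiM {1..n} (\<lambda>_. expo)"

lemma prob_space_expo_sample: "prob_space (expo_sample n)"
  unfolding expo_sample_def by (intro prob_space_PiM prob_space_expo)

lemma sets_expo_sample [measurable_cong]: "sets (expo_sample n) = sets (PiM {1..n} (\<lambda>_. borel))"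
  unfolding expo_sample_def by (intro sets_PiM_cong) auto

lemma space_expo_sample: "space (expo_sample n) = PiE {1..n} (\<lambda>_. UNIV)"
  by (simp add: expo_sample_def space_PiM)

lemma distr_expo_sample_coord:
  assumes "i \<in> {1..n}"
  shows "distr (expo_sample n) borel (\<lambda>\<omega>. \<omega> i) = expo"
proof -
  have "distr (expo_sample n) borel (\<lambda>\<omega>. \<omega> i) = distr (expo_sample n) expo (\<lambda>\<omega>. \<omega> i)"
    by (rule distr_cong) auto
  also have "\<dots> = expo"
    unfolding expo_sample_def by (rule distr_PiM_component[OF prob_space_expo assms])
  finally show ?thesis .
qed

lemma expo_sample_indep:
  assumes "n > 0"
  shows "prob_space.indep_vars (expo_sample n) (\<lambda>_. borel) (\<lambda>i \<omega>. \<omega> i) {1..n}"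
proof -
  interpret prob_space "expo_sample n" by (rule prob_space_expo_sample)
  have "distr (expo_sample n) (PiM {1..n} (\<lambda>_. borel)) (\<lambda>\<omega>. \<lambda>i\<in>{1..n}. \<omega> i) = expo_sample n"
  proof -
    have "distr (expo_sample n) (PiM {1..n} (\<lambda>_. borel)) (\<lambda>\<omega>. \<lambda>i\<in>{1..n}. \<omega> i)
        = distr (expo_sample n) (PiM {1..n} (\<lambda>_. borel)) (\<lambda>\<omega>. \<omega>)"
      by (rule distr_cong) (auto simp: space_expo_sample PiE_iff extensional_restrict restrict_def extensional_def)
    also have "\<dots> = expo_sample n" by (rule distr_id2) (simp add: sets_expo_sample)
    finally show ?thesis .
  qed
  also have "\<dots> = PiM {1..n} (\<lambda>i. distr (expo_sample n) borel (\<lambda>\<omega>. \<omega> i))"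
    unfolding expo_sample_def[of n]
    by (rule PiM_cong[OF refl]) (rule distr_expo_sample_coord[unfolded expo_sample_def, symmetric])
  finally show ?thesis
    using assms by (subst indep_vars_iff_distr_eq_PiM') auto
qed

text \<open>The exceptional events will be preimages of Borel sets of samples, so their probability depends only on the
  law of \<open>(Y\<^sub>1, \<dots>, Y\<^sub>n)\<close> and may be computed for exponential variables instead.\<close>

lemma sample_law_transfer:
  fixes Y :: "nat \<Rightarrow> 'a \<Rightarrow> real"
  assumes "prob_space M" and iv: "prob_space.indep_vars M (\<lambda>_. borel) Y {1..}"
    and F: "\<And>i. i \<ge> 1 \<Longrightarrow> cdf (distr M borel (Y i)) = F"
    and n: "n > 0" and B: "B \<in> sets (PiM {1..n} (\<lambda>_. borel))"
  shows "{\<omega> \<in> space M. (\<lambda>i\<in>{1..n}. Y i \<omega>) \<in> B} \<in> sets M"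
    and "measure M {\<omega> \<in> space M. (\<lambda>i\<in>{1..n}. Y i \<omega>) \<in> B} =
      measure (expo_sample n) {e \<in> space (expo_sample n). (\<lambda>i\<in>{1..n}. exp_quantile F (e i)) \<in> B}"
proof -
  interpret prob_space M by fact
  have rv: "random_variable borel (Y i)" if "i \<ge> 1" for i
    using iv that unfolding indep_vars_def by auto
  have D: "real_distribution (distr M borel (Y i))" if "i \<ge> 1" for i
    by (rule real_distribution_distr[OF rv[OF that]])
  have law: "distr expo borel (exp_quantile F) = distr M borel (Y i)" if "i \<ge> 1" for i
    using distr_exp_quantile[OF D[OF that]] F[OF that] by simp
  have qm [measurable]: "exp_quantile F \<in> borel_measurable borel"
    using exp_quantile_measurable[OF D[of 1]] F[of 1] by simp
  have Ym [measurable]: "(\<lambda>\<omega>. \<lambda>i\<in>{1..n}. Y i \<omega>) \<in> measurable M (PiM {1..n} (\<lambda>_. borel))"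
    by (rule measurable_restrict) (use rv in auto)
  have Em [measurable]: "(\<lambda>e. \<lambda>i\<in>{1..n}. exp_quantile F (e i)) \<in> measurable (expo_sample n) (PiM {1..n} (\<lambda>_. borel))"
    by measurable
  have "indep_vars (\<lambda>_. borel) Y {1..n}" by (rule indep_vars_subset[OF iv]) auto
  then have "distr M (PiM {1..n} (\<lambda>_. borel)) (\<lambda>\<omega>. \<lambda>i\<in>{1..n}. Y i \<omega>) = PiM {1..n} (\<lambda>i. distr M borel (Y i))"
    using n rv by (subst (asm) indep_vars_iff_distr_eq_PiM') auto
  also have "\<dots> = PiM {1..n} (\<lambda>i. distr expo borel (exp_quantile F))"
    by (rule PiM_cong) (auto simp: law)
  also have "\<dots> = distr (expo_sample n) (PiM {1..n} (\<lambda>_. borel)) (compose {1..n} (exp_quantile F))"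
  proof -
    let ?Q = "distr expo borel (exp_quantile F)"
    have "distr (expo_sample n) (PiM {1..n} (\<lambda>_. ?Q)) (compose {1..n} (exp_quantile F)) =
        PiM {1..n} (\<lambda>i. distr expo ?Q (exp_quantile F))"
      unfolding expo_sample_def
      by (rule distr_PiM_finite_prob_space')
         (auto simp: prob_space_expo intro!: prob_space.prob_space_distr)
    moreover have "distr expo ?Q (exp_quantile F) = ?Q" by (rule distr_cong) auto
    moreover have "distr (expo_sample n) (PiM {1..n} (\<lambda>_. ?Q)) (compose {1..n} (exp_quantile F)) =
        distr (expo_sample n) (PiM {1..n} (\<lambda>_. borel)) (compose {1..n} (exp_quantile F))"
      by (intro distr_cong sets_PiM_cong) auto
    ultimately show ?thesis by simp
  qed
  also have "compose {1..n} (exp_quantile F) = (\<lambda>e. \<lambda>i\<in>{1..n}. exp_quantile F (e i))"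
    by (auto simp: compose_def)
  finally have eq: "distr M (PiM {1..n} (\<lambda>_. borel)) (\<lambda>\<omega>. \<lambda>i\<in>{1..n}. Y i \<omega>) =
    distr (expo_sample n) (PiM {1..n} (\<lambda>_. borel)) (\<lambda>e. \<lambda>i\<in>{1..n}. exp_quantile F (e i))" .
  show "{\<omega> \<in> space M. (\<lambda>i\<in>{1..n}. Y i \<omega>) \<in> B} \<in> sets M"
    using measurable_sets[OF Ym B] by (simp add: vimage_def Int_def conj_commute)
  show "measure M {\<omega> \<in> space M. (\<lambda>i\<in>{1..n}. Y i \<omega>) \<in> B} =
      measure (expo_sample n) {e \<in> space (expo_sample n). (\<lambda>i\<in>{1..n}. exp_quantile F (e i)) \<in> B}"
    using arg_cong[OF eq, of "\<lambda>N. measure N B"]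
    unfolding measure_distr[OF Ym B] measure_distr[OF Em B] by (simp add: vimage_def Int_def conj_commute)
qed

lemma (in prob_space) indep_centered_sum_square:
  fixes Z :: "'i \<Rightarrow> 'a \<Rightarrow> real"
  assumes "finite I" "indep_vars (\<lambda>_. borel) Z I"
    and "\<And>i. i \<in> I \<Longrightarrow> integrable M (Z i)" "\<And>i. i \<in> I \<Longrightarrow> integrable M (\<lambda>\<omega>. (Z i \<omega>)\<^sup>2)"
    and "\<And>i. i \<in> I \<Longrightarrow> expectation (Z i) = 0"
  shows "integrable M (\<lambda>\<omega>. (\<Sum>i\<in>I. Z i \<omega>)\<^sup>2) \<and>
    expectation (\<lambda>\<omega>. (\<Sum>i\<in>I. Z i \<omega>)\<^sup>2) = (\<Sum>i\<in>I. expectation (\<lambda>\<omega>. (Z i \<omega>)\<^sup>2))"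
  using assms
proof (induction I rule: finite_induct)
  case empty
  then show ?case by simp
next
  case (insert i I)
  have IH: "integrable M (\<lambda>\<omega>. (\<Sum>i\<in>I. Z i \<omega>)\<^sup>2)"
    "expectation (\<lambda>\<omega>. (\<Sum>i\<in>I. Z i \<omega>)\<^sup>2) = (\<Sum>i\<in>I. expectation (\<lambda>\<omega>. (Z i \<omega>)\<^sup>2))"
    using insert.IH insert.prems indep_vars_subset[OF insert.prems(1), of I] by auto
  have iv: "indep_var borel (Z i) borel (\<lambda>\<omega>. \<Sum>i\<in>I. Z i \<omega>)"
    by (rule indep_vars_sum[OF insert.hyps(1,2) insert.prems(1)])
  have int: "integrable M (Z i)" "integrable M (\<lambda>\<omega>. \<Sum>i\<in>I. Z i \<omega>)" "integrable M (\<lambda>\<omega>. (Z i \<omega>)\<^sup>2)"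
    using insert.prems by auto
  have e0: "expectation (Z i) = 0" using insert.prems by auto
  have cross: "integrable M (\<lambda>\<omega>. Z i \<omega> * (\<Sum>i\<in>I. Z i \<omega>))" "expectation (\<lambda>\<omega>. Z i \<omega> * (\<Sum>i\<in>I. Z i \<omega>)) = 0"
    using indep_var_integrable[OF iv int(1,2)] indep_var_lebesgue_integral[OF iv int(1,2)] e0 by auto
  have eq: "(\<lambda>\<omega>. (\<Sum>i\<in>insert i I. Z i \<omega>)\<^sup>2) = (\<lambda>\<omega>. (Z i \<omega>)\<^sup>2 + 2 * (Z i \<omega> * (\<Sum>i\<in>I. Z i \<omega>)) + (\<Sum>i\<in>I. Z i \<omega>)\<^sup>2)"
    using insert.hyps by (auto simp: power2_sum algebra_simps)
  show ?case
    unfolding eq using IH int cross insert.hyps by simp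
qed

lemma expo_sample_coord:
  fixes f :: "real \<Rightarrow> real"
  assumes i: "i \<in> {1..n}" and f: "f \<in> borel_measurable borel"
  shows "integrable (expo_sample n) (\<lambda>\<omega>. f (\<omega> i)) \<longleftrightarrow> integrable expo f"
    and "(\<integral>\<omega>. f (\<omega> i) \<partial>expo_sample n) = (\<integral>e. f e \<partial>expo)"
proof -
  have m: "(\<lambda>\<omega>. \<omega> i) \<in> measurable (expo_sample n) borel" using i by measurable
  show "integrable (expo_sample n) (\<lambda>\<omega>. f (\<omega> i)) \<longleftrightarrow> integrable expo f"
    using integrable_distr_eq[OF m f] distr_expo_sample_coord[OF i] by simp
  show "(\<integral>\<omega>. f (\<omega> i) \<partial>expo_sample n) = (\<integral>e. f e \<partial>expo)"
    using integral_distr[OF m f] distr_expo_sample_coord[OF i] by simp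
qed

lemma expo_sum_measurable [measurable]:
  fixes \<psi> :: "real \<Rightarrow> real"
  assumes [measurable]: "\<psi> \<in> borel_measurable borel"
  shows "(\<lambda>\<omega>. \<Sum>i=1..n. \<psi> (\<omega> i - s)) \<in> borel_measurable (expo_sample n)"
  by measurable

text \<open>By lack of memory a summand has second moment \<open>exp(-s)\<close> times that of \<open>\<psi>\<close> under
  the exponential law. With \<open>exp(-s) = k/n\<close> the variance of the sum is thus at most of order
  \<open>k\<close>.\<close>

lemma expo_sum_chebyshev:
  fixes \<psi> :: "real \<Rightarrow> real"
  assumes \<psi> [measurable]: "\<psi> \<in> borel_measurable borel" and 0: "\<And>p. p \<le> 0 \<Longrightarrow> \<psi> p = 0" and s: "0 \<le> s"
    and int: "integrable expo (\<lambda>p. (\<psi> p)\<^sup>2)" and n: "n > 0" and a: "a > 0"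
  shows "measure (expo_sample n) {\<omega> \<in> space (expo_sample n).
      a \<le> \<bar>(\<Sum>i=1..n. \<psi> (\<omega> i - s)) - real n * exp (- s) * (\<integral>p. \<psi> p \<partial>expo)\<bar>}
    \<le> real n * exp (- s) * (\<integral>p. (\<psi> p)\<^sup>2 \<partial>expo) / a\<^sup>2"
proof -
  interpret E: prob_space expo by (rule prob_space_expo)
  interpret prob_space "expo_sample n" by (rule prob_space_expo_sample)
  have int1: "integrable expo \<psi>"
    by (rule E.square_integrable_imp_integrable[OF _ int]) measurable
  note S1 = integral_expo_shift[OF \<psi> 0 s int1]
  have "(\<lambda>p. (\<psi> p)\<^sup>2) \<in> borel_measurable borel" by measurable
  note S2 = integral_expo_shift[OF this _ s int]
  define m where "m = exp (- s) * (\<integral>p. \<psi> p \<partial>expo)"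
  define Z where "Z = (\<lambda>i (\<omega> :: nat \<Rightarrow> real). \<psi> (\<omega> i - s) - m)"
  have f: "(\<lambda>e. \<psi> (e - s) - m) \<in> borel_measurable borel" "(\<lambda>e. (\<psi> (e - s) - m)\<^sup>2) \<in> borel_measurable borel" by measurable
  have sq: "(\<lambda>e. (\<psi> (e - s) - m)\<^sup>2) = (\<lambda>e. (\<psi> (e - s))\<^sup>2 - 2 * m * \<psi> (e - s) + m\<^sup>2)"
    by (auto simp: power2_diff)
  have i2: "integrable expo (\<lambda>e. (\<psi> (e - s) - m)\<^sup>2)" unfolding sq
    using S1(1) S2(1) 0 by (intro Bochner_Integration.integrable_add Bochner_Integration.integrable_diff integrable_mult_right) auto
  have e2: "(\<integral>e. (\<psi> (e - s) - m)\<^sup>2 \<partial>expo) \<le> exp (- s) * (\<integral>p. (\<psi> p)\<^sup>2 \<partial>expo)"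
  proof -
    have "(\<integral>e. (\<psi> (e - s) - m)\<^sup>2 \<partial>expo) = (\<integral>e. (\<psi> (e - s))\<^sup>2 \<partial>expo) - 2 * m * (\<integral>e. \<psi> (e - s) \<partial>expo) + m\<^sup>2"
      unfolding sq using S1(1) S2(1) 0 E.prob_space by simp
    also have "\<dots> = (\<integral>e. (\<psi> (e - s))\<^sup>2 \<partial>expo) - m\<^sup>2"
      using S1(2) by (simp add: m_def power2_eq_square)
    finally show ?thesis using S2(2) 0 by simp
  qed
  have iv: "indep_vars (\<lambda>_. borel) Z {1..n}"
    unfolding Z_def by (rule indep_vars_compose2[OF expo_sample_indep[OF n]]) measurable
  have Zi: "integrable (expo_sample n) (Z i)" "integrable (expo_sample n) (\<lambda>\<omega>. (Z i \<omega>)\<^sup>2)"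
    "expectation (Z i) = 0" "expectation (\<lambda>\<omega>. (Z i \<omega>)\<^sup>2) \<le> exp (- s) * (\<integral>p. (\<psi> p)\<^sup>2 \<partial>expo)" if "i \<in> {1..n}" for i
  proof -
    show "integrable (expo_sample n) (Z i)"
      unfolding Z_def using expo_sample_coord(1)[OF that f(1)] S1(1) by auto
    show "integrable (expo_sample n) (\<lambda>\<omega>. (Z i \<omega>)\<^sup>2)"
      unfolding Z_def using expo_sample_coord(1)[OF that f(2)] i2 by auto
    show "expectation (Z i) = 0"
      unfolding Z_def using expo_sample_coord(2)[OF that f(1)] S1 E.prob_space by (simp add: m_def)
    show "expectation (\<lambda>\<omega>. (Z i \<omega>)\<^sup>2) \<le> exp (- s) * (\<integral>p. (\<psi> p)\<^sup>2 \<partial>expo)"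
      unfolding Z_def using expo_sample_coord(2)[OF that f(2)] e2 by auto
  qed
  have sumsq: "integrable (expo_sample n) (\<lambda>\<omega>. (\<Sum>i=1..n. Z i \<omega>)\<^sup>2)"
    "expectation (\<lambda>\<omega>. (\<Sum>i=1..n. Z i \<omega>)\<^sup>2) = (\<Sum>i=1..n. expectation (\<lambda>\<omega>. (Z i \<omega>)\<^sup>2))"
    using indep_centered_sum_square[OF _ iv] Zi by auto
  have mean0: "expectation (\<lambda>\<omega>. \<Sum>i=1..n. Z i \<omega>) = 0"
    using Zi by (subst Bochner_Integration.integral_sum) auto
  have "\<P>(\<omega> in expo_sample n. a \<le> \<bar>(\<Sum>i=1..n. Z i \<omega>) - expectation (\<lambda>\<omega>. \<Sum>i=1..n. Z i \<omega>)\<bar>)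
      \<le> expectation (\<lambda>\<omega>. ((\<Sum>i=1..n. Z i \<omega>) - expectation (\<lambda>\<omega>. \<Sum>i=1..n. Z i \<omega>))\<^sup>2) / a\<^sup>2"
    by (rule Chebyshev_inequality[OF _ sumsq(1) a]) (use Zi in auto)
  also have "\<dots> \<le> (\<Sum>i=1..n. exp (- s) * (\<integral>p. (\<psi> p)\<^sup>2 \<partial>expo)) / a\<^sup>2"
    unfolding mean0 diff_zero sumsq(2) by (intro divide_right_mono sum_mono Zi) auto
  finally show ?thesis
    unfolding mean0 by (simp add: Z_def m_def sum_subtractf mult.assoc)
qed

lemma expo_sum_markov:
  fixes \<psi> :: "real \<Rightarrow> real"
  assumes \<psi> [measurable]: "\<psi> \<in> borel_measurable borel" and 0: "\<And>p. p \<le> 0 \<Longrightarrow> \<psi> p = 0" and s: "0 \<le> s"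
    and pos: "\<And>p. 0 \<le> \<psi> p" and int: "integrable expo \<psi>" and a: "a > 0"
  shows "measure (expo_sample n) {\<omega> \<in> space (expo_sample n). a \<le> (\<Sum>i=1..n. \<psi> (\<omega> i - s))}
    \<le> real n * exp (- s) * (\<integral>p. \<psi> p \<partial>expo) / a"
proof -
  interpret prob_space "expo_sample n" by (rule prob_space_expo_sample)
  note S1 = integral_expo_shift[OF \<psi> 0 s int]
  have f: "(\<lambda>e. \<psi> (e - s)) \<in> borel_measurable borel" by measurable
  have I: "integrable (expo_sample n) (\<lambda>\<omega>. \<psi> (\<omega> i - s))" "expectation (\<lambda>\<omega>. \<psi> (\<omega> i - s)) = exp (- s) * (\<integral>p. \<psi> p \<partial>expo)"
    if "i \<in> {1..n}" for i
    using expo_sample_coord[OF that f] S1 by auto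
  have "measure (expo_sample n) {\<omega> \<in> space (expo_sample n). a \<le> (\<Sum>i=1..n. \<psi> (\<omega> i - s))}
      \<le> expectation (\<lambda>\<omega>. \<Sum>i=1..n. \<psi> (\<omega> i - s)) / a"
    by (rule integral_Markov_inequality_measure[where A = "{}"]) (use I pos a in \<open>auto intro!: sum_nonneg\<close>)
  also have "expectation (\<lambda>\<omega>. \<Sum>i=1..n. \<psi> (\<omega> i - s)) = real n * exp (- s) * (\<integral>p. \<psi> p \<partial>expo)"
    using I by (subst Bochner_Integration.integral_sum) auto
  finally show ?thesis .
qed

lemma integral_expo_indicator:
  "integrable expo (indicator {0<..} :: real \<Rightarrow> real)" "(\<integral>p. indicator {0<..} p \<partial>expo) = (1 :: real)"
proof -
  interpret E: prob_space expo by (rule prob_space_expo)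
  show "integrable expo (indicator {0<..} :: real \<Rightarrow> real)" by (auto simp: E.emeasure_eq_measure)
  show "(\<integral>p. indicator {0<..} p \<partial>expo) = (1 :: real)" using expo_gt[of 0] by simp
qed

lemma card_exceed:
  fixes \<omega> :: "nat \<Rightarrow> real" and c s :: real
  shows
  "real (card {i\<in>{1..n}. c < \<omega> i - s}) = (\<Sum>i=1..n. indicator {0<..} (\<omega> i - (s + c)))"
proof -
  have "(\<Sum>i=1..n. indicator {0<..} (\<omega> i - (s + c)) :: real) = (\<Sum>i=1..n. if c < \<omega> i - s then 1 else 0)"
    by (intro sum.cong refl) (auto simp: indicator_def algebra_simps)
  then show ?thesis by (simp add: sum.If_cases Int_def)
qed

lemma exceedance_count_chebyshev:
  assumes "0 \<le> s + c" "n > 0" "a > 0"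
  shows "measure (expo_sample n) {\<omega> \<in> space (expo_sample n).
      a \<le> \<bar>real (card {i\<in>{1..n}. c < \<omega> i - s}) - real n * exp (- (s + c))\<bar>} \<le> real n * exp (- (s + c)) / a\<^sup>2"
proof -
  have i2: "(\<lambda>p. (indicator {0<..} p :: real)\<^sup>2) = indicator {0<..}" by (auto simp: indicator_def)
  show ?thesis
    using expo_sum_chebyshev[of "indicator {0<..}" "s + c" n a] assms integral_expo_indicator expo_gt[of 0]
    unfolding i2 card_exceed by simp
qed

lemma max_exceed_markov:
  assumes "0 \<le> s + L"
  shows "measure (expo_sample n) {\<omega> \<in> space (expo_sample n). \<exists>i\<in>{1..n}. L < \<omega> i - s} \<le> real n * exp (- (s + L))"
proof -
  have "{\<omega> \<in> space (expo_sample n). \<exists>i\<in>{1..n}. L < \<omega> i - s} =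
      {\<omega> \<in> space (expo_sample n). 1 \<le> (\<Sum>i=1..n. indicator {0<..} (\<omega> i - (s + L)) :: real)}"
  proof (rule Collect_cong, rule conj_cong[OF refl])
    fix \<omega> :: "nat \<Rightarrow> real"
    have "(\<exists>i\<in>{1..n}. L < \<omega> i - s) \<longleftrightarrow> card {i\<in>{1..n}. L < \<omega> i - s} \<noteq> 0" by auto
    also have "\<dots> \<longleftrightarrow> 1 \<le> real (card {i\<in>{1..n}. L < \<omega> i - s})" by linarith
    finally show "(\<exists>i\<in>{1..n}. L < \<omega> i - s) = (1 \<le> (\<Sum>i=1..n. indicator {0<..} (\<omega> i - (s + L)) :: real))"
      unfolding card_exceed .
  qed
  then show ?thesis
    using expo_sum_markov[of "indicator {0<..}" "s + L" 1 n] assms integral_expo_indicator by simp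
qed

section \<open>Statistics on the log scale and their means\<close>

text \<open>The statistics as functions of the log scale. An error of size \<open>exp(by)/\<surd>k\<close> in the argument
  changes such a function by at most \<open>exp(2by)/\<surd>k\<close> up to constants, which has a finite mean
  under the exponential law precisely if \<open>b < 1/2\<close>.\<close>

definition exp_lipschitz :: "real \<Rightarrow> real \<Rightarrow> (real \<Rightarrow> real) \<Rightarrow> bool" where
  "exp_lipschitz b C \<Psi> \<longleftrightarrow> (\<forall>x\<le>0. \<Psi> x = 0) \<and>
     (\<forall>x y. 0 \<le> x \<longrightarrow> x \<le> y \<longrightarrow> \<bar>\<Psi> y - \<Psi> x\<bar> \<le> C * exp (b * y) * (y - x))"

lemma exp_lipschitz_zero: "exp_lipschitz b C \<Psi> \<Longrightarrow> x \<le> 0 \<Longrightarrow> \<Psi> x = 0"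
  by (simp add: exp_lipschitz_def)

lemma exp_lipschitz_le:
  "exp_lipschitz b C \<Psi> \<Longrightarrow> 0 \<le> x \<Longrightarrow> x \<le> y \<Longrightarrow> \<bar>\<Psi> y - \<Psi> x\<bar> \<le> C * exp (b * y) * (y - x)"
  by (simp add: exp_lipschitz_def)

lemma exp_lipschitz_abs_le:
  assumes "exp_lipschitz b C \<Psi>" "0 \<le> x"
  shows "\<bar>\<Psi> x\<bar> \<le> C * exp (b * x) * x"
  using exp_lipschitz_le[OF assms(1), of 0 x] exp_lipschitz_zero[OF assms(1), of 0] assms by simp

lemma exp_lipschitz_diff:
  assumes "exp_lipschitz b C \<Psi>" "exp_lipschitz b C' \<Phi>"
  shows "exp_lipschitz b (C + C') (\<lambda>x. \<Psi> x - \<Phi> x)"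
  unfolding exp_lipschitz_def
proof (intro conjI allI impI)
  fix x y :: real assume "0 \<le> x" "x \<le> y"
  then have "\<bar>\<Psi> y - \<Psi> x\<bar> \<le> C * exp (b * y) * (y - x)" "\<bar>\<Phi> y - \<Phi> x\<bar> \<le> C' * exp (b * y) * (y - x)"
    using assms by (auto intro: exp_lipschitz_le)
  then have "\<bar>(\<Psi> y - \<Phi> y) - (\<Psi> x - \<Phi> x)\<bar> \<le> C * exp (b * y) * (y - x) + C' * exp (b * y) * (y - x)" by linarith
  then show "\<bar>(\<Psi> y - \<Phi> y) - (\<Psi> x - \<Phi> x)\<bar> \<le> (C + C') * exp (b * y) * (y - x)" by (simp add: algebra_simps)
qed (use assms in \<open>simp add: exp_lipschitz_zero\<close>)

lemma exp_lipschitz_measurable: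
  assumes L: "exp_lipschitz b C \<Psi>" and b: "0 \<le> b" and C: "0 \<le> C"
  shows "\<Psi> \<in> borel_measurable borel"
proof -
  have "continuous_on {0..} \<Psi>"
    unfolding continuous_on_def
  proof
    fix x :: real assume x: "x \<in> {0..}"
    define K where "K = C * exp (b * (x + 1))"
    have bound: "\<bar>\<Psi> y - \<Psi> x\<bar> \<le> K * \<bar>y - x\<bar>" if "y \<in> {0..}" "\<bar>y - x\<bar> < 1" for y
    proof (cases "x \<le> y")
      case True
      have "\<bar>\<Psi> y - \<Psi> x\<bar> \<le> C * exp (b * y) * (y - x)" using L x True by (intro exp_lipschitz_le) auto
      also have "\<dots> \<le> K * (y - x)" unfolding K_def
        using that b C True by (intro mult_right_mono mult_left_mono) (auto intro!: mult_left_mono)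
      finally show ?thesis using True by simp
    next
      case False
      have "\<bar>\<Psi> x - \<Psi> y\<bar> \<le> C * exp (b * x) * (x - y)" using L that False by (intro exp_lipschitz_le) auto
      also have "\<dots> \<le> K * (x - y)" unfolding K_def
        using that b C False by (intro mult_right_mono mult_left_mono) (auto intro!: mult_left_mono)
      finally show ?thesis using False by (simp add: abs_minus_commute)
    qed
    have "((\<lambda>y. \<Psi> y - \<Psi> x) \<longlongrightarrow> 0) (at x within {0..})"
    proof (rule Lim_null_comparison)
      have "\<forall>\<^sub>F y in at x within {0..}. y \<in> {0..} \<and> \<bar>y - x\<bar> < 1"
        unfolding eventually_at by (rule exI[of _ 1]) (auto simp: dist_real_def)
      then show "\<forall>\<^sub>F y in at x within {0..}. norm (\<Psi> y - \<Psi> x) \<le> K * \<bar>y - x\<bar>"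
        by eventually_elim (use bound in auto)
      have "((\<lambda>y. K * \<bar>y - x\<bar>) \<longlongrightarrow> K * \<bar>x - x\<bar>) (at x within {0..})" by (intro tendsto_intros)
      then show "((\<lambda>y. K * \<bar>y - x\<bar>) \<longlongrightarrow> 0) (at x within {0..})" by simp
    qed
    then show "(\<Psi> \<longlongrightarrow> \<Psi> x) (at x within {0..})" by (simp add: LIM_zero_iff)
  qed
  then have "(\<lambda>x. indicator {0..} x *\<^sub>R \<Psi> x) \<in> borel_measurable borel"
    by (rule borel_measurable_continuous_on_indicator[rotated]) simp
  moreover have "(\<lambda>x. indicator {0..} x *\<^sub>R \<Psi> x) = \<Psi>"
    using exp_lipschitz_zero[OF L] by (auto simp: indicator_def fun_eq_iff)
  ultimately show ?thesis by simp
qed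

lemma has_derivative_cmult_exp:
  "((\<lambda>r. c * exp (d * r)) has_real_derivative c * d * exp (d * x)) (at x)" for c d :: real
  by (auto intro!: derivative_eq_intros)

lemma expo_exp_moment:
  assumes b: "0 \<le> b" "b < 1"
  shows "integrable expo (\<lambda>p. exp (b * max 0 p) - 1)" "(\<integral>p. exp (b * max 0 p) - 1 \<partial>expo) = b / (1 - b)"
proof -
  have "(\<integral>\<^sup>+r. ennreal (b * exp (b * max 0 r) * exp (- r)) * indicator {0..} r \<partial>lborel)
      = (\<integral>\<^sup>+r. ennreal (b * exp ((b - 1) * r)) * indicator {0..} r \<partial>lborel)"
    by (intro nn_integral_cong) (auto simp: indicator_def mult_exp_exp algebra_simps)
  also have "\<dots> = ennreal (0 - (- b / (1 - b) * exp ((b - 1) * 0)))"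
  proof (rule nn_integral_FTC_atLeast)
    fix x :: real
    show "((\<lambda>r. - b / (1 - b) * exp ((b - 1) * r)) has_real_derivative b * exp ((b - 1) * x)) (at x)"
    proof -
      have "- b * (b - 1) = b * (1 - b)" by (simp add: algebra_simps)
      then have "- b / (1 - b) * (b - 1) = b" unfolding times_divide_eq_left using b by simp
      moreover have "((\<lambda>r. - b / (1 - b) * exp ((b - 1) * r)) has_real_derivative (- b / (1 - b) * (b - 1)) * exp ((b - 1) * x)) (at x)"
        by (rule has_derivative_cmult_exp)
      ultimately show ?thesis by simp
    qed
    have "((\<lambda>r. - b / (1 - b) * exp ((b - 1) * r)) \<longlongrightarrow> - b / (1 - b) * 0) at_top"
      using b by (intro tendsto_mult tendsto_const) real_asymp
    then show "((\<lambda>r. - b / (1 - b) * exp ((b - 1) * r)) \<longlongrightarrow> 0) at_top" by simp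
  qed (use b in auto)
  finally have T: "(\<integral>\<^sup>+r. ennreal (b * exp (b * max 0 r) * exp (- r)) * indicator {0..} r \<partial>lborel) = ennreal (b / (1 - b))"
    by simp
  have I: "((\<lambda>r. b * exp (b * max 0 r)) has_integral exp (b * max 0 p) - 1) {0..p}" if "0 < p" for p
  proof -
    have "((\<lambda>r. b * exp (b * r)) has_integral exp (b * p) - exp (b * 0)) {0..p}"
      by (rule fundamental_theorem_of_calculus)
         (use that in \<open>auto intro!: derivative_eq_intros simp flip: has_real_derivative_iff_has_vector_derivative\<close>)
    then have "((\<lambda>r. b * exp (b * r)) has_integral exp (b * p) - 1) {0..p}" by simp
    moreover have "max 0 p = p" using that by simp
    ultimately show ?thesis by (simp only:) (erule has_integral_eq[rotated], simp)
  qed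
  have m: "(\<lambda>r. b * exp (b * max 0 r)) \<in> borel_measurable borel" "(\<lambda>p. exp (b * max 0 p) - 1) \<in> borel_measurable borel"
    by measurable
  have n: "0 \<le> b * exp (b * max 0 r)" "p \<le> 0 \<Longrightarrow> exp (b * max 0 p) - 1 = 0" "0 \<le> b / (1 - b)" for p r :: real
    using b by (auto simp: max_absorb1)
  show "integrable expo (\<lambda>p. exp (b * max 0 p) - 1)" "(\<integral>p. exp (b * max 0 p) - 1 \<partial>expo) = b / (1 - b)"
    by (rule expo_mean[OF m n(1) I n(2) T n(3)]; assumption)+
qed

lemma exp_lipschitz_square_integrable:
  assumes L: "exp_lipschitz b C \<Psi>" and b: "0 \<le> b" "b < 1/2" and C: "0 \<le> C"
  shows "integrable expo (\<lambda>p. (\<Psi> p)\<^sup>2)"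
proof -
  interpret E: prob_space expo by (rule prob_space_expo)
  define e where "e = (1 - 2 * b) / 4"
  define b' where "b' = 2 * (b + e)"
  have e: "e > 0" and b': "0 \<le> b'" "b' < 1" using b by (auto simp: e_def b'_def field_simps)
  have "integrable expo (\<lambda>p. (C / e)\<^sup>2 * ((exp (b' * max 0 p) - 1) + 1))"
    by (intro integrable_mult_right Bochner_Integration.integrable_add expo_exp_moment b') auto
  then show ?thesis
  proof (rule Bochner_Integration.integrable_bound)
    show "(\<lambda>p. (\<Psi> p)\<^sup>2) \<in> borel_measurable expo"
      using exp_lipschitz_measurable[OF L b(1) C] by measurable
    show "AE p in expo. norm ((\<Psi> p)\<^sup>2) \<le> norm ((C / e)\<^sup>2 * ((exp (b' * max 0 p) - 1) + 1))"
      using AE_expo_pos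
    proof eventually_elim
      case (elim p)
      have "e * p \<le> exp (e * p)" using exp_ge_add_one_self[of "e * p"] by linarith
      then have "p \<le> exp (e * p) / e" using e by (simp add: field_simps)
      then have "C * exp (b * p) * p \<le> C * exp (b * p) * (exp (e * p) / e)" using C by (intro mult_left_mono) auto
      also have "\<dots> = C / e * exp ((b + e) * p)" by (simp add: mult_exp_exp algebra_simps)
      finally have "\<bar>\<Psi> p\<bar> \<le> C / e * exp ((b + e) * p)" using exp_lipschitz_abs_le[OF L, of p] elim by simp
      then have "(\<Psi> p)\<^sup>2 \<le> (C / e * exp ((b + e) * p))\<^sup>2" by (metis abs_ge_zero power2_abs power_mono)
      also have "\<dots> = (C / e)\<^sup>2 * exp (b' * p)"
        by (simp add: power_mult_distrib exp_double[symmetric] b'_def power2_eq_square mult_exp_exp algebra_simps)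
      finally show ?case using elim by simp
    qed
  qed
qed

text \<open>The integrand of \<open>gint a r \<gamma>\<close> after the substitution \<open>v = zeta \<gamma> x\<close>,
  under which \<open>1 + \<gamma>v = exp(\<gamma>x)\<close>.\<close>

definition zker :: "real \<Rightarrow> nat \<Rightarrow> nat \<Rightarrow> real \<Rightarrow> real" where
  "zker \<gamma> a r x = zeta \<gamma> x ^ a * exp (\<gamma> * x) / exp (\<gamma> * x) ^ r"

text \<open>The kernel integral on the log scale, extended by zero to negative arguments so that values below the
  threshold do not contribute.\<close>

definition zint :: "real \<Rightarrow> nat \<Rightarrow> nat \<Rightarrow> real \<Rightarrow> real" where
  "zint \<gamma> a r p = gint a r \<gamma> (zeta \<gamma> (max 0 p))"

lemma zker_nonneg: "0 \<le> x \<Longrightarrow> 0 \<le> zker \<gamma> a r x"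
  by (simp add: zker_def zeta_nonneg)

lemma continuous_zeta [continuous_intros]: "continuous_on S (zeta \<gamma>)"
  using zeta_has_derivative by (intro continuous_at_imp_continuous_on ballI DERIV_isCont) blast

lemma continuous_zker: "continuous_on S (zker \<gamma> a r)"
  unfolding zker_def by (intro continuous_intros) auto

lemma zker_measurable: "(\<lambda>x. zker \<gamma> a r (max 0 x)) \<in> borel_measurable borel"
  by (intro borel_measurable_continuous_onI continuous_on_compose2[OF continuous_zker[of UNIV]] continuous_intros) auto

lemma zint_0: "p \<le> 0 \<Longrightarrow> zint \<gamma> a r p = 0"
  by (simp add: zint_def max_absorb1)

lemma zint_has_derivative:
  assumes "0 \<le> x" "x \<le> y"
  shows "(zint \<gamma> a r has_real_derivative zker \<gamma> a r x) (at x within {0..y})"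
proof -
  have p: "1 + \<gamma> * zeta \<gamma> y > 0" by (simp add: one_plus_zeta)
  have m: "zeta \<gamma> u \<le> zeta \<gamma> v" if "u \<le> v" for u v
    using strict_mono_less_eq[OF zeta_strict_mono] that by blast
  have "((\<lambda>z. gint a r \<gamma> z) has_real_derivative zeta \<gamma> x ^ a / (1 + \<gamma> * zeta \<gamma> x) ^ r) (at (zeta \<gamma> x) within zeta \<gamma> ` {0..y})"
    by (rule DERIV_subset[OF gint_has_derivative_upper[OF p]]) (use assms m zeta_nonneg in auto)
  from DERIV_image_chain[OF this has_field_derivative_at_within[OF zeta_has_derivative]]
  have "(gint a r \<gamma> \<circ> zeta \<gamma> has_real_derivative zeta \<gamma> x ^ a / (1 + \<gamma> * zeta \<gamma> x) ^ r * exp (\<gamma> * x)) (at x within {0..y})" .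
  then have "(gint a r \<gamma> \<circ> zeta \<gamma> has_real_derivative zker \<gamma> a r x) (at x within {0..y})"
    by (simp add: zker_def one_plus_zeta)
  then show ?thesis
    by (rule has_field_derivative_transform_within[of _ _ _ _ 1]) (use assms in \<open>auto simp: zint_def\<close>)
qed

lemma zint_has_integral:
  assumes "0 \<le> p"
  shows "((\<lambda>x. zker \<gamma> a r (max 0 x)) has_integral zint \<gamma> a r p) {0..p}"
proof -
  have "(zker \<gamma> a r has_integral zint \<gamma> a r p - zint \<gamma> a r 0) {0..p}"
    by (rule fundamental_theorem_of_calculus[OF assms])
       (use zint_has_derivative in \<open>auto simp flip: has_real_derivative_iff_has_vector_derivative\<close>)
  then have "(zker \<gamma> a r has_integral zint \<gamma> a r p) {0..p}" by (simp add: zint_0)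
  then show ?thesis by (rule has_integral_eq[rotated]) simp
qed

lemma zint_exp_lipschitz:
  assumes "\<And>x. 0 \<le> x \<Longrightarrow> zker \<gamma> a r x \<le> C * exp (b * x)" "0 \<le> b" "0 \<le> C"
  shows "exp_lipschitz b C (zint \<gamma> a r)"
  unfolding exp_lipschitz_def
proof (intro conjI allI impI)
  fix x y :: real assume xy: "0 \<le> x" "x \<le> y"
  have "norm (zint \<gamma> a r y - zint \<gamma> a r x) \<le> C * exp (b * y) * norm (y - x)"
  proof (rule field_differentiable_bound[of "{x..y}"])
    fix u assume u: "u \<in> {x..y}"
    show "(zint \<gamma> a r has_real_derivative zker \<gamma> a r u) (at u within {x..y})"
      by (rule DERIV_subset[OF zint_has_derivative[of u y]]) (use xy u in auto)
    have "zker \<gamma> a r u \<le> C * exp (b * u)" using assms xy u by auto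
    also have "\<dots> \<le> C * exp (b * y)" using assms u by (auto intro!: mult_left_mono)
    finally show "norm (zker \<gamma> a r u) \<le> C * exp (b * y)" using zker_nonneg[of u \<gamma> a r] xy u by auto
  qed (use xy in auto)
  then show "\<bar>zint \<gamma> a r y - zint \<gamma> a r x\<bar> \<le> C * exp (b * y) * (y - x)" using xy by simp
qed (simp add: zint_0)

lemma zint_trunc_exp_lipschitz:
  assumes k: "0 \<le> \<kappa>" and b: "0 \<le> b"
  shows "\<exists>C\<ge>0. exp_lipschitz b C (\<lambda>p. zint \<gamma> a r (min p \<kappa>))"
proof -
  have "{0..\<kappa>} \<noteq> {}" using k by simp
  from continuous_attains_sup[OF compact_Icc this continuous_zker[of "{0..\<kappa>}" \<gamma> a r]]
  obtain B where B: "\<And>x. x \<in> {0..\<kappa>} \<Longrightarrow> zker \<gamma> a r x \<le> B" by blast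
  define C where "C = max B 0"
  have "exp_lipschitz b C (\<lambda>p. zint \<gamma> a r (min p \<kappa>))"
    unfolding exp_lipschitz_def
  proof (intro conjI allI impI)
    fix x y :: real assume xy: "0 \<le> x" "x \<le> y"
    let ?x = "min x \<kappa>" and ?y = "min y \<kappa>"
    have "norm (zint \<gamma> a r ?y - zint \<gamma> a r ?x) \<le> C * norm (?y - ?x)"
    proof (rule field_differentiable_bound[of "{?x..?y}"])
      fix u assume u: "u \<in> {?x..?y}"
      show "(zint \<gamma> a r has_real_derivative zker \<gamma> a r u) (at u within {?x..?y})"
        by (rule DERIV_subset[OF zint_has_derivative[of u ?y]]) (use xy u k in auto)
      have "0 \<le> u" "u \<le> \<kappa>" using u xy k by auto
      then show "norm (zker \<gamma> a r u) \<le> C" using B[of u] zker_nonneg[of u \<gamma> a r] by (auto simp: C_def)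
    qed (use xy in auto)
    also have "\<dots> \<le> C * (y - x)" using xy by (intro mult_left_mono) (auto simp: C_def)
    also have "\<dots> \<le> C * exp (b * y) * (y - x)"
    proof (intro mult_right_mono)
      have "C * 1 \<le> C * exp (b * y)" using b xy by (intro mult_left_mono) (auto simp: C_def)
      then show "C \<le> C * exp (b * y)" by simp
    qed (use xy in auto)
    finally show "\<bar>zint \<gamma> a r ?y - zint \<gamma> a r ?x\<bar> \<le> C * exp (b * y) * (y - x)" by simp
  qed (simp add: zint_0)
  then show ?thesis by (intro exI[of _ C]) (auto simp: C_def)
qed

lemma zeta_le: "0 \<le> x \<Longrightarrow> zeta \<gamma> x \<le> x * exp (max \<gamma> 0 * x)"
proof (cases "x = 0")
  case False
  assume "0 \<le> x"
  then have x: "0 < x" using False by simp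
  obtain \<xi> where \<xi>: "0 < \<xi>" "\<xi> < x" "zeta \<gamma> x - zeta \<gamma> 0 = (x - 0) * exp (\<gamma> * \<xi>)"
    using MVT2[OF x, of "zeta \<gamma>" "\<lambda>x. exp (\<gamma> * x)"] zeta_has_derivative by auto
  have "\<gamma> * \<xi> \<le> max \<gamma> 0 * \<xi>" using \<xi> by (intro mult_right_mono) auto
  also have "\<dots> \<le> max \<gamma> 0 * x" using \<xi> by (intro mult_left_mono) auto
  finally show ?thesis using \<xi> x by simp
qed simp

lemma zeta_exp_tendsto_0:
  assumes c: "real a * max \<gamma> 0 < c" and a: "a \<in> {1, 2}"
  shows "((\<lambda>x. zeta \<gamma> x ^ a * exp (- c * x)) \<longlongrightarrow> 0) at_top"
proof (rule Lim_null_comparison)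
  define d where "d = c - real a * max \<gamma> 0"
  have d: "d > 0" using c by (simp add: d_def)
  show "\<forall>\<^sub>F x in at_top. norm (zeta \<gamma> x ^ a * exp (- c * x)) \<le> x ^ a * exp (- d * x)"
    using eventually_ge_at_top[of 0]
  proof eventually_elim
    case (elim x)
    have "zeta \<gamma> x ^ a * exp (- c * x) \<le> (x * exp (max \<gamma> 0 * x)) ^ a * exp (- c * x)"
      using zeta_le[OF elim] zeta_nonneg[OF elim] by (intro mult_right_mono power_mono) auto
    also have "\<dots> = x ^ a * exp (- d * x)"
      by (simp add: power_mult_distrib exp_of_nat_mult[symmetric] mult_exp_exp d_def algebra_simps)
    finally show ?case using zeta_nonneg[OF elim, of \<gamma>] by simp
  qed
  show "((\<lambda>x. x ^ a * exp (- d * x)) \<longlongrightarrow> 0) at_top"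
    using a d by (elim insertE emptyE; simp only:; real_asymp)
qed

text \<open>The pairs with their means are listed as triples, so that lemmas about all means can be stated once.\<close>

definition gmeans :: "real \<Rightarrow> (nat \<times> nat \<times> real) set" where
  "gmeans \<gamma> = {(0, 1, 1), (0, 2, 1 / (1 + \<gamma>)), (1, 2, 1 / (1 + \<gamma>)),
     (1, 3, 1 / ((1 + \<gamma>) * (1 + 2 * \<gamma>))), (2, 3, 2 / ((1 + \<gamma>) * (1 + 2 * \<gamma>)))}"

lemma zeta_exp_has_derivative:
  "((\<lambda>x. zeta \<gamma> x * exp (- c * x)) has_real_derivative exp (- (c - \<gamma>) * x) - c * (zeta \<gamma> x * exp (- c * x))) (at x)"
  "((\<lambda>x. zeta \<gamma> x ^ 2 * exp (- c * x)) has_real_derivative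
     2 * (zeta \<gamma> x * exp (- (c - \<gamma>) * x)) - c * (zeta \<gamma> x ^ 2 * exp (- c * x))) (at x)"
proof -
  have e: "exp (- (c - \<gamma>) * x) = exp (\<gamma> * x) * exp (- c * x)" by (simp add: mult_exp_exp algebra_simps)
  have E: "((\<lambda>x. exp (- c * x)) has_real_derivative - c * exp (- c * x)) (at x)"
    using has_derivative_cmult_exp[of 1 "- c" x] by simp
  show "((\<lambda>x. zeta \<gamma> x * exp (- c * x)) has_real_derivative exp (- (c - \<gamma>) * x) - c * (zeta \<gamma> x * exp (- c * x))) (at x)"
    unfolding e by (rule DERIV_cong[OF DERIV_mult[OF zeta_has_derivative E]]) (simp add: algebra_simps)
  have "((\<lambda>x. zeta \<gamma> x ^ 2) has_real_derivative 2 * zeta \<gamma> x * exp (\<gamma> * x)) (at x)"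
    by (rule DERIV_cong[OF DERIV_power[OF zeta_has_derivative]]) simp
  from DERIV_mult[OF this E]
  show "((\<lambda>x. zeta \<gamma> x ^ 2 * exp (- c * x)) has_real_derivative
     2 * (zeta \<gamma> x * exp (- (c - \<gamma>) * x)) - c * (zeta \<gamma> x ^ 2 * exp (- c * x))) (at x)"
    unfolding e by (rule DERIV_cong) (simp add: algebra_simps)
qed

lemma zker_exp: "zker \<gamma> a r x * exp (- x) = zeta \<gamma> x ^ a * exp (- (1 + (real r - 1) * \<gamma>) * x)"
proof -
  have "exp (- (1 + (real r - 1) * \<gamma>) * x) = exp (\<gamma> * x - real r * (\<gamma> * x) - x)" by (simp add: algebra_simps)
  also have "\<dots> = exp (\<gamma> * x) / exp (real r * (\<gamma> * x)) * exp (- x)" by (simp add: exp_diff exp_minus divide_inverse)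
  also have "exp (real r * (\<gamma> * x)) = exp (\<gamma> * x) ^ r" by (rule exp_of_nat_mult)
  finally show ?thesis by (simp add: zker_def)
qed

text \<open>All means have elementary antiderivatives, built from \<open>zeta\<^sup>a\<close> times exponentials; they
  vanish at infinity because \<open>\<gamma> > -1/2\<close>.\<close>

lemma zker_antiderivative:
  assumes \<gamma>: "\<gamma> > -1/2" and aT: "(a, r, T) \<in> gmeans \<gamma>"
  shows "\<exists>R. (\<forall>x. (R has_real_derivative zker \<gamma> a r x * exp (- x)) (at x)) \<and> (R \<longlongrightarrow> 0) at_top \<and> R 0 = - T"
proof -
  have g: "1 + \<gamma> \<noteq> 0" "1 + 2 * \<gamma> \<noteq> 0" using \<gamma> by auto
  have c: "real 1 * max \<gamma> 0 < 1 + \<gamma>" "real 1 * max \<gamma> 0 < 1 + 2 * \<gamma>" "real 2 * max \<gamma> 0 < 1 + 2 * \<gamma>" using \<gamma> by auto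
  have lim: "((\<lambda>x. exp (- c * x)) \<longlongrightarrow> 0) at_top" if "c > 0" for c :: real using that by real_asymp
  have lims: "((\<lambda>x. exp (- 1 * x)) \<longlongrightarrow> (0 :: real)) at_top" "((\<lambda>x. exp (- (1 + \<gamma>) * x)) \<longlongrightarrow> 0) at_top"
    using lim[of 1] lim[of "1 + \<gamma>"] \<gamma> by auto
  have Z: "((\<lambda>x. zeta \<gamma> x * exp (- (1 + \<gamma>) * x)) \<longlongrightarrow> 0) at_top"
     "((\<lambda>x. zeta \<gamma> x * exp (- (1 + 2 * \<gamma>) * x)) \<longlongrightarrow> 0) at_top"
     "((\<lambda>x. zeta \<gamma> x ^ 2 * exp (- (1 + 2 * \<gamma>) * x)) \<longlongrightarrow> 0) at_top"
    using zeta_exp_tendsto_0[OF c(1)] zeta_exp_tendsto_0[OF c(2)] zeta_exp_tendsto_0[OF c(3)] by simp_all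
  have E: "((\<lambda>x. exp (- c * x)) has_real_derivative - c * exp (- c * x)) (at x)" for c x :: real
    using has_derivative_cmult_exp[of 1 "- c" x] by simp
  note ZD = zeta_exp_has_derivative[of \<gamma>]
  have arith: "1 + \<gamma> - \<gamma> = 1" "1 + 2 * \<gamma> - \<gamma> = 1 + \<gamma>" by auto
  consider "(a, r, T) = (0, 1, 1)" | "(a, r, T) = (0, 2, 1 / (1 + \<gamma>))" | "(a, r, T) = (1, 2, 1 / (1 + \<gamma>))"
    | "(a, r, T) = (1, 3, 1 / ((1 + \<gamma>) * (1 + 2 * \<gamma>)))" | "(a, r, T) = (2, 3, 2 / ((1 + \<gamma>) * (1 + 2 * \<gamma>)))"
    using aT unfolding gmeans_def by blast
  then show ?thesis
  proof cases
    case 1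
    let ?R = "\<lambda>x :: real. - 1 * exp (- 1 * x)"
    have "(?R has_real_derivative zker \<gamma> 0 1 x * exp (- x)) (at x)" for x
      unfolding zker_exp by (rule DERIV_cong[OF DERIV_cmult[OF E]]) simp
    moreover have "(?R \<longlongrightarrow> 0) at_top" using tendsto_mult[OF tendsto_const lims(1), of "- 1"] by simp
    ultimately show ?thesis using 1 by (intro exI[of _ ?R]) auto
  next
    case 2
    let ?R = "\<lambda>x. - 1 / (1 + \<gamma>) * exp (- (1 + \<gamma>) * x)"
    have "(?R has_real_derivative zker \<gamma> 0 2 x * exp (- x)) (at x)" for x
      unfolding zker_exp
    proof (rule DERIV_cong[OF DERIV_cmult[OF E]])
      have k: "- 1 / (1 + \<gamma>) * (- (1 + \<gamma>) * y) = y" for y using g by (simp add: divide_simps) (simp add: algebra_simps)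
      show "- 1 / (1 + \<gamma>) * (- (1 + \<gamma>) * exp (- (1 + \<gamma>) * x)) = zeta \<gamma> x ^ 0 * exp (- (1 + (real 2 - 1) * \<gamma>) * x)"
        unfolding k by simp
    qed
    moreover have "(?R \<longlongrightarrow> 0) at_top" using tendsto_mult[OF tendsto_const lims(2), of "- 1 / (1 + \<gamma>)"] by simp
    ultimately show ?thesis using 2 by (intro exI[of _ ?R]) auto
  next
    case 3
    let ?R = "\<lambda>x. - 1 / (1 + \<gamma>) * (zeta \<gamma> x * exp (- (1 + \<gamma>) * x) + exp (- 1 * x))"
    have "(?R has_real_derivative zker \<gamma> 1 2 x * exp (- x)) (at x)" for x
      unfolding zker_exp
      by (rule DERIV_cong[OF DERIV_cmult[OF DERIV_add[OF ZD(1) E]]]) (use g in \<open>simp add: divide_simps\<close>)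
    moreover have "(?R \<longlongrightarrow> 0) at_top"
      using tendsto_mult[OF tendsto_const tendsto_add[OF Z(1) lims(1)], of "- 1 / (1 + \<gamma>)"] by simp
    ultimately show ?thesis using 3 by (intro exI[of _ ?R]) auto
  next
    case 4
    let ?R = "\<lambda>x. - 1 / (1 + 2 * \<gamma>) * (zeta \<gamma> x * exp (- (1 + 2 * \<gamma>) * x) + 1 / (1 + \<gamma>) * exp (- (1 + \<gamma>) * x))"
    have "(?R has_real_derivative zker \<gamma> 1 3 x * exp (- x)) (at x)" for x
      unfolding zker_exp
    proof (rule DERIV_cong[OF DERIV_cmult[OF DERIV_add[OF ZD(1) DERIV_cmult[OF E]]]])
      have k: "1 / (1 + \<gamma>) * (- (1 + \<gamma>) * y) = - y" for y
        using g by (simp add: divide_simps) (simp add: algebra_simps)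
      show "- 1 / (1 + 2 * \<gamma>) * (exp (- (1 + 2 * \<gamma> - \<gamma>) * x) - (1 + 2 * \<gamma>) * (zeta \<gamma> x * exp (- (1 + 2 * \<gamma>) * x))
          + 1 / (1 + \<gamma>) * (- (1 + \<gamma>) * exp (- (1 + \<gamma>) * x))) = zeta \<gamma> x ^ 1 * exp (- (1 + (real 3 - 1) * \<gamma>) * x)"
        unfolding k arith using g by simp
    qed
    moreover have "(?R \<longlongrightarrow> 0) at_top"
      using tendsto_mult[OF tendsto_const tendsto_add[OF Z(2) tendsto_mult[OF tendsto_const lims(2)]], of "- 1 / (1 + 2 * \<gamma>)" "1 / (1 + \<gamma>)"] by simp
    ultimately show ?thesis using 4 by (intro exI[of _ ?R]) (auto simp: mult.commute)
  next
    case 5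
    let ?R = "\<lambda>x. - 1 / (1 + 2 * \<gamma>) * (zeta \<gamma> x ^ 2 * exp (- (1 + 2 * \<gamma>) * x)
        + 2 / (1 + \<gamma>) * (zeta \<gamma> x * exp (- (1 + \<gamma>) * x) + exp (- 1 * x)))"
    have "(?R has_real_derivative zker \<gamma> 2 3 x * exp (- x)) (at x)" for x
      unfolding zker_exp
    proof (rule DERIV_cong[OF DERIV_cmult[OF DERIV_add[OF ZD(2) DERIV_cmult[OF DERIV_add[OF ZD(1) E]]]]])
      have k: "2 / (1 + \<gamma>) * (y - (1 + \<gamma>) * w + - 1 * y) = - 2 * w" for y w using g by (simp add: divide_simps)
      show "- 1 / (1 + 2 * \<gamma>) * (2 * (zeta \<gamma> x * exp (- (1 + 2 * \<gamma> - \<gamma>) * x)) - (1 + 2 * \<gamma>) * (zeta \<gamma> x ^ 2 * exp (- (1 + 2 * \<gamma>) * x))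
          + 2 / (1 + \<gamma>) * (exp (- (1 + \<gamma> - \<gamma>) * x) - (1 + \<gamma>) * (zeta \<gamma> x * exp (- (1 + \<gamma>) * x)) + - 1 * exp (- 1 * x)))
          = zeta \<gamma> x ^ 2 * exp (- (1 + (real 3 - 1) * \<gamma>) * x)"
        unfolding arith k using g by simp
    qed
    moreover have "(?R \<longlongrightarrow> 0) at_top"
      using tendsto_mult[OF tendsto_const tendsto_add[OF Z(3) tendsto_mult[OF tendsto_const tendsto_add[OF Z(1) lims(1)]]], of "- 1 / (1 + 2 * \<gamma>)" "2 / (1 + \<gamma>)"] by simp
    ultimately show ?thesis using 5 by (intro exI[of _ ?R]) (auto simp: mult.commute)
  qed
qed

lemma zint_measurable: "zint \<gamma> a r \<in> borel_measurable borel"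
proof -
  have "continuous_on {0..} (zint \<gamma> a r)"
    unfolding continuous_on_eq_continuous_within
  proof
    fix x :: real assume x: "x \<in> {0..}"
    have "continuous (at x within {0..x + 1}) (zint \<gamma> a r)"
      using DERIV_continuous[OF zint_has_derivative[of x "x + 1"]] x by simp
    moreover have "at x within {0..} = at x within {0..x + 1}"
      by (rule at_within_nhd[of _ "{..<x + 1}"]) auto
    ultimately show "continuous (at x within {0..}) (zint \<gamma> a r)" by simp
  qed
  then have "(\<lambda>x. indicator {0..} x *\<^sub>R zint \<gamma> a r x) \<in> borel_measurable borel"
    by (rule borel_measurable_continuous_on_indicator[rotated]) simp
  moreover have "(\<lambda>x. indicator {0..} x *\<^sub>R zint \<gamma> a r x) = zint \<gamma> a r"
    using zint_0 by (auto simp: indicator_def fun_eq_iff)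
  ultimately show ?thesis by simp
qed

lemma zint_mean:
  assumes \<gamma>: "\<gamma> > -1/2" and aT: "(a, r, T) \<in> gmeans \<gamma>"
  shows "integrable expo (zint \<gamma> a r)" "(\<integral>p. zint \<gamma> a r p \<partial>expo) = T"
proof -
  obtain R where R: "\<And>x. (R has_real_derivative zker \<gamma> a r x * exp (- x)) (at x)" "(R \<longlongrightarrow> 0) at_top" "R 0 = - T"
    using zker_antiderivative[OF assms] by blast
  have T0: "0 \<le> T" using aT \<gamma> by (auto simp: gmeans_def)
  have zm: "zker \<gamma> a r \<in> borel_measurable borel" by (rule borel_measurable_continuous_onI[OF continuous_zker])
  have "(\<integral>\<^sup>+x. ennreal (zker \<gamma> a r (max 0 x) * exp (- x)) * indicator {0..} x \<partial>lborel)
      = (\<integral>\<^sup>+x. ennreal (zker \<gamma> a r x * exp (- x)) * indicator {0..} x \<partial>lborel)"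
    by (intro nn_integral_cong) (auto simp: indicator_def)
  also have "\<dots> = ennreal (0 - R 0)"
    by (rule nn_integral_FTC_atLeast) (use R zm zker_nonneg in auto)
  finally have I: "(\<integral>\<^sup>+x. ennreal (zker \<gamma> a r (max 0 x) * exp (- x)) * indicator {0..} x \<partial>lborel) = ennreal T"
    using R by simp
  have n: "0 \<le> zker \<gamma> a r (max 0 x)" for x by (rule zker_nonneg) simp
  have hi: "0 < p \<Longrightarrow> ((\<lambda>x. zker \<gamma> a r (max 0 x)) has_integral zint \<gamma> a r p) {0..p}" for p
    by (rule zint_has_integral) simp
  show "integrable expo (zint \<gamma> a r)" "(\<integral>p. zint \<gamma> a r p \<partial>expo) = T"
    by (rule expo_mean[OF zker_measurable zint_measurable n hi zint_0 I T0]; assumption)+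
qed

text \<open>Monotone convergence; this provides a truncation level at which the truncated means meet the tolerance of the
  deterministic part.\<close>

lemma zint_trunc_mean_tendsto:
  assumes \<gamma>: "\<gamma> > -1/2" and aT: "(a, r, T) \<in> gmeans \<gamma>"
  shows "((\<lambda>n. \<integral>p. zint \<gamma> a r (min p (real n)) \<partial>expo) \<longlongrightarrow> T) sequentially"
proof -
  have m: "zint \<gamma> a r \<in> borel_measurable borel" by (rule zint_measurable)
  have mono: "zint \<gamma> a r x \<le> zint \<gamma> a r y" if "x \<le> y" for x y
  proof -
    have "zeta \<gamma> (max 0 x) \<le> zeta \<gamma> (max 0 y)" using strict_mono_less_eq[OF zeta_strict_mono] that by simp
    then show ?thesis unfolding zint_def
      by (intro gint_mono) (auto simp: one_plus_zeta zeta_nonneg)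
  qed
  have nn: "0 \<le> zint \<gamma> a r x" for x using mono[of "min 0 x" x] zint_0[of "min 0 x"] by simp
  have "((\<lambda>n. \<integral>p. zint \<gamma> a r (min p (real n)) \<partial>expo) \<longlongrightarrow> (\<integral>p. zint \<gamma> a r p \<partial>expo)) sequentially"
  proof (rule integral_dominated_convergence[where w = "zint \<gamma> a r"])
    show "(zint \<gamma> a r) \<in> borel_measurable expo" using m by simp
    show "(\<lambda>p. zint \<gamma> a r (min p (real n))) \<in> borel_measurable expo" for n
      using m by measurable
    show "integrable expo (zint \<gamma> a r)" by (rule zint_mean[OF assms])
    show "AE p in expo. (\<lambda>n. zint \<gamma> a r (min p (real n))) \<longlonglongrightarrow> zint \<gamma> a r p"
    proof (rule AE_I2)
      fix p :: real
      have "\<forall>\<^sub>F n in sequentially. p \<le> real n"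
        using filterlim_real_sequentially by (simp add: filterlim_at_top)
      then have "\<forall>\<^sub>F n in sequentially. zint \<gamma> a r (min p (real n)) = zint \<gamma> a r p"
        by eventually_elim (simp add: min_absorb1)
      then show "(\<lambda>n. zint \<gamma> a r (min p (real n))) \<longlonglongrightarrow> zint \<gamma> a r p" by (rule tendsto_eventually)
    qed
    show "AE p in expo. norm (zint \<gamma> a r (min p (real n))) \<le> zint \<gamma> a r p" for n
      using nn mono by (intro AE_I2) (simp add: abs_of_nonneg)
  qed
  then show ?thesis unfolding zint_mean(2)[OF assms] .
qed

text \<open>For negative \<open>\<gamma>\<close> the kernels grow like \<open>exp(-\<gamma>x)\<close>, and the third one
  has an extra factor of at most \<open>x\<close> that \<open>exp(ex)/e\<close> absorbs.\<close>

lemma zker_bounds: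
  assumes x: "0 \<le> x" and e: "e > 0"
  shows "zker \<gamma> 0 1 x \<le> exp ((max (- \<gamma>) 0 + e) * x)"
    "zker \<gamma> 0 2 x \<le> exp ((max (- \<gamma>) 0 + e) * x)"
    "zker \<gamma> 1 2 x \<le> 1 / e * exp ((max (- \<gamma>) 0 + e) * x)"
proof -
  have "0 \<le> (max (- \<gamma>) 0 + e) * x" using x e by simp
  moreover have "- \<gamma> * x \<le> (max (- \<gamma>) 0 + e) * x" using x e by (intro mult_right_mono) linarith+
  moreover have "zker \<gamma> 0 2 x = exp (- \<gamma> * x)" by (simp add: zker_def power2_eq_square exp_minus field_simps)
  moreover have "zker \<gamma> 0 1 x = 1" by (simp add: zker_def)
  ultimately show "zker \<gamma> 0 1 x \<le> exp ((max (- \<gamma>) 0 + e) * x)" "zker \<gamma> 0 2 x \<le> exp ((max (- \<gamma>) 0 + e) * x)"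
    by auto
  have "e * x \<le> exp (e * x)" using exp_ge_add_one_self[of "e * x"] by linarith
  then have ex: "x \<le> exp (e * x) / e" using e by (simp add: field_simps)
  have "zker \<gamma> 1 2 x = zeta \<gamma> x * exp (- \<gamma> * x)" by (simp add: zker_def power2_eq_square exp_minus field_simps)
  also have "\<dots> \<le> x * exp (max \<gamma> 0 * x) * exp (- \<gamma> * x)" using zeta_le[OF x] by (intro mult_right_mono) auto
  also have "\<dots> = x * exp (max (- \<gamma>) 0 * x)"
  proof -
    have "max \<gamma> 0 * x + - \<gamma> * x = max (- \<gamma>) 0 * x" by (auto simp: max_def)
    then show ?thesis by (simp add: mult.assoc mult_exp_exp)
  qed
  also have "\<dots> \<le> exp (e * x) / e * exp (max (- \<gamma>) 0 * x)" using ex by (intro mult_right_mono) auto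
  also have "\<dots> = 1 / e * exp ((max (- \<gamma>) 0 + e) * x)" by (simp add: mult_exp_exp algebra_simps)
  finally show "zker \<gamma> 1 2 x \<le> 1 / e * exp ((max (- \<gamma>) 0 + e) * x)" .
qed

section \<open>Excesses and exponential order statistics\<close>

lemma exp_lipschitz_mono: "exp_lipschitz b C \<Psi> \<Longrightarrow> C \<le> C' \<Longrightarrow> exp_lipschitz b C' \<Psi>"
  unfolding exp_lipschitz_def
  by (smt (verit, ccfv_SIG) exp_ge_zero mult_right_mono)

lemma gq_has_derivative:
  assumes "1 + \<gamma> * v > 0"
  shows "(gq \<gamma> has_real_derivative 1 / (1 + \<gamma> * v)) (at v)"
  using assms by (cases "\<gamma> = 0") (auto simp: gq_def[abs_def] intro!: derivative_eq_intros)

text \<open>The inverse \<open>gq\<close> of \<open>zeta\<close> has derivative \<open>1/(1 + \<gamma>z) =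
  exp(-\<gamma>q)\<close>, which turns the error exponent \<open>max \<gamma> 0 + e\<close> into \<open>max
  (-\<gamma>) 0 + e\<close>. The smallness condition keeps \<open>1 + \<gamma>z\<close> comparable with
  \<open>exp(\<gamma>q)\<close>.\<close>

lemma log_scale_close:
  fixes \<gamma> e p z h :: real
  defines "b \<equiv> max (- \<gamma>) 0 + e" and "\<beta> \<equiv> max \<gamma> 0 + e" and "q \<equiv> max 0 p"
  assumes e: "e > 0" and z: "0 \<le> z" and d: "\<bar>z - zeta \<gamma> p\<bar> \<le> h * exp (\<beta> * q)" and h: "0 \<le> h"
    and small: "\<bar>\<gamma>\<bar> * h * exp (b * q) \<le> 1/2"
  shows "1 + \<gamma> * z > 0" "\<bar>gq \<gamma> z - q\<bar> \<le> 2 * h * exp (b * q)"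
    "z \<le> 2 * (1 / e + h) * exp (b * q) * (1 + \<gamma> * z)"
proof -
  have q: "0 \<le> q" by (simp add: q_def)
  have \<beta>: "exp (\<beta> * q) = exp (b * q) * exp (\<gamma> * q)"
  proof -
    have "\<beta> * q = b * q + \<gamma> * q" by (auto simp: \<beta>_def b_def max_def algebra_simps)
    then show ?thesis by (simp add: exp_add)
  qed
  define H where "H = h * exp (\<beta> * q)"
  have H: "0 \<le> H" "\<bar>\<gamma>\<bar> * H \<le> exp (\<gamma> * q) / 2"
  proof -
    show "0 \<le> H" using h by (simp add: H_def)
    have "\<bar>\<gamma>\<bar> * H = (\<bar>\<gamma>\<bar> * h * exp (b * q)) * exp (\<gamma> * q)" by (simp add: H_def \<beta>)
    also have "\<dots> \<le> 1/2 * exp (\<gamma> * q)" using small by (intro mult_right_mono) auto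
    finally show "\<bar>\<gamma>\<bar> * H \<le> exp (\<gamma> * q) / 2" by simp
  qed
  have dz: "\<bar>z - zeta \<gamma> q\<bar> \<le> H"
  proof (cases "0 \<le> p")
    case True
    then have "q = p" by (simp add: q_def)
    then show ?thesis using d by (simp add: H_def)
  next
    case False
    then have "zeta \<gamma> p \<le> zeta \<gamma> 0" using strict_mono_less_eq[OF zeta_strict_mono, of \<gamma> p 0] by simp
    moreover have "q = 0" using False by (simp add: q_def)
    ultimately show ?thesis using d z by (simp add: H_def)
  qed
  have pos: "1 + \<gamma> * v \<ge> exp (\<gamma> * q) / 2" if "\<bar>v - zeta \<gamma> q\<bar> \<le> H" for v
  proof -
    have "\<bar>\<gamma> * (v - zeta \<gamma> q)\<bar> \<le> \<bar>\<gamma>\<bar> * H" unfolding abs_mult using that by (intro mult_left_mono) auto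
    moreover have "1 + \<gamma> * v = exp (\<gamma> * q) + \<gamma> * (v - zeta \<gamma> q)"
      using one_plus_zeta[of \<gamma> q] by (simp add: algebra_simps)
    ultimately show ?thesis using H by linarith
  qed
  have eg: "0 < exp (\<gamma> * q)" by simp
  show "1 + \<gamma> * z > 0" using pos[OF dz] eg by linarith
  have "norm (gq \<gamma> z - gq \<gamma> (zeta \<gamma> q)) \<le> 2 / exp (\<gamma> * q) * norm (z - zeta \<gamma> q)"
  proof (rule field_differentiable_bound[of "closed_segment (zeta \<gamma> q) z"])
    fix v assume "v \<in> closed_segment (zeta \<gamma> q) z"
    then have v: "\<bar>v - zeta \<gamma> q\<bar> \<le> H" using dz by (auto simp: closed_segment_eq_real_ivl split: if_splits)
    have p: "1 + \<gamma> * v > 0" using pos[OF v] eg by linarith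
    show "(gq \<gamma> has_real_derivative 1 / (1 + \<gamma> * v)) (at v within closed_segment (zeta \<gamma> q) z)"
      by (rule has_field_derivative_at_within[OF gq_has_derivative[OF p]])
    have "1 / (1 + \<gamma> * v) \<le> 1 / (exp (\<gamma> * q) / 2)" using pos[OF v] eg p by (intro divide_left_mono) auto
    then show "norm (1 / (1 + \<gamma> * v)) \<le> 2 / exp (\<gamma> * q)" using p by simp
  qed auto
  then have "\<bar>gq \<gamma> z - q\<bar> \<le> 2 / exp (\<gamma> * q) * \<bar>z - zeta \<gamma> q\<bar>" by simp
  also have "\<dots> \<le> 2 / exp (\<gamma> * q) * H" using dz by (intro mult_left_mono) auto
  also have "\<dots> = 2 * h * exp (b * q)" by (simp add: H_def \<beta>)
  finally show "\<bar>gq \<gamma> z - q\<bar> \<le> 2 * h * exp (b * q)" .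
  have "e * q \<le> exp (e * q)" using exp_ge_add_one_self[of "e * q"] by linarith
  then have eq: "q \<le> 1 / e * exp (e * q)" using e by (simp add: field_simps)
  have "zeta \<gamma> q \<le> q * exp (max \<gamma> 0 * q)" by (rule zeta_le[OF q])
  also have "\<dots> \<le> 1 / e * exp (e * q) * exp (max \<gamma> 0 * q)" using eq by (intro mult_right_mono) auto
  also have "\<dots> = 1 / e * exp (\<beta> * q)" by (simp add: \<beta>_def mult_exp_exp algebra_simps)
  finally have "z \<le> 1 / e * exp (\<beta> * q) + H" using dz by linarith
  also have "\<dots> = (1 / e + h) * exp (b * q) * exp (\<gamma> * q)" by (simp add: H_def \<beta> algebra_simps)
  also have "\<dots> \<le> (1 / e + h) * exp (b * q) * (2 * (1 + \<gamma> * z))"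
    using pos[OF dz] e h by (intro mult_left_mono) auto
  finally show "z \<le> 2 * (1 / e + h) * exp (b * q) * (1 + \<gamma> * z)" by (simp only: mult_ac)
qed

text \<open>Two errors are added: replacing the excess by its exponential counterpart costs \<open>O(1/\<surd>k)\<close>
  times an average of \<open>exp(2bp)\<close>, and replacing the top \<open>k\<close> values by the positive
  ones costs the deviation of their number from \<open>k\<close>.\<close>

lemma tail_average_close:
  fixes \<gamma> e h K C0 L \<mu> :: real and p z :: "nat \<Rightarrow> real" and n k :: nat
  defines "b \<equiv> max (- \<gamma>) 0 + e" and "\<beta> \<equiv> max \<gamma> 0 + e"
  defines "P \<equiv> (\<lambda>i. order_stat p (n - i + 1) n)"
  assumes e: "e > 0" and kn: "0 < k" "k < n" and h: "0 \<le> h" "h \<le> K / sqrt k"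
    and z: "\<And>i. i \<in> {1..k} \<Longrightarrow> 0 \<le> z i"
    and d: "\<And>i. i \<in> {1..k} \<Longrightarrow> \<bar>z i - zeta \<gamma> (P i)\<bar> \<le> h * exp (\<beta> * max 0 (P i))"
    and small: "\<And>i. i \<in> {1..k} \<Longrightarrow> 2 * (1 + \<bar>\<gamma>\<bar>) * h * exp (b * max 0 (P i)) \<le> 1"
    and L: "exp_lipschitz b C0 \<Psi>" and C0: "0 \<le> C0" and L0: "0 \<le> L"
    and N: "\<bar>real (card {i\<in>{1..n}. 0 < p i}) - real k\<bar> \<le> L * sqrt k"
    and top: "order_stat p (n - k) n \<le> 1"
    and M: "(\<Sum>i=1..n. exp (2 * b * max 0 (p i)) - 1) \<le> L * k"
    and S: "\<bar>(\<Sum>i=1..n. \<Psi> (p i)) - k * \<mu>\<bar> \<le> L * sqrt k"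
  shows "\<bar>avg k (\<lambda>i. \<Psi> (gq \<gamma> (z i))) - \<mu>\<bar> \<le> (2 * K * C0 * exp b * (1 + L) + C0 * exp b * L + L) / sqrt k"
proof -
  have b: "0 \<le> b" using e by (simp add: b_def)
  have sk: "sqrt k > 0" "sqrt k * sqrt k = real k" using kn by auto
  define q where "q = (\<lambda>i. max 0 (P i))"
  have q0: "0 \<le> q i" for i by (simp add: q_def)
  have close: "\<bar>gq \<gamma> (z i) - q i\<bar> \<le> 2 * h * exp (b * q i)" "2 * h * exp (b * q i) \<le> 1" "0 \<le> gq \<gamma> (z i)"
    if i: "i \<in> {1..k}" for i
  proof -
    have x: "0 \<le> h * exp (b * q i)" using h by simp
    have "2 * (1 + \<bar>\<gamma>\<bar>) * h * exp (b * q i) = 2 * (h * exp (b * q i)) + 2 * (\<bar>\<gamma>\<bar> * (h * exp (b * q i)))"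
      by (simp add: algebra_simps)
    moreover have "0 \<le> \<bar>\<gamma>\<bar> * (h * exp (b * q i))" using x by simp
    moreover have "2 * (1 + \<bar>\<gamma>\<bar>) * h * exp (b * q i) \<le> 1" using small[OF i] by (simp only: q_def)
    ultimately have sm: "\<bar>\<gamma>\<bar> * h * exp (b * q i) \<le> 1/2" "2 * h * exp (b * q i) \<le> 1"
      using x unfolding mult.assoc by linarith+
    show "2 * h * exp (b * q i) \<le> 1" by fact
    have sm': "\<bar>\<gamma>\<bar> * h * exp ((max (- \<gamma>) 0 + e) * max 0 (P i)) \<le> 1/2"
      using sm(1) by (simp only: q_def b_def)
    note C = log_scale_close[OF e z[OF i] d[OF i, unfolded \<beta>_def] h(1) sm']
    show "\<bar>gq \<gamma> (z i) - q i\<bar> \<le> 2 * h * exp (b * q i)" unfolding q_def b_def by (rule C(2))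
    have "1 + \<gamma> * z i > 0" by (rule C(1))
    then show "0 \<le> gq \<gamma> (z i)" by (rule gq_nonneg) (rule z[OF i])
  qed
  have \<Psi>q: "\<Psi> (P i) = \<Psi> (q i)" for i using exp_lipschitz_zero[OF L] by (auto simp: q_def max_def)
  have step1: "\<bar>\<Psi> (gq \<gamma> (z i)) - \<Psi> (P i)\<bar> \<le> 2 * h * C0 * exp b * exp (2 * b * q i)" if i: "i \<in> {1..k}" for i
  proof -
    let ?Q = "gq \<gamma> (z i)"
    define m where "m = max ?Q (q i)"
    have "\<bar>\<Psi> ?Q - \<Psi> (q i)\<bar> \<le> C0 * exp (b * m) * \<bar>?Q - q i\<bar>"
    proof (cases "q i \<le> ?Q")
      case True
      then show ?thesis using exp_lipschitz_le[OF L q0 True] by (simp add: m_def max_absorb1)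
    next
      case False
      then show ?thesis using exp_lipschitz_le[OF L close(3)[OF i], of "q i"] by (simp add: m_def max_absorb2 abs_minus_commute)
    qed
    also have "\<dots> \<le> C0 * exp (b * (q i + 1)) * (2 * h * exp (b * q i))"
    proof (intro mult_mono mult_left_mono)
      have "m \<le> q i + 1" using close[OF i] by (auto simp: m_def)
      then show "exp (b * m) \<le> exp (b * (q i + 1))" using b by (simp add: mult_left_mono)
    qed (use close[OF i] C0 in auto)
    also have "\<dots> = 2 * h * C0 * (exp (b * (q i + 1)) * exp (b * q i))" by (simp only: mult_ac)
    also have "exp (b * (q i + 1)) * exp (b * q i) = exp b * exp (2 * b * q i)"
      by (simp add: mult_exp_exp algebra_simps)
    also have "2 * h * C0 * (exp b * exp (2 * b * q i)) = 2 * h * C0 * exp b * exp (2 * b * q i)" by simp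
    finally show ?thesis unfolding \<Psi>q .
  qed
  have sumtop: "(\<Sum>i=1..k. exp (2 * b * q i)) \<le> (1 + L) * k"
  proof -
    have "(\<Sum>i=1..k. exp (2 * b * q i) - 1) \<le> (\<Sum>i=1..n. exp (2 * b * max 0 (p i)) - 1)"
      unfolding q_def P_def
      by (rule sum_top_nonneg_le[where f = "\<lambda>x. exp (2 * b * max 0 x) - 1"]) (use kn b in auto)
    then show ?thesis using M by (simp add: sum_subtractf algebra_simps)
  qed
  have "\<bar>(\<Sum>i=1..k. \<Psi> (gq \<gamma> (z i))) - (\<Sum>i=1..k. \<Psi> (P i))\<bar> \<le> (\<Sum>i=1..k. \<bar>\<Psi> (gq \<gamma> (z i)) - \<Psi> (P i)\<bar>)"
    unfolding sum_subtractf[symmetric] by (rule sum_abs)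
  also have "\<dots> \<le> (\<Sum>i=1..k. 2 * h * C0 * exp b * exp (2 * b * q i))" by (intro sum_mono step1)
  also have "\<dots> = 2 * h * C0 * exp b * (\<Sum>i=1..k. exp (2 * b * q i))" by (simp add: sum_distrib_left)
  also have "\<dots> \<le> 2 * (K / sqrt k) * C0 * exp b * ((1 + L) * k)"
    using h C0 sumtop by (intro mult_mono mult_nonneg_nonneg sum_nonneg) auto
  also have "\<dots> = 2 * C0 * exp b * (1 + L) * (K / sqrt k * k)" by (simp only: mult_ac)
  also have "K / sqrt k * k = K / sqrt k * (sqrt k * sqrt k)" by (simp only: sk(2))
  also have "\<dots> = (K / sqrt k * sqrt k) * sqrt k" by (simp only: mult.assoc)
  also have "K / sqrt k * sqrt k = K" using sk(1) by simp
  also have "2 * C0 * exp b * (1 + L) * (K * sqrt k) = 2 * K * C0 * exp b * (1 + L) * sqrt k" by (simp only: mult_ac)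
  finally have 1: "\<bar>(\<Sum>i=1..k. \<Psi> (gq \<gamma> (z i))) - (\<Sum>i=1..k. \<Psi> (P i))\<bar> \<le> 2 * K * C0 * exp b * (1 + L) * sqrt k" .
  have "\<bar>(\<Sum>i=1..k. \<Psi> (P i)) - (\<Sum>i=1..n. \<Psi> (p i))\<bar> \<le> (C0 * exp b) * \<bar>real (card {i\<in>{1..n}. 0 < p i}) - real k\<bar>"
    unfolding P_def
  proof (rule sum_top_diff_le[OF kn(2) _ _ top])
    show "\<Psi> x = 0" if "x \<le> 0" for x using exp_lipschitz_zero[OF L that] .
    show "\<bar>\<Psi> x\<bar> \<le> C0 * exp b" if "x \<le> 1" for x
    proof (cases "x \<le> 0")
      case True then show ?thesis using exp_lipschitz_zero[OF L True] C0 by simp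
    next
      case False
      then have "\<bar>\<Psi> x\<bar> \<le> C0 * exp (b * x) * x" by (intro exp_lipschitz_abs_le[OF L]) simp
      also have "\<dots> \<le> C0 * exp b * 1" using False that b C0 by (intro mult_mono mult_left_mono) (auto simp: mult_left_le)
      finally show ?thesis by simp
    qed
  qed (use C0 in simp)
  also have "\<dots> \<le> (C0 * exp b) * (L * sqrt k)" using N C0 by (intro mult_left_mono) auto
  finally have 2: "\<bar>(\<Sum>i=1..k. \<Psi> (P i)) - (\<Sum>i=1..n. \<Psi> (p i))\<bar> \<le> C0 * exp b * L * sqrt k" by simp
  have "avg k (\<lambda>i. \<Psi> (gq \<gamma> (z i))) - \<mu> = ((\<Sum>i=1..k. \<Psi> (gq \<gamma> (z i))) - k * \<mu>) / k"
    using kn by (simp add: avg_def field_simps)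
  also have "\<bar>\<dots>\<bar> = \<bar>(\<Sum>i=1..k. \<Psi> (gq \<gamma> (z i))) - k * \<mu>\<bar> / k" by simp
  also have "\<dots> \<le> ((2 * K * C0 * exp b * (1 + L) + C0 * exp b * L + L) * sqrt k) / k"
  proof (rule divide_right_mono)
    have "\<bar>(\<Sum>i=1..k. \<Psi> (gq \<gamma> (z i))) - k * \<mu>\<bar> \<le> 2 * K * C0 * exp b * (1 + L) * sqrt k + C0 * exp b * L * sqrt k + L * sqrt k"
      using 1 2 S by linarith
    then show "\<bar>(\<Sum>i=1..k. \<Psi> (gq \<gamma> (z i))) - k * \<mu>\<bar> \<le> (2 * K * C0 * exp b * (1 + L) + C0 * exp b * L + L) * sqrt k"
      by (simp add: algebra_simps)
  qed simp
  also have "\<dots> = (2 * K * C0 * exp b * (1 + L) + C0 * exp b * L + L) / sqrt k"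
  proof -
    have "x * sqrt k / k = x / sqrt k" for x using sk kn by (metis mult_divide_mult_cancel_right less_irrefl)
    then show ?thesis .
  qed
  finally show ?thesis .
qed

text \<open>The order statistic leaves \<open>[-c, c]\<close> with \<open>c = L/\<surd>k\<close> only if the number of
  values above \<open>c\<close> or above \<open>-c\<close> is on the wrong side of \<open>k\<close>, while their
  expected numbers \<open>k exp(-c)\<close> and \<open>k exp(c)\<close> are a multiple of
  \<open>L\<surd>k\<close> away from \<open>k\<close>.\<close>

lemma order_stat_count_deviation:
  assumes kn: "0 < k" "k < n" and L: "0 < L" "L / sqrt k \<le> 1" and s: "s = ln (real n / real k)" "1 \<le> s"
  shows "measure (expo_sample n) {\<omega> \<in> space (expo_sample n). \<not> \<bar>order_stat (\<lambda>i. \<omega> i - s) (n - k) n\<bar> \<le> L / sqrt k} \<le> 8 / L\<^sup>2"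
proof -
  interpret prob_space "expo_sample n" by (rule prob_space_expo_sample)
  define c where "c = L / sqrt k"
  have sk: "sqrt k > 0" "sqrt k * sqrt k = real k" using kn by auto
  have c: "0 < c" "c \<le> 1" "real k * c = L * sqrt k" using L sk by (auto simp: c_def field_simps)
  have ns: "real n * exp (- (s + d)) = real k * exp (- d)" for d
    using kn s by (simp add: exp_diff exp_minus field_simps)
  let ?N = "\<lambda>d \<omega>. real (card {i\<in>{1..n}. d < \<omega> i - s})"
  let ?B = "\<lambda>d a. {\<omega> \<in> space (expo_sample n). a \<le> \<bar>?N d \<omega> - real n * exp (- (s + d))\<bar>}"
  have Bm: "?B d a \<in> events" for d a unfolding card_exceed by measurable
  define a where "a = L * sqrt k / 2"
  have a: "a > 0" using L sk by (simp add: a_def)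
  have sub: "{\<omega> \<in> space (expo_sample n). \<not> \<bar>order_stat (\<lambda>i. \<omega> i - s) (n - k) n\<bar> \<le> L / sqrt k} \<subseteq> ?B c a \<union> ?B (- c) (2 * a)"
  proof
    fix \<omega> assume \<omega>: "\<omega> \<in> {\<omega> \<in> space (expo_sample n). \<not> \<bar>order_stat (\<lambda>i. \<omega> i - s) (n - k) n\<bar> \<le> L / sqrt k}"
    then consider "c < order_stat (\<lambda>i. \<omega> i - s) (n - k) n" | "\<not> - c < order_stat (\<lambda>i. \<omega> i - s) (n - k) n"
      unfolding c_def by force
    then show "\<omega> \<in> ?B c a \<union> ?B (- c) (2 * a)"
    proof cases
      case 1
      then have N: "real k \<le> ?N c \<omega>" using order_stat_gt_iff[OF kn(2), of c "\<lambda>i. \<omega> i - s"] by simp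
      have "exp (- c) \<le> 1 - c / 2"
      proof -
        have "exp (- c) * (1 + c) \<le> exp (- c) * exp c" by (intro mult_left_mono exp_ge_add_one_self) auto
        then have "exp (- c) \<le> 1 / (1 + c)" using c by (simp add: mult_exp_exp field_simps)
        also have "\<dots> \<le> 1 - c / 2" using c mult_right_mono[of c 1 c] by (simp add: field_simps)
        finally show ?thesis .
      qed
      then have "real k * exp (- c) \<le> real k * (1 - c / 2)" by (intro mult_left_mono) auto
      then have "a \<le> real k - real k * exp (- c)" using c by (simp add: a_def algebra_simps)
      then show ?thesis using N \<omega> unfolding ns by auto
    next
      case 2
      then have N: "?N (- c) \<omega> \<le> real k" using order_stat_gt_iff[OF kn(2), of "- c" "\<lambda>i. \<omega> i - s"] by simp
      have "real k * (1 + c) \<le> real k * exp c" by (intro mult_left_mono exp_ge_add_one_self) auto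
      then have "2 * a \<le> real k * exp c - real k" using c by (simp add: a_def algebra_simps)
      then show ?thesis using N \<omega> unfolding ns by auto
    qed
  qed
  have "prob {\<omega> \<in> space (expo_sample n). \<not> \<bar>order_stat (\<lambda>i. \<omega> i - s) (n - k) n\<bar> \<le> L / sqrt k} \<le> prob (?B c a \<union> ?B (- c) (2 * a))"
    by (rule finite_measure_mono[OF sub]) (use Bm in auto)
  also have "\<dots> \<le> prob (?B c a) + prob (?B (- c) (2 * a))" by (rule measure_Un_le[OF Bm Bm])
  also have "\<dots> \<le> real n * exp (- (s + c)) / a\<^sup>2 + real n * exp (- (s + - c)) / (2 * a)\<^sup>2"
    using s c kn a by (intro add_mono exceedance_count_chebyshev) auto
  also have "\<dots> \<le> 4 / L\<^sup>2 + 4 / L\<^sup>2"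
  proof -
    have a2: "a\<^sup>2 = L\<^sup>2 * k / 4" "(2 * a)\<^sup>2 = L\<^sup>2 * k" using sk by (simp_all add: a_def power2_eq_square mult_ac)
    have "real k * exp (- c) / a\<^sup>2 = 4 * exp (- c) / L\<^sup>2" unfolding a2 using kn by simp
    moreover have "real k * exp c / (2 * a)\<^sup>2 = exp c / L\<^sup>2" unfolding a2 using kn by simp
    moreover have "4 * exp (- c) / L\<^sup>2 \<le> 4 / L\<^sup>2" using c by (intro divide_right_mono) auto
    moreover have "exp c / L\<^sup>2 \<le> 4 / L\<^sup>2"
    proof (intro divide_right_mono)
      have "exp c \<le> exp 1" using c by simp
      also have "\<dots> \<le> (4::real)" using exp_le by linarith
      finally show "exp c \<le> 4" .
    qed simp
    ultimately show ?thesis unfolding ns by simp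
  qed
  finally show ?thesis by simp
qed

lemma expo_sample_pos_null: "measure (expo_sample n) {\<omega> \<in> space (expo_sample n). \<not> (\<forall>i\<in>{1..n}. 0 < \<omega> i)} = 0"
proof -
  interpret prob_space "expo_sample n" by (rule prob_space_expo_sample)
  have "AE \<omega> in expo_sample n. \<forall>i\<in>{1..n}. 0 < \<omega> i"
    unfolding expo_sample_def
    by (intro AE_finite_allI finite_atLeastAtMost AE_PiM_component prob_space_expo AE_expo_pos)
  then have "prob {\<omega> \<in> space (expo_sample n). \<forall>i\<in>{1..n}. 0 < \<omega> i} = 1" by (subst prob_Collect_eq_1) auto
  then show ?thesis by (subst prob_neg) auto
qed

lemma order_stat_shift:
  assumes "1 \<le> j" "j \<le> n"
  shows "order_stat (\<lambda>i. \<omega> i - s) j n = order_stat \<omega> j n - s"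
  by (rule order_stat_image[of UNIV "\<lambda>x. x - s"]) (use assms in \<open>auto simp: mono_on_def\<close>)

lemma zeta_abs_le:
  assumes "\<bar>x\<bar> \<le> 1"
  shows "\<bar>zeta \<gamma> x\<bar> \<le> exp \<bar>\<gamma>\<bar> * \<bar>x\<bar>"
proof -
  have "norm (zeta \<gamma> x - zeta \<gamma> 0) \<le> exp \<bar>\<gamma>\<bar> * norm (x - 0)"
  proof (rule field_differentiable_bound[of "{-1..1}"])
    fix u :: real assume u: "u \<in> {-1..1}"
    show "(zeta \<gamma> has_real_derivative exp (\<gamma> * u)) (at u within {-1..1})"
      by (rule has_field_derivative_at_within[OF zeta_has_derivative])
    have "\<bar>\<gamma> * u\<bar> \<le> \<bar>\<gamma>\<bar> * 1" unfolding abs_mult using u by (intro mult_left_mono) auto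
    then show "norm (exp (\<gamma> * u)) \<le> exp \<bar>\<gamma>\<bar>" by simp
  qed (use assms in auto)
  then show ?thesis by simp
qed

text \<open>Writing \<open>y\<^sub>i = U(t exp(p\<^sub>i))\<close> with \<open>t = n/k\<close>, the excess is a difference
  of two normalised increments of \<open>U\<close> from \<open>t\<close>, each covered by the uniform bound. The
  threshold corresponds to the \<open>(n-k)\<close>-th order statistic of \<open>p\<close>, which is
  \<open>O(1/\<surd>k)\<close> and contributes the term with \<open>L\<close>.\<close>

lemma (in second_order_tail) excess_close:
  fixes \<omega> :: "nat \<Rightarrow> real" and n k :: nat and t s e CU A0 L :: real
  defines "\<beta> \<equiv> max \<gamma> 0 + e" and "p \<equiv> (\<lambda>i. \<omega> i - s)"
  assumes e: "e > 0" and kn: "0 < k" "k < n" and t: "t > 1" and s: "s = ln t"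
    and bound: "\<And>x. x \<ge> 1/2 \<Longrightarrow> \<bar>rem t x\<bar> \<le> CU * \<bar>A t\<bar> * x powr \<beta>" and CU: "0 \<le> CU"
    and At: "\<bar>A t\<bar> \<le> A0 / sqrt k" and A0: "0 \<le> A0"
    and pos: "\<And>i. i \<in> {1..n} \<Longrightarrow> 0 < \<omega> i" and y: "\<And>i. i \<in> {1..n} \<Longrightarrow> y i = U (exp (\<omega> i))"
    and top: "\<bar>order_stat p (n - k) n\<bar> \<le> L / sqrt k" "L / sqrt k \<le> 1/2" and i: "i \<in> {1..k}"
  shows "0 \<le> excess y n k (a t) i"
    "\<bar>excess y n k (a t) i - zeta \<gamma> (order_stat p (n - i + 1) n)\<bar>
      \<le> (CU * A0 * (1 + exp \<beta>) + exp \<bar>\<gamma>\<bar> * L) / sqrt k * exp (\<beta> * max 0 (order_stat p (n - i + 1) n))"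
proof -
  have \<beta>: "\<beta> > 0" using e by (simp add: \<beta>_def)
  have sk: "sqrt k > 0" using kn by simp
  have map_y: "map y [1..<Suc n] = map (\<lambda>i. U (exp (\<omega> i))) [1..<Suc n]" using y by (intro map_cong) auto
  have ord: "order_stat y j n = U (t * exp (order_stat p j n))" "exp (order_stat \<omega> j n) > 1"
      "t * exp (order_stat p j n) = exp (order_stat \<omega> j n)" if "1 \<le> j" "j \<le> n" for j
  proof -
    have "mono_on {0<..} (\<lambda>x. U (exp x))" using U_mono by (auto simp: mono_on_def)
    then have "order_stat (\<lambda>i. U (exp (\<omega> i))) j n = U (exp (order_stat \<omega> j n))"
      by (rule order_stat_image[where U = "\<lambda>x. U (exp x)"]) (use pos that in auto)
    then have oy: "order_stat y j n = U (exp (order_stat \<omega> j n))" by (simp only: order_stat_def map_y)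
    have "order_stat p j n = order_stat \<omega> j n - s" unfolding p_def by (rule order_stat_shift[OF that])
    then show te: "t * exp (order_stat p j n) = exp (order_stat \<omega> j n)" using s t by (simp add: exp_diff)
    show "order_stat y j n = U (t * exp (order_stat p j n))" unfolding te by (rule oy)
    show "exp (order_stat \<omega> j n) > 1" using order_stat_in[OF that, of \<omega>] pos by auto
  qed
  define P where "P = order_stat p (n - i + 1) n"
  define P0 where "P0 = order_stat p (n - k) n"
  have ji: "1 \<le> n - i + 1" "n - i + 1 \<le> n" "1 \<le> n - k" "n - k \<le> n" "n - k \<le> n - i + 1" using i kn by auto
  have P0P: "P0 \<le> P" unfolding P_def P0_def by (rule order_stat_mono) (use ji in auto)
  have P0: "\<bar>P0\<bar> \<le> 1/2" using top unfolding P0_def by linarith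
  have ex: "excess y n k (a t) i = (U (t * exp P) - U (t * exp P0)) / a t"
    unfolding excess_def P_def P0_def using ord(1)[OF ji(1,2)] ord(1)[OF ji(3,4)] by simp
  have at: "a t > 0" by (rule a_pos[OF t])
  show "0 \<le> excess y n k (a t) i"
  proof -
    have "U (t * exp P0) \<le> U (t * exp P)"
    proof (rule mono_onD[OF U_mono])
      show "t * exp P0 \<in> {1<..}" using ord(2,3)[OF ji(3,4)] by (simp only: P0_def greaterThan_iff)
      show "t * exp P \<in> {1<..}" using ord(2,3)[OF ji(1,2)] by (simp only: P_def greaterThan_iff)
      show "t * exp P0 \<le> t * exp P" using P0P t by simp
    qed
    then show ?thesis using at by (simp add: ex)
  qed
  have "excess y n k (a t) i - zeta \<gamma> P = rem t (exp P) - rem t (exp P0) - zeta \<gamma> P0"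
    unfolding ex rem_def zeta_def by (simp add: diff_divide_distrib)
  then have tri: "\<bar>excess y n k (a t) i - zeta \<gamma> P\<bar> \<le> \<bar>rem t (exp P)\<bar> + \<bar>rem t (exp P0)\<bar> + \<bar>zeta \<gamma> P0\<bar>" by linarith
  have half: "exp x \<ge> 1/2" if "x \<ge> -1/2" for x :: real
    using exp_ge_add_one_self[of x] that by linarith
  have r: "\<bar>rem t (exp x)\<bar> \<le> CU * (A0 / sqrt k) * exp (\<beta> * max 0 x)" if "x \<ge> -1/2" for x
  proof -
    have "\<bar>rem t (exp x)\<bar> \<le> CU * \<bar>A t\<bar> * exp x powr \<beta>" by (rule bound[OF half[OF that]])
    also have "\<dots> \<le> CU * (A0 / sqrt k) * exp (\<beta> * max 0 x)"
      using At CU \<beta> A0 sk by (intro mult_mono) (auto simp: powr_def intro!: mult_left_mono)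
    finally show ?thesis .
  qed
  define E where "E = exp (\<beta> * max 0 P)"
  have E1: "1 \<le> E" using \<beta> by (simp add: E_def)
  have c0: "0 \<le> CU * (A0 / sqrt k)" using CU A0 sk by simp
  have "\<bar>rem t (exp P)\<bar> \<le> CU * (A0 / sqrt k) * E" unfolding E_def by (rule r) (use P0 P0P in auto)
  moreover have "\<bar>rem t (exp P0)\<bar> \<le> CU * (A0 / sqrt k) * exp \<beta> * E"
  proof -
    have "\<bar>rem t (exp P0)\<bar> \<le> CU * (A0 / sqrt k) * exp (\<beta> * max 0 P0)" by (rule r) (use P0 in auto)
    also have "\<dots> \<le> CU * (A0 / sqrt k) * exp \<beta>"
      using c0 \<beta> P0 by (intro mult_left_mono) (auto intro!: mult_left_le)
    also have "\<dots> \<le> CU * (A0 / sqrt k) * exp \<beta> * E"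
    proof -
      have "0 \<le> CU * (A0 / sqrt k) * exp \<beta>" by (intro mult_nonneg_nonneg c0) simp
      from mult_left_mono[OF E1 this] show ?thesis by (simp only: mult_1_right)
    qed
    finally show ?thesis .
  qed
  moreover have "\<bar>zeta \<gamma> P0\<bar> \<le> exp \<bar>\<gamma>\<bar> * (L / sqrt k) * E"
  proof -
    have "\<bar>zeta \<gamma> P0\<bar> \<le> exp \<bar>\<gamma>\<bar> * \<bar>P0\<bar>" by (rule zeta_abs_le) (use P0 in auto)
    also have "\<dots> \<le> exp \<bar>\<gamma>\<bar> * (L / sqrt k)" using top by (intro mult_left_mono) (auto simp: P0_def)
    finally have *: "\<bar>zeta \<gamma> P0\<bar> \<le> exp \<bar>\<gamma>\<bar> * (L / sqrt k)" .
    then have "0 \<le> exp \<bar>\<gamma>\<bar> * (L / sqrt k)" by linarith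
    from mult_left_mono[OF E1 this] * show ?thesis by simp
  qed
  ultimately have "\<bar>excess y n k (a t) i - zeta \<gamma> P\<bar> \<le>
      CU * (A0 / sqrt k) * E + CU * (A0 / sqrt k) * exp \<beta> * E + exp \<bar>\<gamma>\<bar> * (L / sqrt k) * E" using tri by linarith
  also have "\<dots> = (CU * A0 * (1 + exp \<beta>) + exp \<bar>\<gamma>\<bar> * L) / sqrt k * E"
    by (simp add: add_divide_distrib algebra_simps)
  finally show "\<bar>excess y n k (a t) i - zeta \<gamma> (order_stat p (n - i + 1) n)\<bar>
      \<le> (CU * A0 * (1 + exp \<beta>) + exp \<bar>\<gamma>\<bar> * L) / sqrt k * exp (\<beta> * max 0 (order_stat p (n - i + 1) n))"
    unfolding P_def E_def .
qed

text \<open>The largest shifted exponential is at most \<open>ln(Lk)\<close> with high probability, so the worst error is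
  \<open>(Lk)\<^sup>b/\<surd>k\<close>.\<close>

lemma power_over_sqrt_small:
  fixes k :: "nat \<Rightarrow> nat"
  assumes k: "filterlim k at_top sequentially" and b: "b < 1/2" and \<eta>: "\<eta> > 0" and L: "L > 0"
  shows "\<forall>\<^sub>F n in sequentially. (L * real (k n)) powr b / sqrt (real (k n)) \<le> \<eta>"
proof -
  have kr: "filterlim (\<lambda>n. real (k n)) at_top sequentially"
    by (rule filterlim_compose[OF filterlim_real_sequentially k])
  have "((\<lambda>x. x powr (b - 1/2)) \<longlongrightarrow> 0) at_top"
    by (rule tendsto_neg_powr) (use b in \<open>auto intro: filterlim_ident\<close>)
  from tendsto_mult[OF tendsto_const filterlim_compose[OF this kr], of "L powr b"]
  have "(\<lambda>n. L powr b * real (k n) powr (b - 1/2)) \<longlonglongrightarrow> 0" by simp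
  then have "\<forall>\<^sub>F n in sequentially. L powr b * real (k n) powr (b - 1/2) < \<eta>" using \<eta> by (rule order_tendstoD)
  moreover have "\<forall>\<^sub>F n in sequentially. real (k n) > 0" using kr unfolding filterlim_at_top_dense by blast
  ultimately show ?thesis
  proof eventually_elim
    case (elim n)
    have "(L * real (k n)) powr b / sqrt (real (k n)) = L powr b * real (k n) powr (b - 1/2)"
      using elim L by (simp add: powr_mult powr_diff powr_half_sqrt)
    then show ?case using elim by simp
  qed
qed

lemma measure_Un_6_le:
  assumes "A \<in> sets M" "B \<in> sets M" "C \<in> sets M" "D \<in> sets M" "E \<in> sets M" "F \<in> sets M"
  shows "measure M (A \<union> B \<union> C \<union> D \<union> E \<union> F) \<le> measure M A + measure M B + measure M C + measure M D + measure M E + measure M F"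
proof -
  note s = assms sets.Un
  have "measure M (A \<union> B \<union> C \<union> D \<union> E \<union> F) \<le> measure M (A \<union> B \<union> C \<union> D \<union> E) + measure M F" by (intro measure_Un_le s)
  also have "measure M (A \<union> B \<union> C \<union> D \<union> E) \<le> measure M (A \<union> B \<union> C \<union> D) + measure M E" by (intro measure_Un_le s)
  also have "measure M (A \<union> B \<union> C \<union> D) \<le> measure M (A \<union> B \<union> C) + measure M D" by (intro measure_Un_le s)
  also have "measure M (A \<union> B \<union> C) \<le> measure M (A \<union> B) + measure M C" by (intro measure_Un_le s)
  also have "measure M (A \<union> B) \<le> measure M A + measure M B" by (intro measure_Un_le s)
  finally show ?thesis by simp
qed

text \<open>Outside an event of small probability the exponential sample is such that \<open>excess_close\<close> and
  \<open>tail_average_close\<close> apply. The constant \<open>C\<close> does not depend on \<open>c\<close>: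
  since \<open>b < 1/2\<close>, the largest ratio \<open>z\<^sub>i/(1 + \<gamma>z\<^sub>i)\<close> is of smaller
  order than \<open>\<surd>k\<close>.\<close>

theorem (in second_order_tail) tail_statistics:
  fixes k :: "nat \<Rightarrow> nat" and S :: "(real \<Rightarrow> real) set"
  assumes U_eq: "U = tail_quantile F"
    and k: "filterlim k at_top sequentially" and kn: "filterlim (\<lambda>n. real n / real (k n)) at_top sequentially"
    and A0: "0 \<le> A0" and At: "\<forall>\<^sub>F n in sequentially. \<bar>A (real n / real (k n))\<bar> \<le> A0 / sqrt (k n)"
    and e: "e > 0" and b: "b = max (- \<gamma>) 0 + e" "b < 1/2"
    and S: "finite S" "\<And>\<Psi>. \<Psi> \<in> S \<Longrightarrow> exp_lipschitz b C0 \<Psi>" and C0: "0 \<le> C0" and \<delta>: "0 < \<delta>"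
  shows "\<exists>C>0. \<forall>c>0. \<forall>\<^sub>F n in sequentially. \<exists>E\<in>sets (expo_sample n). measure (expo_sample n) E \<le> \<delta> \<and>
     (\<forall>\<omega>\<in>space (expo_sample n) - E. let z = excess (\<lambda>i. exp_quantile F (\<omega> i)) n (k n) (a (real n / real (k n))) in
        (\<forall>i\<in>{1..k n}. 0 \<le> z i \<and> 1 + \<gamma> * z i > 0 \<and> z i \<le> c * sqrt (k n) * (1 + \<gamma> * z i)) \<and>
        (\<forall>\<Psi>\<in>S. \<bar>avg (k n) (\<lambda>i. \<Psi> (gq \<gamma> (z i))) - (\<integral>p. \<Psi> p \<partial>expo)\<bar> \<le> C / sqrt (k n)))"
proof -
  have b0: "0 \<le> b" using e b by auto
  define \<beta> where "\<beta> = max \<gamma> 0 + e"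
  obtain CU t0 where CU: "CU > 0" and t0: "t0 > 4"
    and unif: "\<And>t x. t \<ge> t0 \<Longrightarrow> x \<ge> 1/2 \<Longrightarrow> \<bar>rem t x\<bar> \<le> CU * \<bar>A t\<bar> * x powr \<beta>"
    using uniform_bound[OF e] unfolding \<beta>_def by blast
  define V where "V = (\<lambda>\<Psi>. \<integral>p. (\<Psi> p :: real)\<^sup>2 \<partial>expo)"
  define M0 where "M0 = 2 * b / (1 - 2 * b)"
  \<comment> \<open>Each exceptional event below has probability at most a constant over \<open>L\<close>; \<open>tot\<close> adds up the constants.\<close>
  define tot where "tot = 10 + M0 + (\<Sum>\<Psi>\<in>S. V \<Psi>)"
  define L where "L = max 1 (tot / \<delta>)"
  have V0: "0 \<le> V \<Psi>" for \<Psi> by (simp add: V_def)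
  have M0: "0 \<le> M0" using b0 b by (simp add: M0_def)
  have tot0: "tot > 0" using M0 V0 by (auto simp: tot_def intro!: add_pos_nonneg sum_nonneg)
  have L1: "L \<ge> 1" by (simp add: L_def)
  have "tot / \<delta> \<le> L" by (simp add: L_def)
  then have totL: "tot / L \<le> \<delta>" using \<delta> L1 by (simp add: field_simps)
  define K where "K = CU * A0 * (1 + exp \<beta>) + exp \<bar>\<gamma>\<bar> * L"
  have K0: "0 \<le> K" using CU A0 L1 by (auto simp: K_def intro!: add_nonneg_nonneg mult_nonneg_nonneg)
  define C where "C = 2 * K * C0 * exp b * (1 + L) + C0 * exp b * L + L"
  have C: "C > 0" using K0 C0 L1 by (auto simp: C_def intro!: add_nonneg_pos add_nonneg_nonneg mult_nonneg_nonneg)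
  have kr: "filterlim (\<lambda>n. real (k n)) at_top sequentially"
    by (rule filterlim_compose[OF filterlim_real_sequentially k])
  show ?thesis
  proof (rule exI[of _ C], rule conjI[OF C], intro allI impI)
    fix c :: real assume c: "0 < c"
    define \<eta> where "\<eta> = min (1 / (2 * (1 + \<bar>\<gamma>\<bar>) * (K + 1))) (c / (2 * (1 / e + K)))"
    have eK: "1 / e + K > 0" using e K0 by (intro add_pos_nonneg) auto
    have \<eta>: "\<eta> > 0" using K0 c eK by (auto simp: \<eta>_def intro!: divide_pos_pos mult_pos_pos add_pos_nonneg)
    have ev1: "\<forall>\<^sub>F n in sequentially. (L * real (k n)) powr b / sqrt (real (k n)) \<le> \<eta>"
      using power_over_sqrt_small[OF k b(2) \<eta>] L1 by simp
    have ev2: "\<forall>\<^sub>F n in sequentially. real n / real (k n) \<ge> max t0 (exp 1)" using kn unfolding filterlim_at_top by blast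
    have ev3: "\<forall>\<^sub>F n in sequentially. real (k n) \<ge> (2 * L)\<^sup>2" using kr unfolding filterlim_at_top by blast
    from ev1 ev2 ev3 At
    show "\<forall>\<^sub>F n in sequentially. \<exists>E\<in>sets (expo_sample n). measure (expo_sample n) E \<le> \<delta> \<and>
     (\<forall>\<omega>\<in>space (expo_sample n) - E. let z = excess (\<lambda>i. exp_quantile F (\<omega> i)) n (k n) (a (real n / real (k n))) in
        (\<forall>i\<in>{1..k n}. 0 \<le> z i \<and> 1 + \<gamma> * z i > 0 \<and> z i \<le> c * sqrt (k n) * (1 + \<gamma> * z i)) \<and>
        (\<forall>\<Psi>\<in>S. \<bar>avg (k n) (\<lambda>i. \<Psi> (gq \<gamma> (z i))) - (\<integral>p. \<Psi> p \<partial>expo)\<bar> \<le> C / sqrt (k n)))"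
    proof eventually_elim
      case (elim n)
      define kk where "kk = k n"
      define t where "t = real n / real kk"
      define s where "s = ln t"
      note el = elim[folded kk_def, folded t_def]
      have "2 \<le> 2 * L" using L1 by simp
      then have "2\<^sup>2 \<le> (2 * L)\<^sup>2" by (intro power_mono) auto
      then have k4: "4 \<le> real kk" using el(3) by simp
      then have kk0: "0 < kk" by simp
      have sk: "sqrt kk > 0" "sqrt kk * sqrt kk = real kk" using kk0 by auto
      have t: "t \<ge> t0" "t > 1" "t \<ge> exp 1" using el(2) t0 by auto
      have kkn: "kk < n" using t(2) kk0 by (simp add: t_def)
      have s1: "1 \<le> s" using t ln_ge_iff[of t 1] by (simp add: s_def)
      have ns: "real n * exp (- s) = real kk" using t kk0 kkn by (simp add: s_def exp_minus t_def field_simps)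
      have nsx: "real n * exp (- (s + x)) = real kk * exp (- x)" for x
        using ns by (simp add: exp_diff exp_minus field_simps)
      have Lk: "L / sqrt kk \<le> 1/2"
      proof -
        have "2 * L \<le> sqrt kk" using el(3) L1 by (intro real_le_rsqrt) auto
        then show ?thesis using sk by (simp add: field_simps)
      qed
      have Lk1: "1 \<le> L * real kk" using L1 k4 mult_mono[of 1 L 1 "real kk"] by simp
      let ?M = "expo_sample n"
      interpret prob_space ?M by (rule prob_space_expo_sample)
      define p where "p = (\<lambda>\<omega> :: nat \<Rightarrow> real. \<lambda>i. \<omega> i - s)"
      define N where "N = (\<lambda>\<omega> :: nat \<Rightarrow> real. real (card {i\<in>{1..n}. 0 < \<omega> i - s}))"
      define g where "g = (\<lambda>x. exp (2 * b * max 0 x) - 1)"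
      \<comment> \<open>The exceptional events: a degenerate sample, a deviating threshold, a too large maximum, a deviating number
        of exceedances, a too large exponential moment, and a deviating sum for one of the statistics.\<close>
      define E0 where "E0 = {\<omega> \<in> space ?M. \<not> (\<forall>i\<in>{1..n}. 0 < \<omega> i)}"
      define E1 where "E1 = {\<omega> \<in> space ?M. \<not> \<bar>order_stat (\<lambda>i. \<omega> i - s) (n - kk) n\<bar> \<le> L / sqrt kk}"
      define E2 where "E2 = {\<omega> \<in> space ?M. \<exists>i\<in>{1..n}. ln (L * kk) < \<omega> i - s}"
      define E3 where "E3 = {\<omega> \<in> space ?M. L * sqrt kk \<le> \<bar>N \<omega> - real n * exp (- (s + 0))\<bar>}"
      define E4 where "E4 = {\<omega> \<in> space ?M. L * kk \<le> (\<Sum>i=1..n. g (\<omega> i - s))}"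
      define Ep where "Ep = (\<lambda>\<Psi>. {\<omega> \<in> space ?M. L * sqrt kk \<le> \<bar>(\<Sum>i=1..n. \<Psi> (\<omega> i - s)) - real n * exp (- s) * (\<integral>p. \<Psi> p \<partial>expo)\<bar>})"
      define E5 where "E5 = (\<Union>\<Psi>\<in>S. Ep \<Psi>)"
      have g_int: "integrable expo g" "(\<integral>p. g p \<partial>expo) = M0"
        unfolding g_def M0_def using expo_exp_moment[of "2 * b"] b0 b by auto
      have g_meas [measurable]: "g \<in> borel_measurable borel" unfolding g_def by measurable
      have \<Psi>m: "\<Psi> \<in> borel_measurable borel" if "\<Psi> \<in> S" for \<Psi> by (rule exp_lipschitz_measurable[OF S(2)[OF that] b0 C0])
      have sets: "E0 \<in> sets ?M" "E1 \<in> sets ?M" "E2 \<in> sets ?M" "E3 \<in> sets ?M" "E4 \<in> sets ?M" "E5 \<in> sets ?M"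
      proof -
        show "E0 \<in> sets ?M" unfolding E0_def by measurable
        show "E2 \<in> sets ?M" unfolding E2_def by measurable
        show "E3 \<in> sets ?M" unfolding E3_def N_def card_exceed[of n 0, simplified] by measurable
        show "E4 \<in> sets ?M" unfolding E4_def by measurable
        show "E5 \<in> sets ?M" unfolding E5_def
        proof (rule sets.finite_UN[OF S(1)])
          fix \<Psi> assume "\<Psi> \<in> S"
          note \<Psi>m[OF this, measurable]
          show "Ep \<Psi> \<in> sets ?M" unfolding Ep_def by measurable
        qed
        have j: "1 \<le> n - kk" "n - kk \<le> n" using kkn by auto
        have [measurable]: "(\<lambda>\<omega>. order_stat \<omega> (n - kk) n) \<in> borel_measurable ?M"
          using order_stat_measurable[OF j] by (simp add: measurable_cong_sets[OF sets_expo_sample refl])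
        show "E1 \<in> sets ?M" unfolding E1_def order_stat_shift[OF j] by measurable
      qed
      have m0: "prob E0 \<le> 0" unfolding E0_def using expo_sample_pos_null[of n] by simp
      have m1: "prob E1 \<le> 8 / L"
      proof -
        have "prob E1 \<le> 8 / L\<^sup>2" unfolding E1_def
          by (rule order_stat_count_deviation) (use kk0 kkn L1 Lk s1 in \<open>auto simp: s_def t_def\<close>)
        also have "\<dots> \<le> 8 / L" using L1 by (intro divide_left_mono) (auto simp: power2_eq_square mult_left_le)
        finally show ?thesis .
      qed
      have m2: "prob E2 \<le> 1 / L"
      proof -
        have "prob E2 \<le> real n * exp (- (s + ln (L * kk)))"
          unfolding E2_def by (rule max_exceed_markov) (use s1 Lk1 in simp)
        also have "\<dots> = 1 / L" unfolding nsx using Lk1 L1 kk0 by (simp add: exp_minus field_simps)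
        finally show ?thesis .
      qed
      have L2: "x / L\<^sup>2 \<le> x / L" if "0 \<le> x" for x
        using that L1 by (intro divide_left_mono) (auto simp: power2_eq_square mult_left_le)
      have kL: "x * real kk / (L * sqrt kk)\<^sup>2 = x / L\<^sup>2" for x
        using kk0 by (simp add: power_mult_distrib)
      have m3: "prob E3 \<le> 1 / L"
      proof -
        have "prob E3 \<le> real n * exp (- (s + 0)) / (L * sqrt kk)\<^sup>2"
          unfolding E3_def N_def by (rule exceedance_count_chebyshev) (use s1 kkn L1 sk in auto)
        also have "\<dots> = 1 / L\<^sup>2" using kL[of 1] by (simp add: ns)
        also have "\<dots> \<le> 1 / L" by (rule L2) simp
        finally show ?thesis .
      qed
      have m4: "prob E4 \<le> M0 / L"
      proof -
        have "prob E4 \<le> real n * exp (- s) * (\<integral>p. g p \<partial>expo) / (L * kk)"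
          unfolding E4_def
          by (rule expo_sum_markov[OF g_meas]) (use s1 L1 kk0 g_int b0 in \<open>auto simp: g_def max_absorb1\<close>)
        also have "\<dots> = M0 / L" using kk0 by (simp add: ns g_int)
        finally show ?thesis .
      qed
      have m5: "prob E5 \<le> (\<Sum>\<Psi>\<in>S. V \<Psi>) / L"
      proof -
        have Eps: "Ep \<Psi> \<in> sets ?M" if "\<Psi> \<in> S" for \<Psi>
          using \<Psi>m[OF that] unfolding Ep_def by measurable
        have "prob E5 \<le> (\<Sum>\<Psi>\<in>S. prob (Ep \<Psi>))"
          unfolding E5_def by (rule measure_UNION_le[OF S(1)]) (use Eps in auto)
        also have "\<dots> \<le> (\<Sum>\<Psi>\<in>S. V \<Psi> / L)"
        proof (rule sum_mono)
          fix \<Psi> assume \<Psi>: "\<Psi> \<in> S"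
          have "prob (Ep \<Psi>) \<le> real n * exp (- s) * (\<integral>p. (\<Psi> p)\<^sup>2 \<partial>expo) / (L * sqrt kk)\<^sup>2"
            unfolding Ep_def
            by (rule expo_sum_chebyshev[OF \<Psi>m[OF \<Psi>] exp_lipschitz_zero[OF S(2)[OF \<Psi>]] _ exp_lipschitz_square_integrable[OF S(2)[OF \<Psi>] b0 b(2) C0]])
               (use s1 kkn L1 sk in auto)
          also have "\<dots> = V \<Psi> / L\<^sup>2" using kL[of "V \<Psi>"] by (simp add: ns V_def mult.commute)
          also have "\<dots> \<le> V \<Psi> / L" by (rule L2[OF V0])
          finally show "prob (Ep \<Psi>) \<le> V \<Psi> / L" .
        qed
        finally show ?thesis by (simp add: sum_divide_distrib)
      qed
      define E where "E = E0 \<union> E1 \<union> E2 \<union> E3 \<union> E4 \<union> E5"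
      have Es: "E \<in> sets ?M" unfolding E_def by (intro sets.Un sets)
      have "prob E \<le> prob E0 + prob E1 + prob E2 + prob E3 + prob E4 + prob E5"
        unfolding E_def by (intro measure_Un_6_le sets)
      also have "\<dots> \<le> 8 / L + 1 / L + 1 / L + M0 / L + (\<Sum>\<Psi>\<in>S. V \<Psi>) / L" using m0 m1 m2 m3 m4 m5 by linarith
      also have "\<dots> = tot / L" by (simp add: tot_def add_divide_distrib)
      finally have Ed: "prob E \<le> \<delta>" using totL by linarith
      show ?case
      proof (rule bexI[OF _ Es], rule conjI[OF Ed], rule ballI)
        fix \<omega> assume "\<omega> \<in> space ?M - E"
        then have \<omega>: "\<omega> \<in> space ?M" "\<omega> \<notin> E0" "\<omega> \<notin> E1" "\<omega> \<notin> E2" "\<omega> \<notin> E3" "\<omega> \<notin> E4" "\<omega> \<notin> E5"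
          by (auto simp: E_def)
        define z where "z = excess (\<lambda>i. exp_quantile F (\<omega> i)) n kk (a t)"
        define P where "P = (\<lambda>i. order_stat (\<lambda>i. \<omega> i - s) (n - i + 1) n)"
        have pos: "0 < \<omega> i" if "i \<in> {1..n}" for i using \<omega>(1,2) that by (auto simp: E0_def)
        have top: "\<bar>order_stat (\<lambda>i. \<omega> i - s) (n - kk) n\<bar> \<le> L / sqrt kk" using \<omega>(1,3) by (auto simp: E1_def)
        have y: "exp_quantile F (\<omega> i) = U (exp (\<omega> i))" if "i \<in> {1..n}" for i
          using pos[OF that] by (simp add: exp_quantile_def U_eq)
        have zc: "0 \<le> z i" "\<bar>z i - zeta \<gamma> (P i)\<bar> \<le> K / sqrt kk * exp (\<beta> * max 0 (P i))" if i: "i \<in> {1..kk}" for i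
          unfolding z_def P_def K_def \<beta>_def
          using excess_close[OF e kk0 kkn t(2) s_def unif[OF t(1), unfolded \<beta>_def] _ el(4) A0 pos y top Lk i] CU
          by auto
        have q: "exp (b * max 0 (P i)) \<le> (L * kk) powr b" if i: "i \<in> {1..kk}" for i
        proof -
          have "1 \<le> n - i + 1" "n - i + 1 \<le> n" using i kkn by auto
          from order_stat_in[OF this, of "\<lambda>i. \<omega> i - s"] obtain j where "j \<in> {1..n}" "P i = \<omega> j - s"
            by (auto simp: P_def)
          then have "P i \<le> ln (L * kk)" using \<omega>(1,4) by (auto simp: E2_def not_less)
          moreover have "0 \<le> ln (L * kk)" using Lk1 by simp
          ultimately have "b * max 0 (P i) \<le> b * ln (L * kk)" using b0 by (intro mult_left_mono) auto
          then show ?thesis using Lk1 kk0 L1 by (simp add: powr_def)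
        qed
        have qs: "exp (b * max 0 (P i)) \<le> \<eta> * sqrt kk" if i: "i \<in> {1..kk}" for i
          using q[OF i] el(1) sk by (simp add: pos_divide_le_eq)
        have K1: "1 / sqrt kk * (\<eta> * sqrt kk) = \<eta>" using sk by simp
        have h0: "0 \<le> K / sqrt kk" using K0 sk by simp
        have sm: "2 * (1 + \<bar>\<gamma>\<bar>) * (K / sqrt kk) * exp (b * max 0 (P i)) \<le> 1" if i: "i \<in> {1..kk}" for i
        proof -
          have "2 * (1 + \<bar>\<gamma>\<bar>) * (K / sqrt kk) * exp (b * max 0 (P i)) \<le> 2 * (1 + \<bar>\<gamma>\<bar>) * (K / sqrt kk) * (\<eta> * sqrt kk)"
            by (intro mult_left_mono qs[OF i] mult_nonneg_nonneg h0) auto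
          also have "\<dots> = 2 * (1 + \<bar>\<gamma>\<bar>) * K * \<eta>" using sk by simp
          also have "\<dots> \<le> 2 * (1 + \<bar>\<gamma>\<bar>) * (K + 1) * \<eta>" using \<eta> by (intro mult_right_mono mult_left_mono) auto
          also have "\<dots> \<le> 2 * (1 + \<bar>\<gamma>\<bar>) * (K + 1) * (1 / (2 * (1 + \<bar>\<gamma>\<bar>) * (K + 1)))"
            using K0 by (intro mult_left_mono) (auto simp: \<eta>_def)
          also have "\<dots> = 1" using K0 by (simp add: add_nonneg_eq_0_iff)
          finally show ?thesis .
        qed
        have A: "\<forall>i\<in>{1..kk}. 0 \<le> z i \<and> 1 + \<gamma> * z i > 0 \<and> z i \<le> c * sqrt kk * (1 + \<gamma> * z i)"
        proof
          fix i assume i: "i \<in> {1..kk}"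
          define X where "X = K / sqrt kk * exp (b * max 0 (P i))"
          have X: "0 \<le> X" unfolding X_def by (intro mult_nonneg_nonneg h0) simp
          have "2 * X + 2 * (\<bar>\<gamma>\<bar> * X) \<le> 1" using sm[OF i] unfolding X_def by (simp add: algebra_simps)
          then have "\<bar>\<gamma>\<bar> * X \<le> 1/2" using X by linarith
          then have sm': "\<bar>\<gamma>\<bar> * (K / sqrt kk) * exp ((max (- \<gamma>) 0 + e) * max 0 (P i)) \<le> 1/2"
            unfolding X_def b(1)[symmetric] by (simp only: mult.assoc)
          note LC = log_scale_close[OF e zc(1)[OF i] zc(2)[OF i, unfolded \<beta>_def] h0 sm', folded b(1)]
          have "2 * (1 / e + K / sqrt kk) * exp (b * max 0 (P i)) \<le> 2 * (1 / e + K) * (\<eta> * sqrt kk)"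
          proof (rule mult_mono[OF _ qs[OF i]])
            have "1 \<le> sqrt kk" using k4 by simp
            then have "K / sqrt kk \<le> K / 1" using K0 by (intro divide_left_mono) auto
            then show "2 * (1 / e + K / sqrt kk) \<le> 2 * (1 / e + K)" by simp
          qed (use eK in auto)
          also have "\<dots> = (2 * (1 / e + K) * \<eta>) * sqrt kk" by simp
          also have "\<dots> \<le> c * sqrt kk"
          proof (rule mult_right_mono)
            have "\<eta> \<le> c / (2 * (1 / e + K))" by (simp add: \<eta>_def)
            then show "2 * (1 / e + K) * \<eta> \<le> c" using eK by (simp add: pos_le_divide_eq mult.commute)
          qed (use sk in simp)
          finally have "2 * (1 / e + K / sqrt kk) * exp (b * max 0 (P i)) * (1 + \<gamma> * z i) \<le> c * sqrt kk * (1 + \<gamma> * z i)"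
            using LC(1) by (intro mult_right_mono) auto
          then show "0 \<le> z i \<and> 1 + \<gamma> * z i > 0 \<and> z i \<le> c * sqrt kk * (1 + \<gamma> * z i)"
            using LC zc(1)[OF i] by linarith
        qed
        have B: "\<bar>avg kk (\<lambda>i. \<Psi> (gq \<gamma> (z i))) - (\<integral>p. \<Psi> p \<partial>expo)\<bar> \<le> C / sqrt kk" if \<Psi>: "\<Psi> \<in> S" for \<Psi>
          unfolding C_def
        proof (rule tail_average_close[where \<gamma> = \<gamma> and e = e and k = kk and K = K and z = z and \<Psi> = \<Psi>
              and L = L and \<mu> = "\<integral>p. \<Psi> p \<partial>expo" and p = "\<lambda>i. \<omega> i - s" and n = n and h = "K / sqrt kk", OF e kk0 kkn h0 order_refl, folded b(1)])
          show "order_stat (\<lambda>i. \<omega> i - s) (n - kk) n \<le> 1" using top Lk by linarith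
          show "\<bar>real (card {i\<in>{1..n}. 0 < \<omega> i - s}) - real kk\<bar> \<le> L * sqrt kk"
            using \<omega>(1,5) by (auto simp: E3_def N_def ns not_le)
          show "(\<Sum>i=1..n. exp (2 * b * max 0 (\<omega> i - s)) - 1) \<le> L * kk"
            using \<omega>(1,6) by (auto simp: E4_def g_def not_le)
          show "\<bar>(\<Sum>i=1..n. \<Psi> (\<omega> i - s)) - kk * (\<integral>p. \<Psi> p \<partial>expo)\<bar> \<le> L * sqrt kk"
            using \<omega>(1,7) \<Psi> by (auto simp: E5_def Ep_def ns not_le less_imp_le)
          show "exp_lipschitz b C0 \<Psi>" by (rule S(2)[OF \<Psi>])
        qed (use zc sm C0 L1 in \<open>auto simp: P_def \<beta>_def\<close>)
        show "let z = excess (\<lambda>i. exp_quantile F (\<omega> i)) n (k n) (a (real n / real (k n))) in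
        (\<forall>i\<in>{1..k n}. 0 \<le> z i \<and> 1 + \<gamma> * z i > 0 \<and> z i \<le> c * sqrt (k n) * (1 + \<gamma> * z i)) \<and>
        (\<forall>\<Psi>\<in>S. \<bar>avg (k n) (\<lambda>i. \<Psi> (gq \<gamma> (z i))) - (\<integral>p. \<Psi> p \<partial>expo)\<bar> \<le> C / sqrt (k n))"
          using A B unfolding Let_def kk_def[symmetric] t_def[symmetric] z_def[symmetric] by blast
      qed
    qed
  qed
qed

lemma gint_eq_zint:
  assumes "0 \<le> z" "1 + \<gamma> * z > 0"
  shows "gint a r \<gamma> z = zint \<gamma> a r (gq \<gamma> z)"
  using zeta_gq[OF assms(2)] gq_nonneg[OF assms(2,1)] by (simp add: zint_def max_absorb2)

lemma gint_min_eq_zint: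
  assumes "0 \<le> z" "1 + \<gamma> * z > 0" "0 \<le> \<kappa>"
  shows "gint a r \<gamma> (min z (zeta \<gamma> \<kappa>)) = zint \<gamma> a r (min (gq \<gamma> z) \<kappa>)"
proof -
  have "zeta \<gamma> (min (gq \<gamma> z) \<kappa>) = min (zeta \<gamma> (gq \<gamma> z)) (zeta \<gamma> \<kappa>)"
    using strict_mono_less_eq[OF zeta_strict_mono, of \<gamma>] by (auto simp: min_def)
  then show ?thesis
    using zeta_gq[OF assms(2)] gq_nonneg[OF assms(2,1)] assms(3) by (simp add: zint_def max_absorb2)
qed

lemma zeta_eventually_ge_2:
  assumes "\<gamma> > -1/2"
  shows "\<forall>\<^sub>F n::nat in sequentially. 2 \<le> zeta \<gamma> (real n)"
proof (cases "\<gamma> \<ge> 0")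
  case True
  have "\<forall>\<^sub>F n::nat in sequentially. 2 \<le> real n" by (rule eventually_sequentiallyI[of 2]) simp
  then show ?thesis
  proof eventually_elim
    case (elim n)
    have "real n \<le> zeta \<gamma> (real n)"
    proof (cases "\<gamma> = 0")
      case False
      then have "\<gamma> > 0" using True by simp
      moreover have "1 + \<gamma> * real n \<le> exp (\<gamma> * real n)" by (rule exp_ge_add_one_self)
      ultimately show ?thesis by (simp add: zeta_eq field_simps)
    qed (simp add: zeta_eq)
    then show ?case using elim by simp
  qed
next
  case False
  then have g: "\<gamma> < 0" by simp
  have "((\<lambda>n::nat. (exp (\<gamma> * real n) - 1) / \<gamma>) \<longlongrightarrow> (0 - 1) / \<gamma>) sequentially"
  proof (intro tendsto_intros)
    show "(\<lambda>n::nat. exp (\<gamma> * real n)) \<longlonglongrightarrow> 0" using g by real_asymp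
  qed (use g in auto)
  moreover have "2 < (0 - 1) / \<gamma>" using g assms by (simp add: field_simps)
  ultimately have "\<forall>\<^sub>F n::nat in sequentially. 2 < (exp (\<gamma> * real n) - 1) / \<gamma>" by (rule order_tendstoD)
  then show ?thesis by eventually_elim (use g in \<open>simp add: zeta_eq\<close>)
qed

lemma order_stat_restrict:
  "order_stat (\<lambda>i\<in>{1..n}. y i) j n = order_stat y j n"
proof -
  have "map (\<lambda>i\<in>{1..n}. y i) [1..<Suc n] = map y [1..<Suc n]" by (intro map_cong) auto
  then show ?thesis unfolding order_stat_def by (simp only:)
qed

lemma excess_restrict: "excess (\<lambda>i\<in>{1..n}. y i) n k s = excess y n k s"
  by (rule ext) (simp only: excess_def order_stat_restrict)

text \<open>The event where the inequalities fail is cut out by finitely many measurable conditions on the sample, so its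
  probability is the one found for exponential variables.\<close>

theorem tail_statistics_sample:
  fixes M :: "'a measure" and Y :: "nat \<Rightarrow> 'a \<Rightarrow> real" and k :: "nat \<Rightarrow> nat" and S :: "(real \<Rightarrow> real) set"
  assumes so: "second_order_tail (tail_quantile F) a A \<gamma> \<rho>"
    and M: "prob_space M" and iv: "prob_space.indep_vars M (\<lambda>_. borel) Y {1..}"
    and F: "\<And>i. i \<ge> 1 \<Longrightarrow> cdf (distr M borel (Y i)) = F"
    and k: "filterlim k at_top sequentially" and kn: "filterlim (\<lambda>n. real n / real (k n)) at_top sequentially"
    and A0: "0 \<le> A0" and At: "\<forall>\<^sub>F n in sequentially. \<bar>A (real n / real (k n))\<bar> \<le> A0 / sqrt (k n)"
    and e: "e > 0" and b: "b = max (- \<gamma>) 0 + e" "b < 1/2"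
    and S: "finite S" "\<And>\<Psi>. \<Psi> \<in> S \<Longrightarrow> exp_lipschitz b C0 \<Psi>" and C0: "0 \<le> C0" and \<delta>: "0 < \<delta>"
  shows "\<exists>C>0. \<forall>c>0. \<forall>\<^sub>F n in sequentially. \<exists>E\<in>sets M. measure M E \<le> \<delta> \<and>
     (\<forall>\<omega>\<in>space M - E. let z = excess (\<lambda>i. Y i \<omega>) n (k n) (a (real n / real (k n))) in
        (\<forall>i\<in>{1..k n}. 0 \<le> z i \<and> 1 + \<gamma> * z i > 0 \<and> z i \<le> c * sqrt (k n) * (1 + \<gamma> * z i)) \<and>
        (\<forall>\<Psi>\<in>S. \<bar>avg (k n) (\<lambda>i. \<Psi> (gq \<gamma> (z i))) - (\<integral>p. \<Psi> p \<partial>expo)\<bar> \<le> C / sqrt (k n)))"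
proof -
  interpret second_order_tail "tail_quantile F" a A \<gamma> \<rho> by (rule so)
  have b0: "0 \<le> b" using e b by auto
  obtain C where C: "C > 0" and main: "\<And>c. c > 0 \<Longrightarrow> \<forall>\<^sub>F n in sequentially. \<exists>E\<in>sets (expo_sample n). measure (expo_sample n) E \<le> \<delta> \<and>
     (\<forall>\<omega>\<in>space (expo_sample n) - E. let z = excess (\<lambda>i. exp_quantile F (\<omega> i)) n (k n) (a (real n / real (k n))) in
        (\<forall>i\<in>{1..k n}. 0 \<le> z i \<and> 1 + \<gamma> * z i > 0 \<and> z i \<le> c * sqrt (k n) * (1 + \<gamma> * z i)) \<and>
        (\<forall>\<Psi>\<in>S. \<bar>avg (k n) (\<lambda>i. \<Psi> (gq \<gamma> (z i))) - (\<integral>p. \<Psi> p \<partial>expo)\<bar> \<le> C / sqrt (k n)))"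
    using tail_statistics[OF refl k kn A0 At e b S C0 \<delta>] by blast
  have \<Psi>m: "\<Psi> \<in> borel_measurable borel" if "\<Psi> \<in> S" for \<Psi> by (rule exp_lipschitz_measurable[OF S(2)[OF that] b0 C0])
  have gqm [measurable]: "gq \<gamma> \<in> borel_measurable borel"
    unfolding gq_def[abs_def] by (cases "\<gamma> = 0") simp_all
  show ?thesis
  proof (rule exI[of _ C], rule conjI[OF C], intro allI impI)
    fix c :: real assume c: "c > 0"
    have kn2: "\<forall>\<^sub>F n in sequentially. real n / real (k n) \<ge> 2" using kn unfolding filterlim_at_top by blast
    have k1: "\<forall>\<^sub>F n in sequentially. k n \<ge> 1" using k unfolding filterlim_at_top by blast
    from main[OF c] kn2 k1
    show "\<forall>\<^sub>F n in sequentially. \<exists>E\<in>sets M. measure M E \<le> \<delta> \<and>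
     (\<forall>\<omega>\<in>space M - E. let z = excess (\<lambda>i. Y i \<omega>) n (k n) (a (real n / real (k n))) in
        (\<forall>i\<in>{1..k n}. 0 \<le> z i \<and> 1 + \<gamma> * z i > 0 \<and> z i \<le> c * sqrt (k n) * (1 + \<gamma> * z i)) \<and>
        (\<forall>\<Psi>\<in>S. \<bar>avg (k n) (\<lambda>i. \<Psi> (gq \<gamma> (z i))) - (\<integral>p. \<Psi> p \<partial>expo)\<bar> \<le> C / sqrt (k n)))"
    proof eventually_elim
      case (elim n)
      define sc where "sc = a (real n / real (k n))"
      have kn': "1 \<le> k n" "k n < n" using elim(2,3) by (auto simp: field_simps intro: ccontr)
      define good where "good = (\<lambda>y :: nat \<Rightarrow> real.
        (\<forall>i\<in>{1..k n}. 0 \<le> excess y n (k n) sc i \<and> 1 + \<gamma> * excess y n (k n) sc i > 0 \<and>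
            excess y n (k n) sc i \<le> c * sqrt (k n) * (1 + \<gamma> * excess y n (k n) sc i)) \<and>
        (\<forall>\<Psi>\<in>S. \<bar>avg (k n) (\<lambda>i. \<Psi> (gq \<gamma> (excess y n (k n) sc i))) - (\<integral>p. \<Psi> p \<partial>expo)\<bar> \<le> C / sqrt (k n)))"
      let ?P = "PiM {1..n} (\<lambda>_. borel :: real measure)"
      have exm: "(\<lambda>y. excess y n (k n) sc i) \<in> borel_measurable ?P" if "i \<in> {1..k n}" for i
        unfolding excess_def using kn' that
        by (intro borel_measurable_divide borel_measurable_diff order_stat_measurable borel_measurable_const) auto
      have B: "{y \<in> space ?P. \<not> good y} \<in> sets ?P"
      proof -
        have 1: "{y \<in> space ?P. \<forall>i\<in>{1..k n}. 0 \<le> excess y n (k n) sc i \<and> 1 + \<gamma> * excess y n (k n) sc i > 0 \<and>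
            excess y n (k n) sc i \<le> c * sqrt (k n) * (1 + \<gamma> * excess y n (k n) sc i)} \<in> sets ?P"
        proof (rule sets.sets_Collect_finite_All'[OF _ finite_atLeastAtMost])
          fix i assume "i \<in> {1..k n}"
          note exm[OF this, measurable]
          show "{y \<in> space ?P. 0 \<le> excess y n (k n) sc i \<and> 1 + \<gamma> * excess y n (k n) sc i > 0 \<and>
            excess y n (k n) sc i \<le> c * sqrt (k n) * (1 + \<gamma> * excess y n (k n) sc i)} \<in> sets ?P" by measurable
        qed (use kn' in auto)
        have 2: "{y \<in> space ?P. \<forall>\<Psi>\<in>S. \<bar>avg (k n) (\<lambda>i. \<Psi> (gq \<gamma> (excess y n (k n) sc i))) - (\<integral>p. \<Psi> p \<partial>expo)\<bar> \<le> C / sqrt (k n)} \<in> sets ?P"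
        proof (cases "S = {}")
          case False
          show ?thesis
          proof (rule sets.sets_Collect_finite_All'[OF _ S(1) False])
            fix \<Psi> assume "\<Psi> \<in> S"
            note [measurable] = \<Psi>m[OF this]
            have "(\<lambda>y. avg (k n) (\<lambda>i. \<Psi> (gq \<gamma> (excess y n (k n) sc i)))) \<in> borel_measurable ?P"
              unfolding avg_def
            proof (intro borel_measurable_divide borel_measurable_sum borel_measurable_const)
              fix i assume "i \<in> {1..k n}"
              note exm[OF this, measurable]
              show "(\<lambda>y. \<Psi> (gq \<gamma> (excess y n (k n) sc i))) \<in> borel_measurable ?P" by measurable
            qed
            note [measurable] = this
            show "{y \<in> space ?P. \<bar>avg (k n) (\<lambda>i. \<Psi> (gq \<gamma> (excess y n (k n) sc i))) - (\<integral>p. \<Psi> p \<partial>expo)\<bar> \<le> C / sqrt (k n)} \<in> sets ?P"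
              by measurable
          qed
        qed simp
        have "{y \<in> space ?P. \<not> good y} = space ?P - ({y \<in> space ?P. \<forall>i\<in>{1..k n}. 0 \<le> excess y n (k n) sc i \<and> 1 + \<gamma> * excess y n (k n) sc i > 0 \<and>
            excess y n (k n) sc i \<le> c * sqrt (k n) * (1 + \<gamma> * excess y n (k n) sc i)} \<inter>
          {y \<in> space ?P. \<forall>\<Psi>\<in>S. \<bar>avg (k n) (\<lambda>i. \<Psi> (gq \<gamma> (excess y n (k n) sc i))) - (\<integral>p. \<Psi> p \<partial>expo)\<bar> \<le> C / sqrt (k n)})"
          unfolding good_def by blast
        also have "\<dots> \<in> sets ?P" by (intro sets.Diff sets.Int 1 2 sets.top)
        finally show ?thesis .
      qed
      have gr: "good (\<lambda>i\<in>{1..n}. y i) = good y" for y unfolding good_def excess_restrict ..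
      have inP: "(\<lambda>i\<in>{1..n}. y i) \<in> space ?P" for y :: "nat \<Rightarrow> real" by (simp add: space_PiM)
      obtain E where E: "E \<in> sets (expo_sample n)" "measure (expo_sample n) E \<le> \<delta>"
        and gE: "\<And>\<omega>. \<omega> \<in> space (expo_sample n) - E \<Longrightarrow> good (\<lambda>i. exp_quantile F (\<omega> i))"
        using elim(1) unfolding good_def sc_def Let_def by blast
      interpret EE: prob_space "expo_sample n" by (rule prob_space_expo_sample)
      have n0: "n > 0" using kn' by simp
      note T = sample_law_transfer[OF M iv F n0 B]
      show ?case
      proof (rule bexI[of _ "{\<omega> \<in> space M. (\<lambda>i\<in>{1..n}. Y i \<omega>) \<in> {y \<in> space ?P. \<not> good y}}"], intro conjI ballI)
        have "EE.prob {e \<in> space (expo_sample n). (\<lambda>i\<in>{1..n}. exp_quantile F (e i)) \<in> {y \<in> space ?P. \<not> good y}} \<le> EE.prob E"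
          by (rule EE.finite_measure_mono[OF _ E(1)]) (use gE gr in blast)
        then show "measure M {\<omega> \<in> space M. (\<lambda>i\<in>{1..n}. Y i \<omega>) \<in> {y \<in> space ?P. \<not> good y}} \<le> \<delta>"
          using T(2) E(2) by simp
        show "{\<omega> \<in> space M. (\<lambda>i\<in>{1..n}. Y i \<omega>) \<in> {y \<in> space ?P. \<not> good y}} \<in> sets M" by (rule T(1))
        fix \<omega> assume "\<omega> \<in> space M - {\<omega> \<in> space M. (\<lambda>i\<in>{1..n}. Y i \<omega>) \<in> {y \<in> space ?P. \<not> good y}}"
        then have "good (\<lambda>i\<in>{1..n}. Y i \<omega>)" using inP by blast
        then have "good (\<lambda>i. Y i \<omega>)" unfolding gr .
        then show "let z = excess (\<lambda>i. Y i \<omega>) n (k n) (a (real n / real (k n))) in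
        (\<forall>i\<in>{1..k n}. 0 \<le> z i \<and> 1 + \<gamma> * z i > 0 \<and> z i \<le> c * sqrt (k n) * (1 + \<gamma> * z i)) \<and>
        (\<forall>\<Psi>\<in>S. \<bar>avg (k n) (\<lambda>i. \<Psi> (gq \<gamma> (z i))) - (\<integral>p. \<Psi> p \<partial>expo)\<bar> \<le> C / sqrt (k n))"
          unfolding good_def Let_def sc_def .
      qed
    qed
  qed
qed

section \<open>Consistency of the local maximum likelihood estimator\<close>

lemma O_P_I:
  assumes "\<And>\<delta>. \<delta> > 0 \<Longrightarrow> \<exists>C. \<forall>\<^sub>F n in sequentially. \<exists>E\<in>sets M. measure M E \<le> \<delta> \<and>
     (\<forall>\<omega>\<in>space M - E. \<bar>X n \<omega>\<bar> \<le> C * r n)"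
  shows "O_P M X r"
  unfolding O_P_def
proof (intro allI impI)
  fix \<delta> :: real assume "\<delta> > 0"
  from assms[OF this] obtain C where "\<forall>\<^sub>F n in sequentially. \<exists>E\<in>sets M. measure M E \<le> \<delta> \<and>
     (\<forall>\<omega>\<in>space M - E. \<bar>X n \<omega>\<bar> \<le> C * r n)" by blast
  then show "\<exists>C. \<forall>\<^sub>F n in sequentially. \<exists>E\<in>sets M. {\<omega> \<in> space M. \<bar>X n \<omega>\<bar> > C * r n} \<subseteq> E \<and> measure M E \<le> \<delta>"
  proof (intro exI[of _ C], elim eventually_mono)
    fix n assume "\<exists>E\<in>sets M. measure M E \<le> \<delta> \<and> (\<forall>\<omega>\<in>space M - E. \<bar>X n \<omega>\<bar> \<le> C * r n)"
    then obtain E where E: "E \<in> sets M" "measure M E \<le> \<delta>" "\<And>\<omega>. \<omega> \<in> space M - E \<Longrightarrow> \<bar>X n \<omega>\<bar> \<le> C * r n" by blast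
    have "{\<omega> \<in> space M. \<bar>X n \<omega>\<bar> > C * r n} \<subseteq> E"
    proof
      fix \<omega> assume \<omega>: "\<omega> \<in> {\<omega> \<in> space M. \<bar>X n \<omega>\<bar> > C * r n}"
      show "\<omega> \<in> E"
      proof (rule ccontr)
        assume "\<omega> \<notin> E"
        then have "\<bar>X n \<omega>\<bar> \<le> C * r n" using \<omega> by (intro E(3)) simp
        then show False using \<omega> by simp
      qed
    qed
    then show "\<exists>E\<in>sets M. {\<omega> \<in> space M. \<bar>X n \<omega>\<bar> > C * r n} \<subseteq> E \<and> measure M E \<le> \<delta>" using E(1,2) by blast
  qed
qed

text \<open>Uniqueness need not be a measurable event. Its inner probability is nearly attained by measurable subsets, one
  for each \<open>n\<close>, and these probabilities tend to one.\<close>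

lemma prob_tends_to_one_I:
  assumes "prob_space M"
    and ev: "\<And>\<delta>. \<delta> > 0 \<Longrightarrow> \<forall>\<^sub>F n in sequentially. \<exists>E\<in>sets M. measure M E \<le> \<delta> \<and> (\<forall>\<omega>\<in>space M - E. P n \<omega>)"
  shows "prob_tends_to_one M P"
proof -
  interpret prob_space M by fact
  define G where "G = (\<lambda>n. {E \<in> sets M. E \<subseteq> {\<omega> \<in> space M. P n \<omega>}})"
  define v where "v = (\<lambda>n. SUP E\<in>G n. prob E)"
  have ne: "G n \<noteq> {}" for n by (auto simp: G_def intro!: exI[of _ "{}"])
  have bdd: "bdd_above (prob ` G n)" for n by (rule bdd_aboveI[of _ 1]) auto
  have "\<exists>E\<in>G n. v n - 1 / real (Suc n) < prob E" for n
  proof -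
    have "v n - 1 / real (Suc n) < v n" by simp
    then show ?thesis unfolding v_def by (subst (asm) less_cSUP_iff[OF ne bdd]) auto
  qed
  then obtain E where E: "\<And>n. E n \<in> G n" "\<And>n. v n - 1 / real (Suc n) < prob (E n)" by metis
  have "(\<lambda>n. prob (E n)) \<longlonglongrightarrow> 1"
  proof (rule LIMSEQ_I)
    fix r :: real assume r: "r > 0"
    have "\<forall>\<^sub>F n in sequentially. 1 / real (Suc n) < r / 2"
    proof -
      have "(\<lambda>n. 1 / real (Suc n)) \<longlonglongrightarrow> 0" by real_asymp
      then show ?thesis using r by (intro order_tendstoD) auto
    qed
    moreover have "\<forall>\<^sub>F n in sequentially. \<exists>E\<in>sets M. measure M E \<le> r / 2 \<and> (\<forall>\<omega>\<in>space M - E. P n \<omega>)"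
      by (rule ev) (use r in simp)
    ultimately have "\<forall>\<^sub>F n in sequentially. norm (prob (E n) - 1) < r"
    proof eventually_elim
      case (elim n)
      then obtain B where B: "B \<in> sets M" "prob B \<le> r / 2" "\<forall>\<omega>\<in>space M - B. P n \<omega>" by blast
      have "space M - B \<in> G n" using B by (auto simp: G_def)
      then have "prob (space M - B) \<le> v n" unfolding v_def by (intro cSUP_upper bdd)
      moreover have "prob (space M - B) = 1 - prob B" by (rule prob_compl[OF B(1)])
      ultimately show ?case using elim(1) B(2) E(2)[of n] prob_le_1[of "E n"] r
        unfolding real_norm_def by linarith
    qed
    then show "\<exists>no. \<forall>n\<ge>no. norm (prob (E n) - 1) < r" by (simp add: eventually_sequentially)
  qed
  then show ?thesis unfolding prob_tends_to_one_def using E(1) by (auto simp: G_def)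
qed

lemma inv_into_rescale:
  assumes "s > 0" "\<theta> \<in> Theta"
  shows "inv_into Theta (rescale s) \<theta> = (fst \<theta>, snd \<theta> * s)"
proof (rule inv_into_f_eq)
  show "inj_on (rescale s) Theta" using assms(1) by (auto simp: inj_on_def rescale_def)
  show "(fst \<theta>, snd \<theta> * s) \<in> Theta" using assms by (auto simp: Theta_def)
  show "rescale s (fst \<theta>, snd \<theta> * s) = \<theta>" using assms(1) by (simp add: rescale_def)
qed

lemma abs_coordinate_le_norm:
  fixes x :: "real \<times> real"
  shows "\<bar>fst x\<bar> \<le> norm x" "\<bar>snd x\<bar> \<le> norm x"
  using norm_fst_le[of "fst x" "snd x"] norm_snd_le[of "snd x" "fst x"] by simp_all

lemma intermediate_ratio_at_top:
  fixes k :: "nat \<Rightarrow> nat"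
  assumes k: "filterlim k at_top sequentially" and kn: "(\<lambda>n. real (k n)) \<in> o(\<lambda>n. real n)"
  shows "filterlim (\<lambda>n. real n / real (k n)) at_top sequentially"
proof -
  have "\<forall>\<^sub>F n in sequentially. k n \<ge> 1" using k unfolding filterlim_at_top by blast
  then have "\<forall>\<^sub>F n in sequentially. 0 < real (k n) / real n"
    using eventually_gt_at_top[of 0] by eventually_elim simp
  moreover have "((\<lambda>n. real (k n) / real n) \<longlongrightarrow> 0) sequentially" by (rule smalloD_tendsto[OF kn])
  ultimately have "filterlim (\<lambda>n. inverse (real (k n) / real n)) at_top sequentially"
    by (intro filterlim_inverse_at_top)
  then show ?thesis by (simp add: field_simps)
qed

text \<open>The radius \<open>\<epsilon>\<close> is fixed before \<open>\<delta>\<close>: the tolerance and the truncation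
  level depend on \<open>\<gamma>0\<close> only, whereas the constant \<open>C\<close> of the fluctuations grows
  as \<open>\<delta>\<close> decreases.\<close>

theorem local_mle_rate:
  fixes M :: "'a measure" and Y :: "nat \<Rightarrow> 'a \<Rightarrow> real"
    and F0 a0 A :: "real \<Rightarrow> real" and k :: "nat \<Rightarrow> nat" and \<gamma>0 \<rho> l :: real
  assumes M: "prob_space M"
    and iv: "prob_space.indep_vars M (\<lambda>_. borel) Y {1..}"
    and F: "\<And>i. i \<ge> 1 \<Longrightarrow> cdf (distr M borel (Y i)) = F0"
    and k: "filterlim k at_top sequentially" and kn: "(\<lambda>n. real (k n)) \<in> o(\<lambda>n. real n)"
    and \<gamma>0: "\<gamma>0 > -1/2" and ga: "gev_attraction F0 \<gamma>0 a0" and so: "second_order F0 \<gamma>0 a0 A \<rho>"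
    and lim: "(\<lambda>n. sqrt (real (k n)) * A (real n / real (k n))) \<longlonglongrightarrow> l"
  shows "\<exists>\<epsilon>>0. \<forall>\<delta>>0. \<exists>C>0. \<forall>\<^sub>F n in sequentially. \<exists>E\<in>sets M. measure M E \<le> \<delta> \<and>
     (\<forall>\<omega>\<in>space M - E. \<exists>\<theta>. local_argmax (\<lambda>i. Y i \<omega>) n (k n) (a0 (real n / real (k n))) (\<gamma>0, 1) \<epsilon> = {\<theta>}
        \<and> norm (\<theta> - (\<gamma>0, 1)) \<le> C / sqrt (k n))"
proof -
  interpret M: prob_space M by (rule M)
  have rv: "Y 1 \<in> borel_measurable M" using iv unfolding M.indep_vars_def by auto
  have D: "real_distribution (distr M borel (Y 1))" by (rule M.real_distribution_distr[OF rv])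
  have F1: "F0 = cdf (distr M borel (Y 1))" using F[of 1] by simp
  have sot: "second_order_tail (tail_quantile F0) a0 A \<gamma>0 \<rho>"
  proof
    show "mono_on {1<..} (tail_quantile F0)" unfolding F1 by (rule tail_quantile_mono[OF D])
    show "t > 1 \<Longrightarrow> a0 t > 0" for t using ga by (simp add: gev_attraction_def)
    show "t > 1 \<Longrightarrow> A t \<noteq> 0" for t using so by (force simp: second_order_def)
    show "(A \<longlongrightarrow> 0) at_top" "\<rho> \<le> 0" using so by (auto simp: second_order_def)
    show "A \<in> borel_measurable (lebesgue_on {1<..})" using so by (simp add: second_order_def regularly_varying_def)
    show "x > 0 \<Longrightarrow> ((\<lambda>t. A (t * x) / A t) \<longlongrightarrow> x powr \<rho>) at_top" for x
      using so by (simp add: second_order_def regularly_varying_def)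
    show "x > 0 \<Longrightarrow> \<exists>h. ((\<lambda>t. ((tail_quantile F0 (t * x) - tail_quantile F0 t) / a0 t - box_cox \<gamma>0 x) / A t) \<longlongrightarrow> h) at_top" for x
      using so unfolding second_order_def by blast
  qed
  have kr: "filterlim (\<lambda>n. real (k n)) at_top sequentially"
    by (rule filterlim_compose[OF filterlim_real_sequentially k])
  have k1: "\<forall>\<^sub>F n in sequentially. k n > 0"
  proof -
    have "\<forall>\<^sub>F n in sequentially. k n \<ge> 1" using k unfolding filterlim_at_top by blast
    then show ?thesis by eventually_elim simp
  qed
  have kn': "filterlim (\<lambda>n. real n / real (k n)) at_top sequentially"
    by (rule intermediate_ratio_at_top[OF k kn])
  define A0 where "A0 = \<bar>l\<bar> + 1"
  have A0p: "0 \<le> A0" by (simp add: A0_def)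
  have At: "\<forall>\<^sub>F n in sequentially. \<bar>A (real n / real (k n))\<bar> \<le> A0 / sqrt (k n)"
  proof -
    have "\<forall>\<^sub>F n in sequentially. \<bar>sqrt (real (k n)) * A (real n / real (k n))\<bar> < A0"
      using tendsto_rabs[OF lim] by (rule order_tendstoD) (simp add: A0_def)
    then show ?thesis using k1
      by eventually_elim (simp add: abs_mult pos_le_divide_eq mult.commute less_imp_le)
  qed
  \<comment> \<open>The exponent \<open>b\<close> is halfway between \<open>max (-\<gamma>0) 0\<close> and \<open>1/2\<close>.\<close>
  define e where "e = (1/2 - max (- \<gamma>0) 0) / 2"
  define b where "b = max (- \<gamma>0) 0 + e"
  have e: "e > 0" and b2: "b < 1/2" and b0: "0 \<le> b" using \<gamma>0 by (auto simp: e_def b_def max_def)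
  obtain \<eta>' where \<eta>': "\<eta>' > 0" and det: "\<And>K. K \<ge> 2 \<Longrightarrow> 1 + \<gamma>0 * K > 0 \<Longrightarrow> (\<exists>\<epsilon>>0. \<forall>C>0. \<exists>c>0. \<exists>k0 C'. \<forall>k\<ge>k0. \<forall>z :: nat \<Rightarrow> real.
     (\<forall>i\<in>{1..k}. 0 \<le> z i \<and> 1 + \<gamma>0 * z i > 0 \<and> z i \<le> c * sqrt k * (1 + \<gamma>0 * z i)) \<longrightarrow>
     \<bar>avg k (\<lambda>i. gint 0 1 \<gamma>0 (z i)) - 1\<bar> \<le> C / sqrt k \<longrightarrow>
     \<bar>avg k (\<lambda>i. gint 0 2 \<gamma>0 (z i) - gint 1 2 \<gamma>0 (z i))\<bar> \<le> C / sqrt k \<longrightarrow>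
     avg k (\<lambda>i. gint 1 2 \<gamma>0 (z i)) \<le> C \<longrightarrow>
     (\<forall>(a, r)\<in>{(0, 1), (1, 2), (1, 3), (2, 3)}.
        \<bar>avg k (\<lambda>i. gint a r \<gamma>0 (min (z i) K)) - gmean \<gamma>0 a r\<bar> \<le> \<eta>') \<longrightarrow>
     (\<exists>\<theta>. {\<theta>. is_arg_max (\<lambda>\<theta>. ereal (1 / real k) * (\<Sum>i=1..k. gpd_loglik \<theta> (z i)))
              (\<lambda>\<theta>. \<theta> \<in> Theta \<and> norm (\<theta> - (\<gamma>0, 1)) < \<epsilon>) \<theta>} = {\<theta>}
         \<and> norm (\<theta> - (\<gamma>0, 1)) \<le> C' / sqrt k))"
    using gpd_unique_local_argmax[OF \<gamma>0] by blast
  define Q :: "(nat \<times> nat) set" where "Q = {(0, 1), (1, 2), (1, 3), (2, 3)}"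
  have gm: "(a, r, gmean \<gamma>0 a r) \<in> gmeans \<gamma>0" if "(a, r) \<in> Q" for a r
    using that by (auto simp: Q_def gmeans_def gmean_def)
  have "\<forall>\<^sub>F n in sequentially. \<forall>(a, r)\<in>Q. \<bar>(\<integral>p. zint \<gamma>0 a r (min p (real n)) \<partial>expo) - gmean \<gamma>0 a r\<bar> < \<eta>' / 2"
  proof (rule eventually_ball_finite)
    show "finite Q" by (simp add: Q_def)
    show "\<forall>x\<in>Q. \<forall>\<^sub>F n in sequentially. case x of (a, r) \<Rightarrow> \<bar>(\<integral>p. zint \<gamma>0 a r (min p (real n)) \<partial>expo) - gmean \<gamma>0 a r\<bar> < \<eta>' / 2"
    proof safe
      fix a r assume "(a, r) \<in> Q"
      from tendstoD[OF zint_trunc_mean_tendsto[OF \<gamma>0 gm[OF this]], of "\<eta>' / 2"]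
      show "\<forall>\<^sub>F n in sequentially. \<bar>(\<integral>p. zint \<gamma>0 a r (min p (real n)) \<partial>expo) - gmean \<gamma>0 a r\<bar> < \<eta>' / 2"
        using \<eta>' by (simp add: dist_real_def)
    qed
  qed
  then have "\<forall>\<^sub>F n in sequentially. (\<forall>(a, r)\<in>Q. \<bar>(\<integral>p. zint \<gamma>0 a r (min p (real n)) \<partial>expo) - gmean \<gamma>0 a r\<bar> < \<eta>' / 2) \<and> 2 \<le> zeta \<gamma>0 (real n)"
    using zeta_eventually_ge_2[OF \<gamma>0] by (rule eventually_conj)
  then obtain m :: nat where m: "\<forall>(a, r)\<in>Q. \<bar>(\<integral>p. zint \<gamma>0 a r (min p (real m)) \<partial>expo) - gmean \<gamma>0 a r\<bar> < \<eta>' / 2" "2 \<le> zeta \<gamma>0 (real m)"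
    using eventually_happens'[OF sequentially_bot] by blast
  define K where "K = zeta \<gamma>0 (real m)"
  have K: "K \<ge> 2" "1 + \<gamma>0 * K > 0" using m by (simp_all add: K_def one_plus_zeta)
  from det[OF K] obtain \<epsilon> where \<epsilon>: "\<epsilon> > 0" and det2: "\<And>C. C > 0 \<Longrightarrow> \<exists>c>0. \<exists>k0 C'. \<forall>k\<ge>k0. \<forall>z :: nat \<Rightarrow> real.
     (\<forall>i\<in>{1..k}. 0 \<le> z i \<and> 1 + \<gamma>0 * z i > 0 \<and> z i \<le> c * sqrt k * (1 + \<gamma>0 * z i)) \<longrightarrow>
     \<bar>avg k (\<lambda>i. gint 0 1 \<gamma>0 (z i)) - 1\<bar> \<le> C / sqrt k \<longrightarrow>
     \<bar>avg k (\<lambda>i. gint 0 2 \<gamma>0 (z i) - gint 1 2 \<gamma>0 (z i))\<bar> \<le> C / sqrt k \<longrightarrow>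
     avg k (\<lambda>i. gint 1 2 \<gamma>0 (z i)) \<le> C \<longrightarrow>
     (\<forall>(a, r)\<in>{(0, 1), (1, 2), (1, 3), (2, 3)}.
        \<bar>avg k (\<lambda>i. gint a r \<gamma>0 (min (z i) K)) - gmean \<gamma>0 a r\<bar> \<le> \<eta>') \<longrightarrow>
     (\<exists>\<theta>. {\<theta>. is_arg_max (\<lambda>\<theta>. ereal (1 / real k) * (\<Sum>i=1..k. gpd_loglik \<theta> (z i)))
              (\<lambda>\<theta>. \<theta> \<in> Theta \<and> norm (\<theta> - (\<gamma>0, 1)) < \<epsilon>) \<theta>} = {\<theta>}
         \<and> norm (\<theta> - (\<gamma>0, 1)) \<le> C' / sqrt k)" by blast
  define \<Psi>t where "\<Psi>t = (\<lambda>(a, r) p. zint \<gamma>0 a r (min p (real m)))"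
  define \<Psi>s where "\<Psi>s = (\<lambda>p. zint \<gamma>0 0 2 p - zint \<gamma>0 1 2 p)"
  define S where "S = \<Psi>t ` Q \<union> {zint \<gamma>0 0 1, zint \<gamma>0 1 2, \<Psi>s}"
  have L01: "exp_lipschitz b 1 (zint \<gamma>0 0 1)" "exp_lipschitz b 1 (zint \<gamma>0 0 2)" "exp_lipschitz b (1 / e) (zint \<gamma>0 1 2)"
    using zker_bounds[OF _ e, of _ \<gamma>0] e b0 unfolding b_def[symmetric]
    by (auto intro!: zint_exp_lipschitz)
  have Ls: "exp_lipschitz b (1 + 1 / e) \<Psi>s" unfolding \<Psi>s_def by (rule exp_lipschitz_diff[OF L01(2,3)])
  have finS: "finite S" by (simp add: S_def Q_def)
  have "\<exists>C\<ge>0. exp_lipschitz b C \<Psi>" if "\<Psi> \<in> S" for \<Psi>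
  proof -
    from that consider q where "q \<in> Q" "\<Psi> = \<Psi>t q" | "\<Psi> = zint \<gamma>0 0 1" | "\<Psi> = zint \<gamma>0 1 2" | "\<Psi> = \<Psi>s"
      by (auto simp: S_def)
    then show ?thesis
    proof cases
      case 1
      obtain a r where "q = (a, r)" by (cases q)
      then show ?thesis using 1 zint_trunc_exp_lipschitz[of "real m" b \<gamma>0 a r] b0 by (simp add: \<Psi>t_def)
    next
      case 2 then show ?thesis using L01(1) by (intro exI[of _ 1]) simp
    next
      case 3 then show ?thesis using L01(3) e by (intro exI[of _ "1 / e"]) simp
    next
      case 4 then show ?thesis using Ls e by (intro exI[of _ "1 + 1 / e"]) simp
    qed
  qed
  then obtain Cf where Cf: "\<And>\<Psi>. \<Psi> \<in> S \<Longrightarrow> Cf \<Psi> \<ge> 0 \<and> exp_lipschitz b (Cf \<Psi>) \<Psi>" by metis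
  define C0 where "C0 = (\<Sum>\<Psi>\<in>S. Cf \<Psi>)"
  have C0: "0 \<le> C0" using Cf by (auto simp: C0_def intro!: sum_nonneg)
  have SL: "exp_lipschitz b C0 \<Psi>" if "\<Psi> \<in> S" for \<Psi>
  proof (rule exp_lipschitz_mono)
    show "exp_lipschitz b (Cf \<Psi>) \<Psi>" using Cf[OF that] by simp
    show "Cf \<Psi> \<le> C0" unfolding C0_def using Cf that by (intro member_le_sum finS) auto
  qed
  have means: "(\<integral>p. zint \<gamma>0 0 1 p \<partial>expo) = 1" "(\<integral>p. zint \<gamma>0 1 2 p \<partial>expo) = 1 / (1 + \<gamma>0)" "(\<integral>p. \<Psi>s p \<partial>expo) = 0"
    using zint_mean[OF \<gamma>0, of 0 1 1] zint_mean[OF \<gamma>0, of 1 2 "1 / (1 + \<gamma>0)"] zint_mean[OF \<gamma>0, of 0 2 "1 / (1 + \<gamma>0)"]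
    by (auto simp: \<Psi>s_def gmeans_def)
  show ?thesis
  proof (rule exI[of _ \<epsilon>], rule conjI[OF \<epsilon>], intro allI impI)
    fix \<delta> :: real assume \<delta>: "\<delta> > 0"
    obtain C where C: "C > 0" and stat: "\<And>c. c > 0 \<Longrightarrow> \<forall>\<^sub>F n in sequentially. \<exists>E\<in>sets M. measure M E \<le> \<delta> \<and>
     (\<forall>\<omega>\<in>space M - E. let z = excess (\<lambda>i. Y i \<omega>) n (k n) (a0 (real n / real (k n))) in
        (\<forall>i\<in>{1..k n}. 0 \<le> z i \<and> 1 + \<gamma>0 * z i > 0 \<and> z i \<le> c * sqrt (k n) * (1 + \<gamma>0 * z i)) \<and>
        (\<forall>\<Psi>\<in>S. \<bar>avg (k n) (\<lambda>i. \<Psi> (gq \<gamma>0 (z i))) - (\<integral>p. \<Psi> p \<partial>expo)\<bar> \<le> C / sqrt (k n)))"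
      using tail_statistics_sample[OF sot M iv F k kn' A0p At e b_def b2 finS SL C0 \<delta>] by blast
    define C1 where "C1 = C + 1 / (1 + \<gamma>0)"
    have C1: "C1 > 0" "C \<le> C1" using C \<gamma>0 by (auto simp: C1_def intro!: add_pos_pos)
    from det2[OF C1(1)] obtain c k0 C' where c: "c > 0" and det3: "\<forall>k\<ge>k0. \<forall>z :: nat \<Rightarrow> real.
     (\<forall>i\<in>{1..k}. 0 \<le> z i \<and> 1 + \<gamma>0 * z i > 0 \<and> z i \<le> c * sqrt k * (1 + \<gamma>0 * z i)) \<longrightarrow>
     \<bar>avg k (\<lambda>i. gint 0 1 \<gamma>0 (z i)) - 1\<bar> \<le> C1 / sqrt k \<longrightarrow>
     \<bar>avg k (\<lambda>i. gint 0 2 \<gamma>0 (z i) - gint 1 2 \<gamma>0 (z i))\<bar> \<le> C1 / sqrt k \<longrightarrow>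
     avg k (\<lambda>i. gint 1 2 \<gamma>0 (z i)) \<le> C1 \<longrightarrow>
     (\<forall>(a, r)\<in>{(0, 1), (1, 2), (1, 3), (2, 3)}.
        \<bar>avg k (\<lambda>i. gint a r \<gamma>0 (min (z i) K)) - gmean \<gamma>0 a r\<bar> \<le> \<eta>') \<longrightarrow>
     (\<exists>\<theta>. {\<theta>. is_arg_max (\<lambda>\<theta>. ereal (1 / real k) * (\<Sum>i=1..k. gpd_loglik \<theta> (z i)))
              (\<lambda>\<theta>. \<theta> \<in> Theta \<and> norm (\<theta> - (\<gamma>0, 1)) < \<epsilon>) \<theta>} = {\<theta>}
         \<and> norm (\<theta> - (\<gamma>0, 1)) \<le> C' / sqrt k)" by blast
    note det3 = det3[THEN spec, THEN mp, THEN spec, THEN mp, THEN mp, THEN mp, THEN mp, THEN mp]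
    have ev1: "\<forall>\<^sub>F n in sequentially. k n \<ge> max k0 1" using k unfolding filterlim_at_top by blast
    have ev2: "\<forall>\<^sub>F n in sequentially. C / sqrt (k n) < \<eta>' / 2"
    proof -
      have "((\<lambda>x. C / sqrt x) \<longlongrightarrow> 0) at_top" by real_asymp
      from filterlim_compose[OF this kr] show ?thesis using \<eta>' by (intro order_tendstoD) auto
    qed
    show "\<exists>C>0. \<forall>\<^sub>F n in sequentially. \<exists>E\<in>sets M. measure M E \<le> \<delta> \<and>
     (\<forall>\<omega>\<in>space M - E. \<exists>\<theta>. local_argmax (\<lambda>i. Y i \<omega>) n (k n) (a0 (real n / real (k n))) (\<gamma>0, 1) \<epsilon> = {\<theta>}
        \<and> norm (\<theta> - (\<gamma>0, 1)) \<le> C / sqrt (k n))"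
    proof (rule exI[of _ "max C' 1"], rule conjI)
      from stat[OF c] ev1 ev2
      show "\<forall>\<^sub>F n in sequentially. \<exists>E\<in>sets M. measure M E \<le> \<delta> \<and>
       (\<forall>\<omega>\<in>space M - E. \<exists>\<theta>. local_argmax (\<lambda>i. Y i \<omega>) n (k n) (a0 (real n / real (k n))) (\<gamma>0, 1) \<epsilon> = {\<theta>}
        \<and> norm (\<theta> - (\<gamma>0, 1)) \<le> max C' 1 / sqrt (k n))"
      proof eventually_elim
        case (elim n)
        from elim(1) obtain E where E: "E \<in> sets M" "measure M E \<le> \<delta>" and good: "\<And>\<omega>. \<omega> \<in> space M - E \<Longrightarrow>
          let z = excess (\<lambda>i. Y i \<omega>) n (k n) (a0 (real n / real (k n))) in
        (\<forall>i\<in>{1..k n}. 0 \<le> z i \<and> 1 + \<gamma>0 * z i > 0 \<and> z i \<le> c * sqrt (k n) * (1 + \<gamma>0 * z i)) \<and>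
        (\<forall>\<Psi>\<in>S. \<bar>avg (k n) (\<lambda>i. \<Psi> (gq \<gamma>0 (z i))) - (\<integral>p. \<Psi> p \<partial>expo)\<bar> \<le> C / sqrt (k n))" by blast
        show ?case
        proof (rule bexI[OF _ E(1)], rule conjI[OF E(2)], rule ballI)
          fix \<omega> assume \<omega>: "\<omega> \<in> space M - E"
          define z where "z = excess (\<lambda>i. Y i \<omega>) n (k n) (a0 (real n / real (k n)))"
          have z: "\<forall>i\<in>{1..k n}. 0 \<le> z i \<and> 1 + \<gamma>0 * z i > 0 \<and> z i \<le> c * sqrt (k n) * (1 + \<gamma>0 * z i)"
            and st: "\<And>\<Psi>. \<Psi> \<in> S \<Longrightarrow> \<bar>avg (k n) (\<lambda>i. \<Psi> (gq \<gamma>0 (z i))) - (\<integral>p. \<Psi> p \<partial>expo)\<bar> \<le> C / sqrt (k n)"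
            using good[OF \<omega>] unfolding Let_def z_def[symmetric] by blast+
          have avg_cong: "avg (k n) f = avg (k n) g" if "\<And>i. i \<in> {1..k n} \<Longrightarrow> f i = g i" for f g
            unfolding avg_def by (rule arg_cong[where f = "\<lambda>x. x / real (k n)"], rule sum.cong[OF refl that])
          have conv: "avg (k n) (\<lambda>i. gint a r \<gamma>0 (z i)) = avg (k n) (\<lambda>i. zint \<gamma>0 a r (gq \<gamma>0 (z i)))" for a r
            by (rule avg_cong) (use z in \<open>auto intro!: gint_eq_zint\<close>)
          have convm: "avg (k n) (\<lambda>i. gint a r \<gamma>0 (min (z i) K)) = avg (k n) (\<lambda>i. \<Psi>t (a, r) (gq \<gamma>0 (z i)))" for a r
            unfolding \<Psi>t_def K_def prod.case by (rule avg_cong) (use z in \<open>auto intro!: gint_min_eq_zint\<close>)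
          have kn1: "1 \<le> sqrt (k n)" using elim(2) by simp
          have CC: "C / sqrt (k n) \<le> C1 / sqrt (k n)" using C1 kn1 by (intro divide_right_mono) auto
          have C2: "C / sqrt (k n) \<le> C" using kn1 C by (simp add: divide_le_eq mult_le_cancel_left1)
          have "\<exists>\<theta>. {\<theta>. is_arg_max (\<lambda>\<theta>. ereal (1 / real (k n)) * (\<Sum>i=1..k n. gpd_loglik \<theta> (z i)))
              (\<lambda>\<theta>. \<theta> \<in> Theta \<and> norm (\<theta> - (\<gamma>0, 1)) < \<epsilon>) \<theta>} = {\<theta>}
             \<and> norm (\<theta> - (\<gamma>0, 1)) \<le> C' / sqrt (k n)"
          proof (rule det3[OF _ z])
            show "k0 \<le> k n" using elim(2) by simp
            show "\<bar>avg (k n) (\<lambda>i. gint 0 1 \<gamma>0 (z i)) - 1\<bar> \<le> C1 / sqrt (k n)"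
              using st[of "zint \<gamma>0 0 1"] CC unfolding conv means by (simp add: S_def)
            have "avg (k n) (\<lambda>i. gint 0 2 \<gamma>0 (z i) - gint 1 2 \<gamma>0 (z i)) = avg (k n) (\<lambda>i. \<Psi>s (gq \<gamma>0 (z i)))"
              unfolding \<Psi>s_def avg_diff conv ..
            then show "\<bar>avg (k n) (\<lambda>i. gint 0 2 \<gamma>0 (z i) - gint 1 2 \<gamma>0 (z i))\<bar> \<le> C1 / sqrt (k n)"
              using st[of \<Psi>s] CC means(3) by (simp add: S_def)
            have "\<bar>avg (k n) (\<lambda>i. gint 1 2 \<gamma>0 (z i)) - 1 / (1 + \<gamma>0)\<bar> \<le> C / sqrt (k n)"
              using st[of "zint \<gamma>0 1 2"] means(2) unfolding conv by (simp add: S_def)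
            then show "avg (k n) (\<lambda>i. gint 1 2 \<gamma>0 (z i)) \<le> C1" using C2 unfolding C1_def by linarith
            show "\<forall>(a, r)\<in>{(0, 1), (1, 2), (1, 3), (2, 3)}.
              \<bar>avg (k n) (\<lambda>i. gint a r \<gamma>0 (min (z i) K)) - gmean \<gamma>0 a r\<bar> \<le> \<eta>'"
            proof (intro ballI, clarify)
              fix a r :: nat assume "(a, r) \<in> {(0, 1), (1, 2), (1, 3), (2, 3)}"
              then have q: "(a, r) \<in> Q" by (simp only: Q_def)
              then have "\<Psi>t (a, r) \<in> S" unfolding S_def by blast
              from st[OF this] have "\<bar>avg (k n) (\<lambda>i. gint a r \<gamma>0 (min (z i) K)) - (\<integral>p. \<Psi>t (a, r) p \<partial>expo)\<bar> \<le> C / sqrt (k n)"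
                unfolding convm .
              moreover have "\<bar>(\<integral>p. \<Psi>t (a, r) p \<partial>expo) - gmean \<gamma>0 a r\<bar> < \<eta>' / 2"
                using m(1) q unfolding \<Psi>t_def prod.case by blast
              ultimately show "\<bar>avg (k n) (\<lambda>i. gint a r \<gamma>0 (min (z i) K)) - gmean \<gamma>0 a r\<bar> \<le> \<eta>'"
                using elim(3) by linarith
            qed
          qed
          then obtain \<theta> where th: "{\<theta>. is_arg_max (\<lambda>\<theta>. ereal (1 / real (k n)) * (\<Sum>i=1..k n. gpd_loglik \<theta> (z i)))
              (\<lambda>\<theta>. \<theta> \<in> Theta \<and> norm (\<theta> - (\<gamma>0, 1)) < \<epsilon>) \<theta>} = {\<theta>}" "norm (\<theta> - (\<gamma>0, 1)) \<le> C' / sqrt (k n)" by blast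
          have "local_argmax (\<lambda>i. Y i \<omega>) n (k n) (a0 (real n / real (k n))) (\<gamma>0, 1) \<epsilon> = {\<theta>}"
            unfolding local_argmax_def loglik_def[abs_def] z_def[symmetric] by (rule th(1))
          moreover have "C' / sqrt (k n) \<le> max C' 1 / sqrt (k n)" by (intro divide_right_mono) auto
          ultimately show "\<exists>\<theta>. local_argmax (\<lambda>i. Y i \<omega>) n (k n) (a0 (real n / real (k n))) (\<gamma>0, 1) \<epsilon> = {\<theta>}
            \<and> norm (\<theta> - (\<gamma>0, 1)) \<le> max C' 1 / sqrt (k n)" using th(2) by (intro exI[of _ \<theta>]) auto
        qed
      qed
    qed simp
  qed
qed

text \<open>The sequence \<open>R\<close> is eventually at least one, so its claim is implied by the rate
  \<open>1/\<surd>k\<close>. The two coordinates of the rescaled estimator are those of the local one up to the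
  known scale.\<close>

theorem corollary2p2:
  fixes M :: "'a measure" and Y :: "nat \<Rightarrow> 'a \<Rightarrow> real"
    and F0 a0 A :: "real \<Rightarrow> real" and k :: "nat \<Rightarrow> nat"
    and \<gamma>0 \<rho> l :: real
  assumes "prob_space M"
    and iid: "prob_space.indep_vars M (\<lambda>_. borel) Y {1..}"
             "\<And>i. i \<ge> 1 \<Longrightarrow> cdf (distr M borel (Y i)) = F0"
    and intermediate: "filterlim k at_top sequentially"
                      "(\<lambda>n. real (k n)) \<in> o(\<lambda>n. real n)"
    and "\<gamma>0 > -1/2"
    and "gev_attraction F0 \<gamma>0 a0"
    and "second_order F0 \<gamma>0 a0 A \<rho>"
    and "(\<lambda>n. sqrt (real (k n)) * A (real n / real (k n))) \<longlonglongrightarrow> l"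
  defines "argmax \<equiv> (\<lambda>\<epsilon> n \<omega>. local_argmax (\<lambda>i. Y i \<omega>) n (k n) (a0 (real n / real (k n))) (\<gamma>0, 1) \<epsilon>)"
  shows "\<exists>\<epsilon>>0.
    (\<forall>\<theta>_hat :: nat \<Rightarrow> 'a \<Rightarrow> real \<times> real.
       (\<forall>n. \<forall>\<omega>\<in>space M. argmax \<epsilon> n \<omega> \<noteq> {} \<longrightarrow> \<theta>_hat n \<omega> \<in> argmax \<epsilon> n \<omega>) \<longrightarrow>
       (\<forall>R :: nat \<Rightarrow> real.
          filterlim R at_top sequentially \<and> R \<in> o(\<lambda>n. sqrt (real (k n))) \<longrightarrow>
          O_P M (\<lambda>n \<omega>. norm (\<theta>_hat n \<omega> - (\<gamma>0, 1))) (\<lambda>n. R n / sqrt (real (k n)))) \<and>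
       (let est = (\<lambda>n \<omega>. inv_into Theta (rescale (a0 (real n / real (k n)))) (\<theta>_hat n \<omega>));
            \<gamma>_hat = (\<lambda>n \<omega>. fst (est n \<omega>));
            \<sigma>_hat = (\<lambda>n \<omega>. snd (est n \<omega>))
        in O_P M (\<lambda>n \<omega>. \<gamma>_hat n \<omega> - \<gamma>0) (\<lambda>n. 1 / sqrt (real (k n))) \<and>
           O_P M (\<lambda>n \<omega>. \<sigma>_hat n \<omega> / a0 (real n / real (k n)) - 1) (\<lambda>n. 1 / sqrt (real (k n))))) \<and>
    prob_tends_to_one M (\<lambda>n \<omega>. \<exists>!\<theta>. \<theta> \<in> argmax \<epsilon> n \<omega>)"
proof -
  note M = assms(1) and \<gamma>0 = assms(6) and ga = assms(7) and so = assms(8) and lim = assms(9)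
  obtain \<epsilon> where \<epsilon>: "\<epsilon> > 0" and rate: "\<And>\<delta>. \<delta> > 0 \<Longrightarrow> \<exists>C>0. \<forall>\<^sub>F n in sequentially. \<exists>E\<in>sets M. measure M E \<le> \<delta> \<and>
     (\<forall>\<omega>\<in>space M - E. \<exists>\<theta>. argmax \<epsilon> n \<omega> = {\<theta>} \<and> norm (\<theta> - (\<gamma>0, 1)) \<le> C / sqrt (k n))"
    using local_mle_rate[OF M iid(1) iid(2) intermediate \<gamma>0 ga so lim] unfolding argmax_def by blast
  have unique: "prob_tends_to_one M (\<lambda>n \<omega>. \<exists>!\<theta>. \<theta> \<in> argmax \<epsilon> n \<omega>)"
  proof (rule prob_tends_to_one_I[OF M])
    fix \<delta> :: real assume "\<delta> > 0"
    from rate[OF this] obtain C where "\<forall>\<^sub>F n in sequentially. \<exists>E\<in>sets M. measure M E \<le> \<delta> \<and>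
     (\<forall>\<omega>\<in>space M - E. \<exists>\<theta>. argmax \<epsilon> n \<omega> = {\<theta>} \<and> norm (\<theta> - (\<gamma>0, 1)) \<le> C / sqrt (k n))" by blast
    then show "\<forall>\<^sub>F n in sequentially. \<exists>E\<in>sets M. measure M E \<le> \<delta> \<and> (\<forall>\<omega>\<in>space M - E. \<exists>!\<theta>. \<theta> \<in> argmax \<epsilon> n \<omega>)"
    proof eventually_elim
      case (elim n)
      then obtain E where E: "E \<in> sets M" "measure M E \<le> \<delta>"
        and g: "\<And>\<omega>. \<omega> \<in> space M - E \<Longrightarrow> \<exists>\<theta>. argmax \<epsilon> n \<omega> = {\<theta>} \<and> norm (\<theta> - (\<gamma>0, 1)) \<le> C / sqrt (k n)" by blast
      have "\<exists>!\<theta>. \<theta> \<in> argmax \<epsilon> n \<omega>" if \<omega>: "\<omega> \<in> space M - E" for \<omega>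
      proof -
        from g[OF \<omega>] obtain \<theta> where "argmax \<epsilon> n \<omega> = {\<theta>}" by blast
        then show ?thesis by simp
      qed
      then show ?case using E by blast
    qed
  qed
  have scale: "\<forall>\<^sub>F n in sequentially. a0 (real n / real (k n)) > 0"
  proof -
    have "\<forall>\<^sub>F n in sequentially. real n / real (k n) \<ge> 2"
      using intermediate_ratio_at_top[OF intermediate] unfolding filterlim_at_top by blast
    then show ?thesis by eventually_elim (use ga in \<open>auto simp: gev_attraction_def\<close>)
  qed
  have est: "(\<forall>R :: nat \<Rightarrow> real. filterlim R at_top sequentially \<and> R \<in> o(\<lambda>n. sqrt (real (k n))) \<longrightarrow>
          O_P M (\<lambda>n \<omega>. norm (\<theta>_hat n \<omega> - (\<gamma>0, 1))) (\<lambda>n. R n / sqrt (real (k n)))) \<and>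
       (let est = (\<lambda>n \<omega>. inv_into Theta (rescale (a0 (real n / real (k n)))) (\<theta>_hat n \<omega>));
            \<gamma>_hat = (\<lambda>n \<omega>. fst (est n \<omega>));
            \<sigma>_hat = (\<lambda>n \<omega>. snd (est n \<omega>))
        in O_P M (\<lambda>n \<omega>. \<gamma>_hat n \<omega> - \<gamma>0) (\<lambda>n. 1 / sqrt (real (k n))) \<and>
           O_P M (\<lambda>n \<omega>. \<sigma>_hat n \<omega> / a0 (real n / real (k n)) - 1) (\<lambda>n. 1 / sqrt (real (k n))))"
    if sel: "\<forall>n. \<forall>\<omega>\<in>space M. argmax \<epsilon> n \<omega> \<noteq> {} \<longrightarrow> \<theta>_hat n \<omega> \<in> argmax \<epsilon> n \<omega>"
    for \<theta>_hat :: "nat \<Rightarrow> 'a \<Rightarrow> real \<times> real"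
  proof -
    \<comment> \<open>On the good event the maximiser is the selected point, whatever the selection.\<close>
    have sel_rate: "\<exists>C>0. \<forall>\<^sub>F n in sequentially. \<exists>E\<in>sets M. measure M E \<le> \<delta> \<and>
     (\<forall>\<omega>\<in>space M - E. \<theta>_hat n \<omega> \<in> Theta \<and> norm (\<theta>_hat n \<omega> - (\<gamma>0, 1)) \<le> C / sqrt (k n))" if \<delta>: "\<delta> > 0" for \<delta>
    proof -
      from rate[OF \<delta>] obtain C where C: "C > 0" and ev: "\<forall>\<^sub>F n in sequentially. \<exists>E\<in>sets M. measure M E \<le> \<delta> \<and>
       (\<forall>\<omega>\<in>space M - E. \<exists>\<theta>. argmax \<epsilon> n \<omega> = {\<theta>} \<and> norm (\<theta> - (\<gamma>0, 1)) \<le> C / sqrt (k n))" by blast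
      have "\<forall>\<^sub>F n in sequentially. \<exists>E\<in>sets M. measure M E \<le> \<delta> \<and>
       (\<forall>\<omega>\<in>space M - E. \<theta>_hat n \<omega> \<in> Theta \<and> norm (\<theta>_hat n \<omega> - (\<gamma>0, 1)) \<le> C / sqrt (k n))"
        using ev
      proof eventually_elim
        case (elim n)
        then obtain E where E: "E \<in> sets M" "measure M E \<le> \<delta>"
          and g: "\<And>\<omega>. \<omega> \<in> space M - E \<Longrightarrow> \<exists>\<theta>. argmax \<epsilon> n \<omega> = {\<theta>} \<and> norm (\<theta> - (\<gamma>0, 1)) \<le> C / sqrt (k n)" by blast
        have "\<theta>_hat n \<omega> \<in> Theta \<and> norm (\<theta>_hat n \<omega> - (\<gamma>0, 1)) \<le> C / sqrt (k n)" if \<omega>: "\<omega> \<in> space M - E" for \<omega>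
        proof -
          from g[OF \<omega>] obtain \<theta> where th: "argmax \<epsilon> n \<omega> = {\<theta>}" "norm (\<theta> - (\<gamma>0, 1)) \<le> C / sqrt (k n)" by blast
          have "\<theta>_hat n \<omega> \<in> argmax \<epsilon> n \<omega>" using sel \<omega> th(1) by blast
          then have eq: "\<theta>_hat n \<omega> = \<theta>" using th(1) by simp
          have "\<theta> \<in> argmax \<epsilon> n \<omega>" using th(1) by simp
          then have "\<theta> \<in> Theta" unfolding argmax_def local_argmax_def is_arg_max_def by simp
          then show ?thesis using th(2) eq by simp
        qed
        then show ?case using E by blast
      qed
      then show ?thesis using C by blast
    qed
    have bound: "O_P M X r"
      if imp: "\<And>C. C > 0 \<Longrightarrow> \<forall>\<^sub>F n in sequentially. \<forall>\<omega>. \<theta>_hat n \<omega> \<in> Theta \<and>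
          norm (\<theta>_hat n \<omega> - (\<gamma>0, 1)) \<le> C / sqrt (k n) \<longrightarrow> \<bar>X n \<omega>\<bar> \<le> C * r n" for X r
    proof (rule O_P_I)
      fix \<delta> :: real assume "\<delta> > 0"
      from sel_rate[OF this] obtain C where C: "C > 0" and ev: "\<forall>\<^sub>F n in sequentially. \<exists>E\<in>sets M. measure M E \<le> \<delta> \<and>
       (\<forall>\<omega>\<in>space M - E. \<theta>_hat n \<omega> \<in> Theta \<and> norm (\<theta>_hat n \<omega> - (\<gamma>0, 1)) \<le> C / sqrt (k n))" by blast
      have "\<forall>\<^sub>F n in sequentially. \<exists>E\<in>sets M. measure M E \<le> \<delta> \<and> (\<forall>\<omega>\<in>space M - E. \<bar>X n \<omega>\<bar> \<le> C * r n)"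
        using ev imp[OF C] by eventually_elim blast
      then show "\<exists>C. \<forall>\<^sub>F n in sequentially. \<exists>E\<in>sets M. measure M E \<le> \<delta> \<and> (\<forall>\<omega>\<in>space M - E. \<bar>X n \<omega>\<bar> \<le> C * r n)" by blast
    qed
    have "O_P M (\<lambda>n \<omega>. norm (\<theta>_hat n \<omega> - (\<gamma>0, 1))) (\<lambda>n. R n / sqrt (real (k n)))"
      if R: "filterlim R at_top sequentially" for R :: "nat \<Rightarrow> real"
    proof (rule bound)
      fix C :: real assume C: "C > 0"
      have "\<forall>\<^sub>F n in sequentially. R n \<ge> 1" using R unfolding filterlim_at_top by blast
      then show "\<forall>\<^sub>F n in sequentially. \<forall>\<omega>. \<theta>_hat n \<omega> \<in> Theta \<and> norm (\<theta>_hat n \<omega> - (\<gamma>0, 1)) \<le> C / sqrt (k n) \<longrightarrow>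
         \<bar>norm (\<theta>_hat n \<omega> - (\<gamma>0, 1))\<bar> \<le> C * (R n / sqrt (real (k n)))"
      proof eventually_elim
        case (elim n)
        have "C * 1 \<le> C * R n" using elim C by (intro mult_left_mono) auto
        then have "C / sqrt (k n) \<le> C * R n / sqrt (k n)" by (intro divide_right_mono) auto
        then show ?case by (auto simp only: abs_norm_cancel times_divide_eq_right)
      qed
    qed
    moreover have "O_P M (\<lambda>n \<omega>. fst (inv_into Theta (rescale (a0 (real n / real (k n)))) (\<theta>_hat n \<omega>)) - \<gamma>0) (\<lambda>n. 1 / sqrt (real (k n)))"
    proof (rule bound)
      fix C :: real
      from scale show "\<forall>\<^sub>F n in sequentially. \<forall>\<omega>. \<theta>_hat n \<omega> \<in> Theta \<and> norm (\<theta>_hat n \<omega> - (\<gamma>0, 1)) \<le> C / sqrt (k n) \<longrightarrow>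
         \<bar>fst (inv_into Theta (rescale (a0 (real n / real (k n)))) (\<theta>_hat n \<omega>)) - \<gamma>0\<bar> \<le> C * (1 / sqrt (real (k n)))"
      proof eventually_elim
        case (elim n)
        show ?case
        proof (intro allI impI)
          fix \<omega> assume h: "\<theta>_hat n \<omega> \<in> Theta \<and> norm (\<theta>_hat n \<omega> - (\<gamma>0, 1)) \<le> C / sqrt (k n)"
          have est: "inv_into Theta (rescale (a0 (real n / real (k n)))) (\<theta>_hat n \<omega>)
            = (fst (\<theta>_hat n \<omega>), snd (\<theta>_hat n \<omega>) * a0 (real n / real (k n)))"
            by (rule inv_into_rescale[OF elim conjunct1[OF h]])
          have "\<bar>fst (\<theta>_hat n \<omega>) - \<gamma>0\<bar> \<le> norm (\<theta>_hat n \<omega> - (\<gamma>0, 1))"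
            using abs_coordinate_le_norm(1)[of "\<theta>_hat n \<omega> - (\<gamma>0, 1)"] by simp
          from order_trans[OF this conjunct2[OF h]]
          show "\<bar>fst (inv_into Theta (rescale (a0 (real n / real (k n)))) (\<theta>_hat n \<omega>)) - \<gamma>0\<bar> \<le> C * (1 / sqrt (real (k n)))"
            unfolding est using elim by simp
        qed
      qed
    qed
    moreover have "O_P M (\<lambda>n \<omega>. snd (inv_into Theta (rescale (a0 (real n / real (k n)))) (\<theta>_hat n \<omega>)) / a0 (real n / real (k n)) - 1) (\<lambda>n. 1 / sqrt (real (k n)))"
    proof (rule bound)
      fix C :: real
      from scale show "\<forall>\<^sub>F n in sequentially. \<forall>\<omega>. \<theta>_hat n \<omega> \<in> Theta \<and> norm (\<theta>_hat n \<omega> - (\<gamma>0, 1)) \<le> C / sqrt (k n) \<longrightarrow>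
         \<bar>snd (inv_into Theta (rescale (a0 (real n / real (k n)))) (\<theta>_hat n \<omega>)) / a0 (real n / real (k n)) - 1\<bar> \<le> C * (1 / sqrt (real (k n)))"
      proof eventually_elim
        case (elim n)
        show ?case
        proof (intro allI impI)
          fix \<omega> assume h: "\<theta>_hat n \<omega> \<in> Theta \<and> norm (\<theta>_hat n \<omega> - (\<gamma>0, 1)) \<le> C / sqrt (k n)"
          have est: "inv_into Theta (rescale (a0 (real n / real (k n)))) (\<theta>_hat n \<omega>)
            = (fst (\<theta>_hat n \<omega>), snd (\<theta>_hat n \<omega>) * a0 (real n / real (k n)))"
            by (rule inv_into_rescale[OF elim conjunct1[OF h]])
          have "\<bar>snd (\<theta>_hat n \<omega>) - 1\<bar> \<le> norm (\<theta>_hat n \<omega> - (\<gamma>0, 1))"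
            using abs_coordinate_le_norm(2)[of "\<theta>_hat n \<omega> - (\<gamma>0, 1)"] by simp
          from order_trans[OF this conjunct2[OF h]]
          show "\<bar>snd (inv_into Theta (rescale (a0 (real n / real (k n)))) (\<theta>_hat n \<omega>)) / a0 (real n / real (k n)) - 1\<bar> \<le> C * (1 / sqrt (real (k n)))"
            unfolding est using elim by simp
        qed
      qed
    qed
    ultimately show ?thesis unfolding Let_def by blast
  qed
  show ?thesis using \<epsilon> unique est by (intro exI[of _ \<epsilon>] conjI allI impI) (blast | assumption)+
qed

end
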